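(* Consider the multi-component Curie–Weiss Ising model described in the context, with $\mathbf K$ positive definite and $\beta=\beta_{cr}$. Then there exist constants $C_1,C_2>0$ (independent of $n$) such that the mixing time of the Glauber dynamics satisfies \[ C_1n^{3/2}\le t_{mix}^{(n)}\le C_2n^{3/2}. \]
   Context: Fix an integer $m\ge 1$, proportions $p_1,\dots,p_m>0$ with $\sum_i p_i=1$, and a symmetric matrix $\mathbf K=(k_{ij})_{1\le i,j\le m}$ with all $k_{ij}>0$. The parameter $n$ ranges over positive integers with $np_i\in\mathbb N$ for all $i$. The vertex set $V=\{1,\dots,n\}$ is partitioned into blocks $G_1,\dots,G_m$ with $|G_i|=np_i$; for $v\in G_i,w\in G_j$ put $K(v,w)=k_{ij}/n$. The state space is $\Omega=\{-1,+1\}^V$ and, for inverse temperature $\beta\ge0$, the Gibbs measure is $\mu_n(\sigma)\propto\exp\big(\beta\sum_{\{v,w\},v\ne w}K(v,w)\sigma(v)\sigma(w)\big)$. The Glauber dynamics $(\sigma_t)_{t\ge0}$ picks at each step a vertex $v$ uniformly from $V$ and sets its spin to $\pm1$ with probability $r_\pm(S^v)=\frac{1\pm\tanh(\beta S^v)}{2}$, $S^v=\sum_{w\ne v}K(v,w)\sigma(w)$, other spins unchanged. Let $d_n(t)=\max_{\sigma}\|\mathbb P_\sigma(\sigma_t\in\cdot)-\mu_n\|_{TV}$ and $t_{mix}^{(n)}=\min\{t: d_n(t)\le 1/4\}$. Let $\mathbf B=(p_ik_{ij})_{i,j}$ and let $\mathbf a>0$ be the left Perron eigenvector of $\mathbf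 B$ normalized by $\|\mathbf a\|_1=1$; define $\beta_{cr}:=\big(\sum_{i,j}a_ip_ik_{ij}\big)^{-1}$. *)

theory Defs
  imports "HOL-Analysis.Analysis"
begin

text \<open>Multi-component Curie--Weiss model. Components are indexed by 0..<m,
vertices by 0..<n; g v is the component of vertex v. Spin configurations are
functions nat => real with values in {-1,1} on 0..<n and 0 outside.\<close>

definition configs :: "nat \<Rightarrow> (nat \<Rightarrow> real) set" where
  "configs n = {\<sigma>. (\<forall>v<n. \<sigma> v = -1 \<or> \<sigma> v = 1) \<and> (\<forall>v\<ge>n. \<sigma> v = 0)}"

definition coupling :: "(nat \<Rightarrow> nat \<Rightarrow> real) \<Rightarrow> (nat \<Rightarrow> nat) \<Rightarrow> nat \<Rightarrow> nat \<Rightarrow> nat \<Rightarrow> real" where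
  "coupling k g n v w = k (g v) (g w) / real n"

definition local_field :: "(nat \<Rightarrow> nat \<Rightarrow> real) \<Rightarrow> (nat \<Rightarrow> nat) \<Rightarrow> nat \<Rightarrow> (nat \<Rightarrow> real) \<Rightarrow> nat \<Rightarrow> real" where
  "local_field k g n \<sigma> v = (\<Sum>w\<in>{0..<n} - {v}. coupling k g n v w * \<sigma> w)"

definition hamiltonian :: "(nat \<Rightarrow> nat \<Rightarrow> real) \<Rightarrow> (nat \<Rightarrow> nat) \<Rightarrow> nat \<Rightarrow> (nat \<Rightarrow> real) \<Rightarrow> real" where
  "hamiltonian k g n \<sigma> = (\<Sum>(v,w)\<in>{(v,w). v < w \<and> w < n}. coupling k g n v w * \<sigma> v * \<sigma> w)"

definition gibbs :: "(nat \<Rightarrow> nat \<Rightarrow> real) \<Rightarrow> (nat \<Rightarrow> nat) \<Rightarrow> nat \<Rightarrow> real \<Rightarrow> (nat \<Rightarrow> real) \<Rightarrow> real" where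
  "gibbs k g n \<beta> \<sigma> = exp (\<beta> * hamiltonian k g n \<sigma>)
     / (\<Sum>\<tau>\<in>configs n. exp (\<beta> * hamiltonian k g n \<tau>))"

definition glauber_step :: "(nat \<Rightarrow> nat \<Rightarrow> real) \<Rightarrow> (nat \<Rightarrow> nat) \<Rightarrow> nat \<Rightarrow> real
    \<Rightarrow> (nat \<Rightarrow> real) \<Rightarrow> (nat \<Rightarrow> real) \<Rightarrow> real" where
  "glauber_step k g n \<beta> \<sigma> \<tau> = (1 / real n) *
     (\<Sum>v\<in>{0..<n}. if (\<forall>w. w \<noteq> v \<longrightarrow> \<tau> w = \<sigma> w)
        then (1 + \<tau> v * tanh (\<beta> * local_field k g n \<sigma> v)) / 2 else 0)"

fun glauber_iter :: "(nat \<Rightarrow> nat \<Rightarrow> real) \<Rightarrow> (nat \<Rightarrow> nat) \<Rightarrow> nat \<Rightarrow> real \<Rightarrow> nat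
    \<Rightarrow> (nat \<Rightarrow> real) \<Rightarrow> (nat \<Rightarrow> real) \<Rightarrow> real" where
  "glauber_iter k g n \<beta> 0 \<sigma> \<tau> = (if \<tau> = \<sigma> then 1 else 0)"
| "glauber_iter k g n \<beta> (Suc t) \<sigma> \<tau> =
     (\<Sum>\<rho>\<in>configs n. glauber_iter k g n \<beta> t \<sigma> \<rho> * glauber_step k g n \<beta> \<rho> \<tau>)"

definition dist_stat :: "(nat \<Rightarrow> nat \<Rightarrow> real) \<Rightarrow> (nat \<Rightarrow> nat) \<Rightarrow> nat \<Rightarrow> real \<Rightarrow> nat \<Rightarrow> real" where
  "dist_stat k g n \<beta> t = (MAX \<sigma>\<in>configs n.
      (1/2) * (\<Sum>\<tau>\<in>configs n. \<bar>glauber_iter k g n \<beta> t \<sigma> \<tau> - gibbs k g n \<beta> \<tau>\<bar>))"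

definition mixing_time :: "(nat \<Rightarrow> nat \<Rightarrow> real) \<Rightarrow> (nat \<Rightarrow> nat) \<Rightarrow> nat \<Rightarrow> real \<Rightarrow> nat" where
  "mixing_time k g n \<beta> = (LEAST t. dist_stat k g n \<beta> t \<le> 1/4)"

definition pos_def_mat :: "nat \<Rightarrow> (nat \<Rightarrow> nat \<Rightarrow> real) \<Rightarrow> bool" where
  "pos_def_mat m k \<longleftrightarrow> (\<forall>x :: nat \<Rightarrow> real. (\<exists>i<m. x i \<noteq> 0) \<longrightarrow>
      (\<Sum>i<m. \<Sum>j<m. x i * k i j * x j) > 0)"

text \<open>a is the normalized left Perron eigenvector of B = (p_i k_ij): positive,
l1-normalized, and a left eigenvector. (For a positive matrix the positive
eigenvector is unique up to scaling, by Perron--Frobenius.)\<close>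
definition left_perron_vec :: "nat \<Rightarrow> (nat \<Rightarrow> real) \<Rightarrow> (nat \<Rightarrow> nat \<Rightarrow> real) \<Rightarrow> (nat \<Rightarrow> real) \<Rightarrow> bool" where
  "left_perron_vec m p k a \<longleftrightarrow> (\<forall>i<m. a i > 0) \<and> (\<Sum>i<m. a i) = 1 \<and>
     (\<exists>r. \<forall>j<m. (\<Sum>i<m. a i * (p i * k i j)) = r * a j)"

definition beta_cr :: "nat \<Rightarrow> (nat \<Rightarrow> real) \<Rightarrow> (nat \<Rightarrow> nat \<Rightarrow> real) \<Rightarrow> (nat \<Rightarrow> real) \<Rightarrow> real" where
  "beta_cr m p k a = 1 / (\<Sum>i<m. \<Sum>j<m. a i * p i * k i j)"

end

theory Submission
  imports Defs
begin

text \<open>At \<open>\<beta> = \<beta>\<^sub>c\<^sub>r\<close> the nonnegative matrix \<open>J v w = \<beta> k (g v) (g w) / n\<close> has the positive eigenvector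
  \<open>v \<mapsto> a (g v)\<close> with eigenvalue 1; together with positive definiteness of \<open>k\<close> this gives
  \<open>0 \<le> J \<le> 1\<close> as quadratic forms.

  Upper bound. Write \<open>P\<close> for the Glauber operator and \<open>\<Gamma> f\<close> for the sum of the squared spin
  derivatives of \<open>f\<close>. Since \<open>J \<le> 1\<close>, differentiating \<open>P f\<close> gives
  \<open>\<Gamma> (P f) \<le> (1 + A / n\<^sup>2) P (\<Gamma> f)\<close>, and with \<open>P f\<^sup>2 - (P f)\<^sup>2 \<ge> c \<Gamma> f / n\<close> this yields the pointwise
  reverse Poincare inequality \<open>\<Gamma> (P\<^sup>t f) \<le> C n / t\<close> for \<open>t \<le> n\<^sup>2\<close> and \<open>\<bar>f\<bar> \<le> 1\<close>. Configurations that
  differ by a permutation inside the blocks are merged exponentially fast on the time scale \<open>n\<close>, hence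
  \<open>P\<^sup>t f\<close> is, up to a negligible error, a \<open>C / sqrt t\<close>-Lipschitz function of the block magnetizations.
  The form \<open>Y \<sigma> = \<langle>\<sigma>, J \<sigma>\<rangle>\<close> satisfies \<open>P Y \<le> Y - c Y\<^sup>2 / n\<^sup>2 + C / n\<close>, whence \<open>Y = O(sqrt n)\<close> and block
  magnetizations of order \<open>n\<^sup>3\<^sup>/\<^sup>4\<close> after \<open>n\<^sup>3\<^sup>/\<^sup>2\<close> steps from any start; another \<open>K n\<^sup>3\<^sup>/\<^sup>2\<close> steps with
  \<open>K\<close> large make the difference of \<open>P\<^sup>t f\<close> between any two starts small. Small \<open>n\<close> are handled by a
  Doeblin argument.

  Lower bound. The linear drift of \<open>F \<sigma> = \<Sum>v. a (g v) \<sigma> v\<close> vanishes. Started from \<open>F \<approx> L n\<^sup>3\<^sup>/\<^sup>4\<close> the process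
  \<open>F\<close> stays above \<open>L n\<^sup>3\<^sup>/\<^sup>4 / 2\<close> for \<open>c n\<^sup>3\<^sup>/\<^sup>2\<close> steps, an event that is unlikely at equilibrium.\<close>

section \<open>Elementary inequalities\<close>

text \<open>At criticality the Perron direction is preserved to first order, so gradient contraction
  alone yields no decay; decay has to come from accumulated one-step variance. Losing a factor
  \<open>1 + A / n^2\<close> per step is then harmless, since \<open>n^2\<close> lies far above the
  time scale \<open>n^(3/2)\<close>. The exponent 3/2 comes from matching scales. Noise
  \<open>1 / n\<close> balances the loss \<open>Y^2 / n^2\<close> at \<open>Y\<close> of order
  \<open>sqrt n\<close>; the transient \<open>n^2 / t\<close> of this recursion falls to that level
  at \<open>t\<close> of order \<open>n^(3/2)\<close>; and the Lipschitz constant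
  \<open>1 / sqrt t\<close> times the spread \<open>n^(3/4)\<close> of the magnetizations is small
  for \<open>t = K * n^(3/2)\<close> with \<open>K\<close> large. A bound \<open>C * n / t\<close>
  on a sum of squares would by itself allow a single derivative of order
  \<open>sqrt (n / t)\<close>, too large by \<open>sqrt n\<close>. Exchangeability inside the blocks
  spreads the sum evenly over order \<open>n\<close> sites; this is why permutations enter.\<close>

lemma tanh_real_diff_le:
  fixes x y :: real assumes "x \<le> y" shows "tanh y - tanh x \<le> y - x"
proof -
  have "(\<lambda>z. z - tanh z) x \<le> (\<lambda>z. z - tanh z) y"
  proof (rule DERIV_nonneg_imp_nondecreasing[OF assms])
    fix z :: real
    show "\<exists>d. ((\<lambda>z. z - tanh z) has_real_derivative d) (at z) \<and> 0 \<le> d"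
      by (rule exI[of _ "tanh z ^ 2"]) (auto intro!: derivative_eq_intros)
  qed
  then show ?thesis by simp
qed

lemma abs_tanh_real_diff_le: "\<bar>tanh x - tanh y\<bar> \<le> \<bar>x - (y::real)\<bar>"
proof (cases "x \<le> y")
  case True
  then have "tanh x \<le> tanh y" by simp
  then show ?thesis using True tanh_real_diff_le[OF True] by linarith
next
  case False
  then have "tanh y \<le> tanh x" by simp
  then show ?thesis using False tanh_real_diff_le[of y x] by linarith
qed

text \<open>A rational bound is enough: on \<open>[0, Q]\<close> it keeps \<open>tanh z\<close>
  above a fixed multiple of \<open>z\<close>, and \<open>tanh z ^ 2\<close> is the derivative of
  \<open>z - tanh z\<close>. The restoring force at criticality comes from here.\<close>

lemma tanh_real_ge_frac:
  fixes x :: real assumes "0 \<le> x" shows "x / (1 + x) \<le> tanh x"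
proof -
  have e: "exp (2 * x) \<ge> 1 + 2 * x" by (rule exp_ge_add_one_self_aux) (use assms in simp)
  have "tanh x = (1 - 1 / exp (2*x)) / (1 + 1 / exp (2*x))"
    unfolding tanh_real_altdef by (simp add: exp_minus inverse_eq_divide)
  also have "\<dots> = (exp (2*x) - 1) / (exp (2*x) + 1)"
    by (simp add: divide_simps)
  also have "\<dots> \<ge> x / (1 + x)"
  proof (rule mult_imp_div_pos_le)
    have "x \<le> (exp (2*x) - 1) * (1 + x) / (exp (2*x) + 1)"
      by (rule mult_imp_le_div_pos) (use e assms in \<open>simp_all add: algebra_simps add_pos_pos\<close>)
    then show "x \<le> (exp (2*x) - 1) / (exp (2*x) + 1) * (1 + x)" by simp
  qed (use assms in simp)
  finally show ?thesis .
qed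

lemma tanh_cubic_lower:
  fixes x Q :: real assumes "0 \<le> x" "x \<le> Q"
  shows "x ^ 3 / (3 * (1 + Q)\<^sup>2) \<le> x - tanh x"
proof -
  have "(\<lambda>z. z - tanh z - z ^ 3 / (3 * (1 + Q)\<^sup>2)) 0 \<le> (\<lambda>z. z - tanh z - z ^ 3 / (3 * (1 + Q)\<^sup>2)) x"
  proof (rule DERIV_nonneg_imp_nondecreasing[OF assms(1)])
    fix z :: real assume z: "0 \<le> z" "z \<le> x"
    have "z / (1 + Q) \<le> z / (1 + z)" using z assms by (intro divide_left_mono) auto
    then have "z / (1 + Q) \<le> tanh z" using tanh_real_ge_frac[OF z(1)] by linarith
    then have "(z / (1 + Q)) ^ 2 \<le> tanh z ^ 2" using z assms by (intro power_mono) auto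
    then have "0 \<le> tanh z ^ 2 - z ^ 2 / (1 + Q)\<^sup>2" by (simp add: power_divide)
    moreover have "((\<lambda>z. z - tanh z - z ^ 3 / (3 * (1 + Q)\<^sup>2)) has_real_derivative tanh z ^ 2 - z ^ 2 / (1 + Q)\<^sup>2) (at z)"
      using z assms by (auto intro!: derivative_eq_intros simp: field_simps)
    ultimately show "\<exists>d. ((\<lambda>z. z - tanh z - z ^ 3 / (3 * (1 + Q)\<^sup>2)) has_real_derivative d) (at z) \<and> 0 \<le> d"
      by blast
  qed
  then show ?thesis by simp
qed

lemma tanh_cubic_upper:
  fixes x :: real assumes "0 \<le> x" shows "x - tanh x \<le> x ^ 3"
proof -
  have "(\<lambda>z. z ^ 3 - (z - tanh z)) 0 \<le> (\<lambda>z. z ^ 3 - (z - tanh z)) x"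
  proof (rule DERIV_nonneg_imp_nondecreasing[OF assms(1)])
    fix z :: real assume z: "0 \<le> z" "z \<le> x"
    have "tanh z \<le> z" using tanh_real_diff_le[of 0 z] z by simp
    then have "tanh z ^ 2 \<le> z ^ 2" using z by (intro power_mono) auto
    then have "0 \<le> 3 * z ^ 2 - tanh z ^ 2" using zero_le_power2[of z] by linarith
    moreover have "((\<lambda>z. z ^ 3 - (z - tanh z)) has_real_derivative 3 * z ^ 2 - tanh z ^ 2) (at z)"
      by (auto intro!: derivative_eq_intros)
    ultimately show "\<exists>d. ((\<lambda>z. z ^ 3 - (z - tanh z)) has_real_derivative d) (at z) \<and> 0 \<le> d"
      by blast
  qed
  then show ?thesis by simp
qed

lemma abs_tanh_cubic_upper: "\<bar>x - tanh x\<bar> \<le> \<bar>x::real\<bar> ^ 3"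
proof (cases "0 \<le> x")
  case True
  then show ?thesis using tanh_cubic_upper[of x] tanh_real_diff_le[of 0 x] by simp
next
  case False
  then show ?thesis using tanh_cubic_upper[of "-x"] tanh_real_diff_le[of x 0] by simp
qed

lemma tanh_quartic_lower:
  fixes x Q :: real assumes "\<bar>x\<bar> \<le> Q"
  shows "x ^ 4 / (3 * (1 + Q)\<^sup>2) \<le> x\<^sup>2 - x * tanh x"
proof -
  have "\<bar>x\<bar> * (\<bar>x\<bar> ^ 3 / (3 * (1 + Q)\<^sup>2)) \<le> \<bar>x\<bar> * (\<bar>x\<bar> - tanh \<bar>x\<bar>)"
    by (intro mult_left_mono tanh_cubic_lower) (use assms in auto)
  moreover have "\<bar>x\<bar> * \<bar>x\<bar> ^ 3 = x ^ 4"
    by (simp add: power_numeral_reduce power2_eq_square abs_mult_self_eq flip: abs_mult mult.assoc)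
  moreover have "\<bar>x\<bar> * tanh \<bar>x\<bar> = x * tanh x" by (cases "x \<ge> 0") auto
  ultimately show ?thesis by (simp add: right_diff_distrib power2_eq_square)
qed

text \<open>The level \<open>sqrt (\<delta> / \<epsilon>)\<close> balances loss and noise. The extra
  \<open>\<delta>\<close> covers the overshoot of one step from below it; above the shifted level
  the excess obeys the pure recursion \<open>u - \<epsilon> * u^2\<close>. A quadratic loss brings
  any start below \<open>1 / \<epsilon>\<close> in one step, so \<open>z 0\<close> is absent from
  the bound and the index is \<open>Suc t\<close>.\<close>

lemma riccati_decay:
  fixes z :: "nat \<Rightarrow> real" and \<epsilon> \<delta> :: real
  assumes eps: "\<epsilon> > 0" and dlt: "\<delta> \<ge> 0"
    and step: "\<And>t. z (Suc t) \<le> z t - \<epsilon> * (z t)\<^sup>2 + \<delta>"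
  shows "z (Suc t) \<le> sqrt (\<delta> / \<epsilon>) + \<delta> + 1 / (\<epsilon> * real (Suc t))"
proof -
  define B where "B = sqrt (\<delta> / \<epsilon>)"
  have B: "B \<ge> 0" "\<epsilon> * B\<^sup>2 = \<delta>" using eps dlt by (auto simp: B_def)
  define u where "u t = z t - B - \<delta>" for t
  have st1: "u (Suc t) \<le> u t - \<epsilon> * (u t)\<^sup>2" if "u t \<ge> 0" for t
  proof -
    have "z t = B + (\<delta> + u t)" by (simp add: u_def)
    then have "(z t)\<^sup>2 = B\<^sup>2 + 2 * B * (\<delta> + u t) + (\<delta> + u t)\<^sup>2" by (simp add: power2_sum)
    moreover have "(u t)\<^sup>2 \<le> (\<delta> + u t)\<^sup>2" using that dlt by (intro power_mono) auto
    moreover have "0 \<le> 2 * B * (\<delta> + u t)" using that dlt B by simp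
    ultimately have "B\<^sup>2 + (u t)\<^sup>2 \<le> (z t)\<^sup>2" by linarith
    then have "\<epsilon> * (B\<^sup>2 + (u t)\<^sup>2) \<le> \<epsilon> * (z t)\<^sup>2" using eps by simp
    then show ?thesis using step[of t] B by (simp add: u_def algebra_simps)
  qed
  have st2: "u (Suc t) \<le> 0" if "u t \<le> 0" for t
  proof (cases "z t \<le> B")
    case True
    have "0 \<le> \<epsilon> * (z t)\<^sup>2" using eps by simp
    then show ?thesis using step[of t] True by (simp add: u_def)
  next
    case False
    then have "B\<^sup>2 \<le> (z t)\<^sup>2" using B by (intro power_mono) auto
    then have "\<delta> \<le> \<epsilon> * (z t)\<^sup>2" using B eps by (metis mult_le_cancel_left_pos)
    then show ?thesis using step[of t] that by (simp add: u_def)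
  qed
  \<comment> \<open>\<open>1 / (\<epsilon> * x)\<close> is a supersolution of the recursion; after
    scaling by \<open>\<epsilon>\<close> this is
    \<open>(1 - s) * (1 - s * x) + s^2 \<ge> 0\<close>.\<close>
  have q: "w - \<epsilon> * w\<^sup>2 \<le> 1 / (\<epsilon> * (x + 1))" if "x \<ge> 1" "w \<ge> 0" "w \<le> 1 / (\<epsilon> * x)" for w x :: real
  proof -
    define s where "s = \<epsilon> * w"
    have s: "0 \<le> s" "s * x \<le> 1" using that eps by (auto simp: s_def field_simps)
    have "0 \<le> (1 - s) * (1 - s * x) + s\<^sup>2" if "s \<le> 1" using that s by simp
    moreover have "s \<le> 1" using s \<open>x \<ge> 1\<close> by (smt (verit) mult_left_mono mult_cancel_left1)
    ultimately have "(s - s\<^sup>2) * (x + 1) \<le> 1" by (simp add: algebra_simps power2_eq_square)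
    moreover have "\<epsilon> * (w - \<epsilon> * w\<^sup>2) = s - s\<^sup>2" by (simp add: s_def power2_eq_square algebra_simps)
    ultimately have "(w - \<epsilon> * w\<^sup>2) * (\<epsilon> * (x + 1)) \<le> 1" by (metis mult.assoc mult.commute)
    then show ?thesis using eps that by (simp add: pos_le_divide_eq)
  qed
  have "u (Suc t) \<le> 1 / (\<epsilon> * real (Suc t))" for t
  proof (induction t)
    case 0
    show ?case
    proof (cases "u 0 \<ge> 0")
      case True
      have "0 \<le> (\<epsilon> * u 0 - 1)\<^sup>2 + \<epsilon> * u 0" using eps True by simp
      then have "\<epsilon> * (u 0 - \<epsilon> * (u 0)\<^sup>2) \<le> 1" by (simp add: power2_eq_square algebra_simps)
      then have "u 0 - \<epsilon> * (u 0)\<^sup>2 \<le> 1 / \<epsilon>" using eps by (simp add: field_simps)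
      then show ?thesis using st1[OF True] by simp
    next
      case False
      then show ?thesis using st2[of 0] eps by (simp add: order_trans[where y = 0])
    qed
  next
    case (Suc t)
    show ?case
    proof (cases "u (Suc t) \<ge> 0")
      case True
      then show ?thesis using st1[OF True] q[of "real (Suc t)" "u (Suc t)"] Suc
        by (simp add: algebra_simps)
    next
      case False
      then have "u (Suc (Suc t)) \<le> 0" using st2 by simp
      then show ?thesis using eps by (smt (verit) divide_nonneg_nonneg mult_nonneg_nonneg of_nat_0_le_iff)
    qed
  qed
  from this[of t] show ?thesis by (simp add: u_def B_def)
qed

text \<open>Cauchy-Schwarz with weights \<open>J v w * b w\<close> and \<open>J v w / b w\<close>;
  symmetry lets the hypothesis on \<open>b\<close> serve a second time, for the columns. It replaces
  spectral theory: a positive supersolution forces operator norm at most 1.\<close>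

lemma schur_test:
  fixes J :: "'a \<Rightarrow> 'a \<Rightarrow> real" and b h :: "'a \<Rightarrow> real"
  assumes fin: "finite V" and J: "\<And>v w. v \<in> V \<Longrightarrow> w \<in> V \<Longrightarrow> 0 \<le> J v w"
    and sym: "\<And>v w. v \<in> V \<Longrightarrow> w \<in> V \<Longrightarrow> J v w = J w v"
    and b: "\<And>v. v \<in> V \<Longrightarrow> b v > 0"
    and eig: "\<And>v. v \<in> V \<Longrightarrow> (\<Sum>w\<in>V. J v w * b w) \<le> b v"
  shows "(\<Sum>v\<in>V. (\<Sum>w\<in>V. J v w * h w)\<^sup>2) \<le> (\<Sum>v\<in>V. (h v)\<^sup>2)"
proof -
  have row: "(\<Sum>w\<in>V. J v w * h w)\<^sup>2 \<le> b v * (\<Sum>w\<in>V. J v w * (h w)\<^sup>2 / b w)" if v: "v \<in> V" for v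
  proof -
    have "(\<Sum>w\<in>V. J v w * h w)\<^sup>2 = (\<Sum>w\<in>V. sqrt (J v w * b w) * (sqrt (J v w / b w) * h w))\<^sup>2"
    proof -
      have "J v w * h w = sqrt (J v w * b w) * (sqrt (J v w / b w) * h w)" if w: "w \<in> V" for w
      proof -
        have "sqrt (J v w * b w) * sqrt (J v w / b w) = J v w"
          using J[OF v w] b[OF w] by (simp flip: real_sqrt_mult)
        then show ?thesis by (simp flip: mult.assoc)
      qed
      then show ?thesis by (intro arg_cong[where f = power2] sum.cong) auto
    qed
    also have "\<dots> \<le> (\<Sum>w\<in>V. (sqrt (J v w * b w))\<^sup>2) * (\<Sum>w\<in>V. (sqrt (J v w / b w) * h w)\<^sup>2)"
      by (rule Cauchy_Schwarz_ineq_sum)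
    also have "(\<Sum>w\<in>V. (sqrt (J v w * b w))\<^sup>2) = (\<Sum>w\<in>V. J v w * b w)"
      using J[OF v] b by (intro sum.cong) (auto simp: less_imp_le)
    also have "(\<Sum>w\<in>V. (sqrt (J v w / b w) * h w)\<^sup>2) = (\<Sum>w\<in>V. J v w * (h w)\<^sup>2 / b w)"
      using J[OF v] b by (intro sum.cong) (auto simp: less_imp_le power_mult_distrib)
    also have "(\<Sum>w\<in>V. J v w * b w) * (\<Sum>w\<in>V. J v w * (h w)\<^sup>2 / b w) \<le> b v * (\<Sum>w\<in>V. J v w * (h w)\<^sup>2 / b w)"
      using J[OF v] b by (intro mult_right_mono eig[OF v] sum_nonneg) (auto simp: less_imp_le)
    finally show ?thesis .
  qed
  have "(\<Sum>v\<in>V. (\<Sum>w\<in>V. J v w * h w)\<^sup>2) \<le> (\<Sum>v\<in>V. b v * (\<Sum>w\<in>V. J v w * (h w)\<^sup>2 / b w))"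
    by (intro sum_mono row)
  also have "\<dots> = (\<Sum>v\<in>V. \<Sum>w\<in>V. (J w v * b v) * ((h w)\<^sup>2 / b w))"
    by (simp add: sum_distrib_left sym mult_ac cong: sum.cong)
  also have "\<dots> = (\<Sum>w\<in>V. (\<Sum>v\<in>V. J w v * b v) * ((h w)\<^sup>2 / b w))"
    by (subst sum.swap) (simp add: sum_distrib_right sum_divide_distrib)
  also have "\<dots> \<le> (\<Sum>w\<in>V. b w * ((h w)\<^sup>2 / b w))"
    using b by (intro sum_mono mult_right_mono eig) (auto simp: less_imp_le)
  also have "\<dots> = (\<Sum>v\<in>V. (h v)\<^sup>2)"
    using b by (intro sum.cong) (auto dest: b)
  finally show ?thesis .
qed

lemma sum_sq_add_le:
  fixes x y :: "'a \<Rightarrow> real"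
  assumes "\<eta> > 0"
  shows "(\<Sum>v\<in>V. (x v + y v)\<^sup>2) \<le> (1 + \<eta>) * (\<Sum>v\<in>V. (x v)\<^sup>2) + (1 + 1 / \<eta>) * (\<Sum>v\<in>V. (y v)\<^sup>2)"
proof -
  have "(x v + y v)\<^sup>2 \<le> (1 + \<eta>) * (x v)\<^sup>2 + (1 + 1 / \<eta>) * (y v)\<^sup>2" for v
  proof -
    have "0 \<le> (\<eta> * x v - y v)\<^sup>2 / \<eta>" using assms by simp
    also have "\<dots> = \<eta> * (x v)\<^sup>2 - 2 * x v * y v + (y v)\<^sup>2 / \<eta>"
      using assms by (simp add: power2_eq_square field_simps)
    finally show ?thesis by (simp add: power2_eq_square algebra_simps)
  qed
  then have "(\<Sum>v\<in>V. (x v + y v)\<^sup>2) \<le> (\<Sum>v\<in>V. (1 + \<eta>) * (x v)\<^sup>2 + (1 + 1 / \<eta>) * (y v)\<^sup>2)"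
    by (intro sum_mono)
  then show ?thesis by (simp add: sum.distrib sum_distrib_left)
qed

lemma sqrt_le_one_plus_sq: "0 \<le> x \<Longrightarrow> sqrt x \<le> 1 + x\<^sup>2"
proof (cases "x \<le> 1")
  case True
  then have "sqrt x \<le> 1" by simp
  then show ?thesis using zero_le_power2[of x] by linarith
next
  case False
  then have "sqrt x \<le> x" by (simp add: real_le_lsqrt power2_eq_square)
  moreover have "x \<le> x\<^sup>2" using False by (simp add: power2_eq_square)
  ultimately show ?thesis by linarith
qed

lemma exp_minus_le: "x > 0 \<Longrightarrow> exp (- x) \<le> 2 / x\<^sup>2" for x :: real
proof -
  assume x: "x > 0"
  have "x\<^sup>2 / 2 \<le> exp x" using exp_lower_Taylor_quadratic[of x] x by linarith
  then have "1 / exp x \<le> 1 / (x\<^sup>2 / 2)" using x by (intro divide_left_mono) auto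
  then show ?thesis by (simp add: exp_minus inverse_eq_divide)
qed

text \<open>The form attains a positive minimum on the compact unit sphere, and homogeneity extends
  the bound to all vectors.\<close>

lemma pos_def_mat_coercive:
  assumes "pos_def_mat m k"
  obtains \<kappa> :: real where "\<kappa> > 0"
    "\<And>x. \<kappa> * (\<Sum>i<m. (x i)\<^sup>2) \<le> (\<Sum>i<m. \<Sum>j<m. x i * k i j * x j)"
proof (cases "m = 0")
  case True
  then show ?thesis using that[of 1] by simp
next
  case m: False
  define f where "f x = (\<Sum>i<m. \<Sum>j<m. x i * k i j * x j)" for x :: "nat \<Rightarrow> real"
  define N where "N x = (\<Sum>i<m. (x i)\<^sup>2)" for x :: "nat \<Rightarrow> real"
  \<comment> \<open>Vectors are functions on all of \<open>nat\<close>; pinning the coordinates from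
    \<open>m\<close> on to 0 makes the box compact in the product topology.\<close>
  define B where "B = PiE UNIV (\<lambda>i. if i < m then {-1..1::real} else {0})"
  define S where "S = B \<inter> {x. N x = 1}"
  have "compactin (product_topology (\<lambda>_. euclidean) UNIV) B"
    unfolding B_def compactin_PiE by auto
  then have "compact B" by (simp add: euclidean_product_topology)
  moreover have "continuous_on UNIV N"
  proof -
    have "continuous_on UNIV (\<lambda>x :: nat \<Rightarrow> real. x i)" for i by (rule continuous_on_product_coordinates)
    then show ?thesis unfolding N_def[abs_def] by (intro continuous_on_sum continuous_on_power)
  qed
  then have "closed {x. N x = 1}" by (intro closed_Collect_eq) auto
  ultimately have "compact S" unfolding S_def by (rule compact_Int_closed)
  moreover have "S \<noteq> {}"
  proof -
    have "N (\<lambda>i. if i = 0 then 1 else 0) = (\<Sum>i<m. if i = 0 then 1 else 0)"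
      unfolding N_def by (intro sum.cong) auto
    then have "(\<lambda>i. if i = 0 then 1 else 0) \<in> S" using m by (auto simp: S_def B_def)
    then show ?thesis by blast
  qed
  moreover have "continuous_on UNIV f"
  proof -
    have "continuous_on UNIV (\<lambda>x :: nat \<Rightarrow> real. x i)" for i by (rule continuous_on_product_coordinates)
    then show ?thesis unfolding f_def[abs_def] by (intro continuous_on_sum continuous_on_mult continuous_on_const)
  qed
  then have "continuous_on S f" by (rule continuous_on_subset) simp
  ultimately have "\<exists>y\<in>S. \<forall>x\<in>S. f y \<le> f x" by (rule continuous_attains_inf)
  then obtain y where y: "y \<in> S" "\<And>x. x \<in> S \<Longrightarrow> f y \<le> f x" by blast
  have "\<exists>i<m. y i \<noteq> 0"
  proof (rule ccontr)
    assume "\<not> (\<exists>i<m. y i \<noteq> 0)"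
    then have "N y = 0" by (simp add: N_def)
    then show False using y by (simp add: S_def)
  qed
  then have fy: "f y > 0" using assms by (auto simp: pos_def_mat_def f_def)
  have "f y * N x \<le> f x" for x
  proof (cases "N x = 0")
    case True
    then have "x i = 0" if "i < m" for i
      using that unfolding N_def by (subst (asm) sum_nonneg_eq_0_iff) auto
    then show ?thesis using True by (simp add: f_def)
  next
    case False
    then have N: "N x > 0" by (simp add: N_def less_le sum_nonneg)
    define r where "r = sqrt (N x)"
    have r: "r > 0" "r * r = N x" using N by (auto simp: r_def)
    define x' where "x' i = (if i < m then x i / r else 0)" for i
    have N': "N x' = 1"
    proof -
      have "N x' = (\<Sum>i<m. (x i)\<^sup>2 / N x)"
        unfolding N_def[of x'] by (intro sum.cong) (auto simp: x'_def power_divide r(2)[symmetric] power2_eq_square)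
      also have "\<dots> = (\<Sum>i<m. (x i)\<^sup>2) / N x" by (rule sum_divide_distrib[symmetric])
      also have "\<dots> = N x / N x" by (simp only: N_def)
      finally show ?thesis using N by simp
    qed
    have "\<bar>x' i\<bar> \<le> 1" if "i < m" for i
    proof -
      have "(x' i)\<^sup>2 \<le> N x'" unfolding N_def using that by (intro member_le_sum) auto
      then show ?thesis using N' by (simp add: abs_square_le_1)
    qed
    then have "- 1 \<le> x' i" "x' i \<le> 1" if "i < m" for i using that by (fastforce simp: abs_le_iff)+
    moreover have "x' i = 0" if "\<not> i < m" for i using that by (simp add: x'_def)
    ultimately have "x' \<in> S" using N' by (auto simp: S_def B_def)
    then have "f y \<le> f x'" by (rule y(2))
    also have "f x' = f x / (r * r)"
      unfolding f_def sum_divide_distrib by (intro sum.cong) (auto simp: x'_def)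
    finally show ?thesis using r N by (simp add: field_simps)
  qed
  then show ?thesis using that[OF fy] by (simp add: f_def N_def)
qed

section \<open>The multi-component model\<close>

text \<open>\<open>q\<close> stands for \<open>\<beta> k\<close> at the critical \<open>\<beta>\<close>. No constant of the first locale depends on the system
  size \<open>n\<close> or on the block map \<open>g\<close>; this is what makes the final bounds uniform.\<close>

locale curie_weiss_params =
  fixes m :: nat and p a :: "nat \<Rightarrow> real" and q :: "nat \<Rightarrow> nat \<Rightarrow> real"
    and Q \<rho> \<alpha> \<kappa> :: real
  assumes rho_pos: "\<rho> > 0" and p_ge: "\<And>i. i < m \<Longrightarrow> \<rho> \<le> p i"
    and alpha_pos: "\<alpha> > 0" and a_ge: "\<And>i. i < m \<Longrightarrow> \<alpha> \<le> a i"
    and a_le_1: "\<And>i. i < m \<Longrightarrow> a i \<le> 1"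
    and q_nonneg: "\<And>i j. i < m \<Longrightarrow> j < m \<Longrightarrow> 0 \<le> q i j"
    and q_le: "\<And>i j. i < m \<Longrightarrow> j < m \<Longrightarrow> q i j \<le> Q"
    and q_sym: "\<And>i j. i < m \<Longrightarrow> j < m \<Longrightarrow> q i j = q j i"
    and q_eigen: "\<And>i. i < m \<Longrightarrow> (\<Sum>j<m. q i j * p j * a j) = a i"
    and kappa_pos: "\<kappa> > 0"
    and q_pos_def: "\<And>x. \<kappa> * (\<Sum>i<m. (x i)\<^sup>2) \<le> (\<Sum>i<m. \<Sum>j<m. x i * q i j * x j)"
    and Q_pos: "Q > 0"
begin

text \<open>Local fields lie in \<open>[-Q, Q]\<close>, so a resampled site takes either prescribed
  spin with probability at least \<open>c0\<close>, uniformly in \<open>n\<close>.\<close>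

definition c0 :: real where "c0 = (1 - tanh Q) / 2"

lemma c0_pos: "c0 > 0" and c0_le: "c0 \<le> 1 / 2"
  using tanh_real_lt_1[of Q] Q_pos by (auto simp: c0_def)

definition cA :: real where "cA = 2 * (1 + Q\<^sup>2) / c0"
lemma cA_pos: "cA > 0"
  unfolding cA_def using c0_pos by (intro divide_pos_pos mult_pos_pos add_pos_nonneg) auto

text \<open>In this order: the quadratic loss of \<open>energy\<close>, its noise, the growth of its
  second moment, and the growth of the squared displacement of \<open>perron_mag\<close>.\<close>

definition c3 :: real where "c3 = 2 * (\<kappa> * \<rho>)\<^sup>2 / (3 * (1 + Q)\<^sup>2)"
definition cD :: real where "cD = 2 * Q\<^sup>2 + 4 * Q"
definition cE :: real where "cE = 2 * cD + 32 + 32 * Q\<^sup>2"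
definition cG :: real where "cG = 8 * sqrt (m / \<kappa>) * (Q + 1 / sqrt \<rho>) + 4"

lemma c3_pos: "c3 > 0"
  unfolding c3_def using kappa_pos rho_pos Q_pos by (intro divide_pos_pos mult_pos_pos zero_less_power) auto

lemma cD_pos: "cD > 0"
  unfolding cD_def using Q_pos by (intro add_pos_pos) auto

lemma cE_pos: "cE > 0"
  unfolding cE_def using Q_pos cD_pos by (intro add_pos_pos mult_pos_pos) auto

lemma cG_pos: "cG > 0"
  unfolding cG_def using Q_pos rho_pos kappa_pos by (intro add_nonneg_pos mult_nonneg_nonneg) auto

text \<open>The three terms of \<open>riccati_decay\<close> for \<open>c3 / n^2\<close> and
  \<open>cD / n\<close> from time \<open>n * sqrt n\<close> on, each estimated by a multiple of
  \<open>sqrt n\<close>.\<close>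

definition cR :: real where "cR = sqrt (cD / c3) + cD + 1 / c3"

lemma cR_pos: "cR > 0"
  unfolding cR_def using c3_pos cD_pos by (intro add_nonneg_pos add_pos_pos) auto

text \<open>\<open>cM * n^(3/4)\<close> bounds the mean total of absolute block magnetizations; up
  to the permutation error, \<open>cT / (cK * n * sqrt n)\<close> bounds squared spin derivatives
  after \<open>cK * n * sqrt n\<close> steps. The last two summands of \<open>cK\<close> bring the
  Lipschitz term and the permutation error below 1/4 each.\<close>

definition cM :: real where "cM = (cR / \<kappa> + m) / 2"
definition cT :: real where "cT = 4 * exp cA / (c0 * \<rho>)"
definition cK :: real where "cK = 1 + 16 * cT * cM\<^sup>2 + 16 * (cM + 1) / c0\<^sup>2"

lemma cM_nonneg: "cM \<ge> 0"
  unfolding cM_def using cR_pos kappa_pos by simp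

lemma cT_pos: "cT > 0"
  unfolding cT_def using c0_pos rho_pos by simp

lemma cK_ge: "1 \<le> cK" "16 * cT * cM\<^sup>2 \<le> cK" "16 * (cM + 1) / c0\<^sup>2 \<le> cK"
  using cM_nonneg cT_pos c0_pos by (auto simp: cK_def)

text \<open>The lower bound starts from level \<open>cL * n^(3/4)\<close>; the equilibrium second
  moment of \<open>perron_mag\<close> is at most 1/16 of its square. \<open>cl\<close> bounds the
  initial energy in units of \<open>sqrt n\<close>, and \<open>c1\<close> keeps the mean squared
  displacement below 1/16 of the same square.\<close>

definition cL :: real where "cL = sqrt (1 + 16 * m * cR / \<kappa>)"
definition cS :: real where "cS = (3 + m) / \<alpha> + m"
definition cl :: real where "cl = 1 + Q * (cS * cL)\<^sup>2"
definition c1 :: real where "c1 = min 1 (cL\<^sup>2 / (16 * cG * (1 + 2 * cl\<^sup>2 + cE * (cl + 1 + cD))))"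

lemma cL_sq: "cL\<^sup>2 = 1 + 16 * m * cR / \<kappa>" and cL_ge_1: "cL \<ge> 1"
proof -
  have "0 \<le> 16 * m * cR / \<kappa>" using cR_pos kappa_pos by simp
  then show "cL\<^sup>2 = 1 + 16 * m * cR / \<kappa>" "cL \<ge> 1" by (simp_all add: cL_def)
qed

lemma cl_ge_1: "cl \<ge> 1" unfolding cl_def using Q_pos by simp

lemma c1_pos: "c1 > 0"
proof -
  have "0 < 1 + 2 * cl\<^sup>2 + cE * (cl + 1 + cD)"
    using cl_ge_1 cE_pos cD_pos by (intro add_pos_nonneg mult_nonneg_nonneg) auto
  then show ?thesis unfolding c1_def using cG_pos cL_ge_1 by simp
qed

text \<open>The choice depends on \<open>n\<close> and \<open>c0\<close> but not on the block map,
  so that the finitely many small \<open>n\<close> can be covered by one constant.\<close>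

definition doeblin_steps :: "nat \<Rightarrow> nat" where "doeblin_steps n = (SOME j. 2 * (1 - (c0 / real n) ^ n) ^ j \<le> 1 / 2)"

lemma doeblin_steps: assumes "n > 0" shows "2 * (1 - (c0 / real n) ^ n) ^ doeblin_steps n \<le> 1 / 2"
  unfolding doeblin_steps_def
proof (rule someI_ex)
  have "0 < (c0 / n) ^ n" using c0_pos assms by simp
  then obtain j where "(1 - (c0 / n) ^ n) ^ j < 1 / 4"
    using real_arch_pow_inv[of "1 / 4" "1 - (c0 / n) ^ n"] by auto
  then show "\<exists>j. 2 * (1 - (c0 / real n) ^ n) ^ j \<le> 1 / 2" by (intro exI[of _ j]) simp
qed

end

locale curie_weiss = curie_weiss_params +
  fixes n :: nat and g :: "nat \<Rightarrow> nat"
  assumes n_pos: "n > 0" and g_less: "\<And>v. v < n \<Longrightarrow> g v < m"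
    and card_block: "\<And>i. i < m \<Longrightarrow> real (card {v. v < n \<and> g v = i}) = real n * p i"
begin

section \<open>The Glauber operator\<close>

text \<open>The diagonal is kept, so that \<open>J\<close> has an exact Perron eigenvector; the
  local field \<open>spin_field\<close> omits it, a discrepancy of at most
  \<open>Q / n\<close>.\<close>

definition J :: "nat \<Rightarrow> nat \<Rightarrow> real" where "J v w = q (g v) (g w) / real n"

definition spin_field :: "(nat \<Rightarrow> real) \<Rightarrow> nat \<Rightarrow> real" where
  "spin_field \<sigma> v = (\<Sum>w\<in>{..<n} - {v}. J v w * \<sigma> w)"

definition rate_plus :: "(nat \<Rightarrow> real) \<Rightarrow> nat \<Rightarrow> real" where
  "rate_plus \<sigma> v = (1 + tanh (spin_field \<sigma> v)) / 2"

definition resample :: "nat \<Rightarrow> ((nat \<Rightarrow> real) \<Rightarrow> real) \<Rightarrow> (nat \<Rightarrow> real) \<Rightarrow> real" where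
  "resample v f \<sigma> = rate_plus \<sigma> v * f (\<sigma>(v := 1)) + (1 - rate_plus \<sigma> v) * f (\<sigma>(v := -1))"

text \<open>The chain acts on observables rather than on distributions: the \<open>t\<close>-th
  iterate applied to \<open>f\<close> is the expectation of \<open>f\<close> at time
  \<open>t\<close>, so no path space is needed.\<close>

definition glauber_op :: "((nat \<Rightarrow> real) \<Rightarrow> real) \<Rightarrow> (nat \<Rightarrow> real) \<Rightarrow> real" where
  "glauber_op f \<sigma> = (\<Sum>v<n. resample v f \<sigma>) / real n"

abbreviation cf :: "(nat \<Rightarrow> real) set" where "cf \<equiv> configs n"

definition flip :: "nat \<Rightarrow> (nat \<Rightarrow> real) \<Rightarrow> nat \<Rightarrow> real" where
  "flip v \<sigma> = \<sigma>(v := - \<sigma> v)"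

text \<open>Taken between the two spin values instead of along a flip: the result ignores
  \<open>\<sigma> v\<close> and keeps its sign, as is needed to commute it with the
  operator.\<close>

definition spin_diff :: "nat \<Rightarrow> ((nat \<Rightarrow> real) \<Rightarrow> real) \<Rightarrow> (nat \<Rightarrow> real) \<Rightarrow> real" where
  "spin_diff v f \<sigma> = f (\<sigma>(v := 1)) - f (\<sigma>(v := -1))"

definition grad_sq :: "((nat \<Rightarrow> real) \<Rightarrow> real) \<Rightarrow> (nat \<Rightarrow> real) \<Rightarrow> real" where
  "grad_sq f \<sigma> = (\<Sum>v<n. (spin_diff v f \<sigma>)\<^sup>2)"

lemma cf_cases: "\<sigma> \<in> cf \<Longrightarrow> v < n \<Longrightarrow> \<sigma> v = 1 \<or> \<sigma> v = -1"
  by (auto simp: configs_def)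

lemma cf_resample [simp]: "\<sigma> \<in> cf \<Longrightarrow> v < n \<Longrightarrow> \<sigma>(v := 1) \<in> cf" "\<sigma> \<in> cf \<Longrightarrow> v < n \<Longrightarrow> \<sigma>(v := -1) \<in> cf"
  by (auto simp: configs_def)

lemma cf_flip [simp]: "\<sigma> \<in> cf \<Longrightarrow> v < n \<Longrightarrow> flip v \<sigma> \<in> cf"
  by (auto simp: configs_def flip_def)

lemma finite_cf [simp]: "finite cf"
proof -
  have "cf \<subseteq> (\<lambda>A v. if v < n then (if v \<in> A then 1 else -1) else 0) ` Pow {..<n}"
  proof
    fix \<sigma> assume "\<sigma> \<in> cf"
    then have "\<sigma> = (\<lambda>A v. if v < n then (if v \<in> A then 1 else -1) else 0) {v. v < n \<and> \<sigma> v = 1}"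
      by (auto simp: configs_def fun_eq_iff)
    then show "\<sigma> \<in> (\<lambda>A v. if v < n then (if v \<in> A then 1 else -1) else 0) ` Pow {..<n}" by blast
  qed
  then show ?thesis by (rule finite_subset) simp
qed

lemma J_nonneg: "v < n \<Longrightarrow> w < n \<Longrightarrow> 0 \<le> J v w"
  by (auto simp: J_def q_nonneg g_less)

lemma J_le: "v < n \<Longrightarrow> w < n \<Longrightarrow> J v w \<le> Q / n"
  by (auto simp: J_def g_less n_pos intro!: divide_right_mono q_le)

lemma J_sym: "v < n \<Longrightarrow> w < n \<Longrightarrow> J v w = J w v"
  by (auto simp: J_def q_sym g_less)

lemma sum_blocks:
  fixes h :: "nat \<Rightarrow> 'b::comm_monoid_add"
  shows "(\<Sum>v<n. h v) = (\<Sum>i<m. \<Sum>v | v < n \<and> g v = i. h v)"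
proof -
  have "(\<Sum>v<n. h v) = (\<Sum>i<m. \<Sum>v | v \<in> {..<n} \<and> g v = i. h v)"
    using g_less by (intro sum.group[symmetric]) auto
  then show ?thesis by simp
qed

lemma sum_blocks_const:
  fixes h :: "nat \<Rightarrow> real"
  shows "(\<Sum>v<n. h (g v)) = (\<Sum>i<m. real n * p i * h i)"
  by (subst sum_blocks) (auto simp: card_block intro!: sum.cong)

text \<open>Block sizes are exactly \<open>n * p i\<close>, so the block eigenvector lifts to the
  vertices without rounding error.\<close>

lemma J_eigen: "v < n \<Longrightarrow> (\<Sum>w<n. J v w * a (g w)) = a (g v)"
  using q_eigen[OF g_less, of v] n_pos sum_blocks_const[of "\<lambda>j. q (g v) j / real n * a j"]
  by (simp add: J_def mult_ac)

lemma abs_spin: "\<sigma> \<in> cf \<Longrightarrow> v < n \<Longrightarrow> \<bar>\<sigma> v\<bar> = 1"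
  by (auto dest: cf_cases)

lemma abs_spin_field_le: assumes "\<sigma> \<in> cf" "v < n" shows "\<bar>spin_field \<sigma> v\<bar> \<le> Q"
proof -
  have "\<bar>spin_field \<sigma> v\<bar> \<le> (\<Sum>w\<in>{..<n} - {v}. \<bar>J v w * \<sigma> w\<bar>)"
    unfolding spin_field_def by (rule sum_abs)
  also have "\<dots> \<le> (\<Sum>w\<in>{..<n} - {v}. Q / n)"
    using assms J_nonneg J_le by (intro sum_mono) (auto simp: abs_mult abs_spin)
  also have "\<dots> \<le> (\<Sum>w<n. Q / n)"
    using Q_pos by (intro sum_mono2) auto
  also have "\<dots> = Q" using n_pos by simp
  finally show ?thesis .
qed

lemma rate_plus_bounds: "0 < rate_plus \<sigma> v" "rate_plus \<sigma> v < 1"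
  using tanh_real_bounds[of "spin_field \<sigma> v"] by (auto simp: rate_plus_def)

lemma rate_plus_ge: assumes "\<sigma> \<in> cf" "v < n" shows "c0 \<le> rate_plus \<sigma> v" "c0 \<le> 1 - rate_plus \<sigma> v"
proof -
  have "tanh (spin_field \<sigma> v) \<le> tanh Q" "tanh (- Q) \<le> tanh (spin_field \<sigma> v)"
    using abs_spin_field_le[OF assms] by (auto simp only: tanh_real_le_iff)
  then show "c0 \<le> rate_plus \<sigma> v" "c0 \<le> 1 - rate_plus \<sigma> v" by (auto simp: c0_def rate_plus_def field_simps)
qed

lemma resample_add: "resample v (\<lambda>\<sigma>. f \<sigma> + h \<sigma>) = (\<lambda>\<sigma>. resample v f \<sigma> + resample v h \<sigma>)"
  by (auto simp: resample_def algebra_simps)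

lemma resample_diff: "resample v (\<lambda>\<sigma>. f \<sigma> - h \<sigma>) = (\<lambda>\<sigma>. resample v f \<sigma> - resample v h \<sigma>)"
  by (auto simp: resample_def algebra_simps)

lemma resample_cmult: "resample v (\<lambda>\<sigma>. c * f \<sigma>) = (\<lambda>\<sigma>. c * resample v f \<sigma>)"
  by (auto simp: resample_def algebra_simps)

lemma resample_const: "resample v (\<lambda>\<sigma>. c) = (\<lambda>\<sigma>. c)"
  by (auto simp: resample_def algebra_simps)

lemma glauber_op_add: "glauber_op (\<lambda>\<sigma>. f \<sigma> + h \<sigma>) = (\<lambda>\<sigma>. glauber_op f \<sigma> + glauber_op h \<sigma>)"
  by (simp add: glauber_op_def[abs_def] resample_add sum.distrib add_divide_distrib)

lemma glauber_op_diff: "glauber_op (\<lambda>\<sigma>. f \<sigma> - h \<sigma>) = (\<lambda>\<sigma>. glauber_op f \<sigma> - glauber_op h \<sigma>)"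
  by (simp add: glauber_op_def[abs_def] resample_diff sum_subtractf diff_divide_distrib)

lemma glauber_op_cmult: "glauber_op (\<lambda>\<sigma>. c * f \<sigma>) = (\<lambda>\<sigma>. c * glauber_op f \<sigma>)"
  by (simp add: glauber_op_def[abs_def] resample_cmult flip: sum_distrib_left)

lemma glauber_op_const: "glauber_op (\<lambda>\<sigma>. c) = (\<lambda>\<sigma>. c)"
  using n_pos by (simp add: glauber_op_def[abs_def] resample_const)

lemma glauber_op_sum: "finite S \<Longrightarrow> glauber_op (\<lambda>\<sigma>. \<Sum>i\<in>S. f i \<sigma>) = (\<lambda>\<sigma>. \<Sum>i\<in>S. glauber_op (f i) \<sigma>)"
  by (induction S rule: finite_induct) (auto simp: glauber_op_const glauber_op_add)

lemma resample_mono: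
  assumes "\<And>\<tau>. \<tau> \<in> cf \<Longrightarrow> f \<tau> \<le> h \<tau>" "\<sigma> \<in> cf" "v < n"
  shows "resample v f \<sigma> \<le> resample v h \<sigma>"
  using rate_plus_bounds[of \<sigma> v] assms by (auto simp: resample_def intro!: add_mono mult_left_mono)

lemma glauber_op_mono:
  assumes "\<And>\<tau>. \<tau> \<in> cf \<Longrightarrow> f \<tau> \<le> h \<tau>" "\<sigma> \<in> cf" shows "glauber_op f \<sigma> \<le> glauber_op h \<sigma>"
  unfolding glauber_op_def using assms by (intro divide_right_mono sum_mono resample_mono) auto

lemma glauber_op_nonneg:
  assumes "\<And>\<tau>. \<tau> \<in> cf \<Longrightarrow> 0 \<le> f \<tau>" "\<sigma> \<in> cf" shows "0 \<le> glauber_op f \<sigma>"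
  using glauber_op_mono[of "\<lambda>_. 0" f \<sigma>] assms by (simp add: glauber_op_const)

abbreviation iter_op :: "nat \<Rightarrow> ((nat \<Rightarrow> real) \<Rightarrow> real) \<Rightarrow> (nat \<Rightarrow> real) \<Rightarrow> real" where
  "iter_op t \<equiv> glauber_op ^^ t"

lemma Pit_Suc': "iter_op (Suc t) f = iter_op t (glauber_op f)"
  by (simp add: funpow_swap1)

lemma iter_op_add: "iter_op t (\<lambda>\<sigma>. f \<sigma> + h \<sigma>) = (\<lambda>\<sigma>. iter_op t f \<sigma> + iter_op t h \<sigma>)"
  by (induction t) (auto simp: glauber_op_add)

lemma iter_op_diff: "iter_op t (\<lambda>\<sigma>. f \<sigma> - h \<sigma>) = (\<lambda>\<sigma>. iter_op t f \<sigma> - iter_op t h \<sigma>)"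
  by (induction t) (auto simp: glauber_op_diff)

lemma iter_op_cmult: "iter_op t (\<lambda>\<sigma>. c * f \<sigma>) = (\<lambda>\<sigma>. c * iter_op t f \<sigma>)"
  by (induction t) (auto simp: glauber_op_cmult)

lemma iter_op_const: "iter_op t (\<lambda>\<sigma>. c) = (\<lambda>\<sigma>. c)"
  by (induction t) (auto simp: glauber_op_const)

lemma iter_op_mono:
  assumes "\<And>\<tau>. \<tau> \<in> cf \<Longrightarrow> f \<tau> \<le> h \<tau>" "\<sigma> \<in> cf" shows "iter_op t f \<sigma> \<le> iter_op t h \<sigma>"
  using assms(2) by (induction t arbitrary: \<sigma>) (auto simp: assms(1) intro: glauber_op_mono)

lemma iter_op_nonneg:
  assumes "\<And>\<tau>. \<tau> \<in> cf \<Longrightarrow> 0 \<le> f \<tau>" "\<sigma> \<in> cf" shows "0 \<le> iter_op t f \<sigma>"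
  using iter_op_mono[of "\<lambda>_. 0" f \<sigma>] assms by (simp add: iter_op_const)

lemma iter_op_square_le: assumes "\<sigma> \<in> cf" shows "(iter_op t f \<sigma>)\<^sup>2 \<le> iter_op t (\<lambda>\<sigma>. (f \<sigma>)\<^sup>2) \<sigma>"
proof -
  define x where "x = iter_op t f \<sigma>"
  have "0 \<le> iter_op t (\<lambda>\<tau>. (f \<tau> - x)\<^sup>2) \<sigma>" using assms by (intro iter_op_nonneg) auto
  also have "(\<lambda>\<tau>. (f \<tau> - x)\<^sup>2) = (\<lambda>\<tau>. (f \<tau>)\<^sup>2 - (2 * x) * f \<tau> + x\<^sup>2)"
    by (auto simp: power2_eq_square algebra_simps)
  also have "iter_op t \<dots> \<sigma> = iter_op t (\<lambda>\<tau>. (f \<tau>)\<^sup>2) \<sigma> - 2 * x * x + x\<^sup>2"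
    by (simp only: iter_op_add iter_op_diff iter_op_cmult iter_op_const x_def)
  finally show ?thesis by (simp add: x_def power2_eq_square)
qed

text \<open>Whatever site is chosen, one outcome is \<open>\<sigma>\<close> itself and the other its
  flip, each with conditional probability at least \<open>c0\<close>. The chain is thus lazy, and
  every flip has weight at least \<open>c0 / n\<close>.\<close>

lemma glauber_op_lower:
  assumes f: "\<And>\<tau>. \<tau> \<in> cf \<Longrightarrow> 0 \<le> f \<tau>" and s: "\<sigma> \<in> cf"
  shows "c0 * f \<sigma> + c0 / n * (\<Sum>v<n. f (flip v \<sigma>)) \<le> glauber_op f \<sigma>"
proof -
  have "c0 * f \<sigma> + c0 * f (flip v \<sigma>) \<le> resample v f \<sigma>" if v: "v < n" for v
  proof -
    have nn: "0 \<le> f (\<sigma>(v := 1))" "0 \<le> f (\<sigma>(v := -1))" using f s v by auto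
    have *: "c0 * f (\<sigma>(v := 1)) + c0 * f (\<sigma>(v := -1)) \<le> resample v f \<sigma>"
      unfolding resample_def using rate_plus_ge[OF s v] nn by (intro add_mono mult_right_mono) auto
    from cf_cases[OF s v] show ?thesis
    proof
      assume "\<sigma> v = 1"
      then have "\<sigma>(v := 1) = \<sigma>" "flip v \<sigma> = \<sigma>(v := -1)" by (auto simp: flip_def)
      with * show ?thesis by simp
    next
      assume "\<sigma> v = -1"
      then have "\<sigma>(v := -1) = \<sigma>" "flip v \<sigma> = \<sigma>(v := 1)" by (auto simp: flip_def)
      with * show ?thesis by simp
    qed
  qed
  then have "(\<Sum>v<n. c0 * f \<sigma> + c0 * f (flip v \<sigma>)) / n \<le> glauber_op f \<sigma>"
    unfolding glauber_op_def by (intro divide_right_mono sum_mono) auto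
  then show ?thesis using n_pos by (simp add: sum.distrib add_divide_distrib sum_distrib_left sum_divide_distrib)
qed

section \<open>Contraction of squared gradients\<close>

definition rate_diff :: "nat \<Rightarrow> nat \<Rightarrow> (nat \<Rightarrow> real) \<Rightarrow> real" where
  "rate_diff v w \<sigma> = (if w = v then 0 else rate_plus (\<sigma>(v := 1)) w - rate_plus (\<sigma>(v := -1)) w)"

lemma spin_field_resample_same: "spin_field (\<sigma>(v := s)) v = spin_field \<sigma> v"
  unfolding spin_field_def by (intro sum.cong) auto

lemma rate_plus_resample_same: "rate_plus (\<sigma>(v := s)) v = rate_plus \<sigma> v"
  by (simp add: rate_plus_def spin_field_resample_same)

lemma spin_field_resample_other: assumes "v < n" "w < n" "w \<noteq> v"
  shows "spin_field (\<sigma>(v := s)) w = spin_field (\<sigma>(v := t)) w + J w v * (s - t)"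
proof -
  have v: "v \<in> {..<n} - {w}" using assms by auto
  have "(\<Sum>u\<in>{..<n} - {w} - {v}. J w u * (\<sigma>(v := s)) u) = (\<Sum>u\<in>{..<n} - {w} - {v}. J w u * (\<sigma>(v := t)) u)"
    by (intro sum.cong) auto
  then show ?thesis
    unfolding spin_field_def by (subst (1 2) sum.remove[OF _ v]) (auto simp: algebra_simps)
qed

text \<open>The field moves by \<open>2 * J w v\<close>, \<open>tanh\<close> is 1-Lipschitz and the
  rate carries a factor 1/2. The constant 1 matters: \<open>J\<close> has norm 1, with no room for a
  larger factor.\<close>

lemma abs_rate_diff_le: assumes "v < n" "w < n" shows "\<bar>rate_diff v w \<sigma>\<bar> \<le> J v w"
proof (cases "w = v")
  case False
  have "\<bar>tanh (spin_field (\<sigma>(v := 1)) w) - tanh (spin_field (\<sigma>(v := -1)) w)\<bar> \<le> \<bar>J w v * 2\<bar>"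
    using abs_tanh_real_diff_le[of "spin_field (\<sigma>(v := 1)) w" "spin_field (\<sigma>(v := -1)) w"]
      spin_field_resample_other[OF assms False, of \<sigma> 1 "-1"] by simp
  moreover have "rate_diff v w \<sigma> = (tanh (spin_field (\<sigma>(v := 1)) w) - tanh (spin_field (\<sigma>(v := -1)) w)) / 2"
    using False by (simp add: rate_diff_def rate_plus_def field_simps)
  ultimately show ?thesis using J_nonneg[OF assms] J_sym[OF assms] by simp
qed (simp add: rate_diff_def J_nonneg assms)

lemma spin_diff_resample_same [simp]: "spin_diff v f (\<sigma>(v := s)) = spin_diff v f \<sigma>"
  by (simp add: spin_diff_def)

text \<open>The discrepancy term is evaluated at \<^term>\<open>flip v \<sigma>\<close>, a configuration that the
  dynamics started in \<^term>\<open>\<sigma>\<close> reaches in one step; this is what lets the error be absorbed by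
  the one-step variance below.\<close>

lemma spin_diff_resample:
  assumes s: "\<sigma> \<in> cf" and v: "v < n" and w: "w < n" and wv: "w \<noteq> v"
  shows "resample w f (\<sigma>(v := 1)) - resample w f (\<sigma>(v := -1)) =
    resample w (spin_diff v f) \<sigma> + rate_diff v w \<sigma> * spin_diff w f (flip v \<sigma>)"
  using cf_cases[OF s v]
proof
  assume sv: "\<sigma> v = 1"
  then have "\<sigma>(v := 1) = \<sigma>" by auto
  then have "rate_plus \<sigma> w = rate_plus (\<sigma>(v := 1)) w" by simp
  then show ?thesis using wv sv
    by (simp add: resample_def spin_diff_def rate_diff_def flip_def fun_upd_twist algebra_simps)
next
  assume sv: "\<sigma> v = -1"
  then have "\<sigma>(v := -1) = \<sigma>" by auto
  then have "rate_plus \<sigma> w = rate_plus (\<sigma>(v := -1)) w" by simp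
  then show ?thesis using wv sv
    by (simp add: resample_def spin_diff_def rate_diff_def flip_def fun_upd_twist algebra_simps)
qed

text \<open>Resampling \<open>v\<close> itself erases the dependence on the spin at
  \<open>v\<close>, whence the subtracted term. Other sites feel that spin through their rates,
  which gives the interaction term.\<close>

lemma spin_diff_glauber_op:
  assumes s: "\<sigma> \<in> cf" and v: "v < n"
  shows "spin_diff v (glauber_op f) \<sigma> = glauber_op (spin_diff v f) \<sigma> - spin_diff v f \<sigma> / n
    + (\<Sum>w<n. rate_diff v w \<sigma> * spin_diff w f (flip v \<sigma>)) / n"
proof -
  have "spin_diff v (glauber_op f) \<sigma> = (\<Sum>w<n. resample w f (\<sigma>(v := 1)) - resample w f (\<sigma>(v := -1))) / n"
    by (simp add: spin_diff_def glauber_op_def sum_subtractf diff_divide_distrib)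
  also have "(\<Sum>w<n. resample w f (\<sigma>(v := 1)) - resample w f (\<sigma>(v := -1)))
    = (\<Sum>w<n. resample w (spin_diff v f) \<sigma> - (if w = v then spin_diff v f \<sigma> else 0) + rate_diff v w \<sigma> * spin_diff w f (flip v \<sigma>))"
  proof (intro sum.cong refl)
    fix w assume "w \<in> {..<n}"
    then have w: "w < n" by simp
    show "resample w f (\<sigma>(v := 1)) - resample w f (\<sigma>(v := -1)) =
      resample w (spin_diff v f) \<sigma> - (if w = v then spin_diff v f \<sigma> else 0) + rate_diff v w \<sigma> * spin_diff w f (flip v \<sigma>)"
    proof (cases "w = v")
      case True
      then show ?thesis by (simp add: resample_def rate_diff_def rate_plus_resample_same algebra_simps)
    next
      case False
      then show ?thesis using spin_diff_resample[OF s v w False] by simp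
    qed
  qed
  also have "\<dots> = (\<Sum>w<n. resample w (spin_diff v f) \<sigma>) - spin_diff v f \<sigma> + (\<Sum>w<n. rate_diff v w \<sigma> * spin_diff w f (flip v \<sigma>))"
    using v by (simp add: sum.distrib sum_subtractf)
  finally show ?thesis by (simp add: glauber_op_def[of "spin_diff v f"] add_divide_distrib diff_divide_distrib)
qed

section \<open>One-step variance and the gradient estimates\<close>

definition step_var :: "((nat \<Rightarrow> real) \<Rightarrow> real) \<Rightarrow> (nat \<Rightarrow> real) \<Rightarrow> real" where
  "step_var f \<sigma> = glauber_op (\<lambda>\<tau>. (f \<tau>)\<^sup>2) \<sigma> - (glauber_op f \<sigma>)\<^sup>2"

lemma step_var_alt: "step_var f \<sigma> = glauber_op (\<lambda>\<tau>. (f \<tau> - glauber_op f \<sigma>)\<^sup>2) \<sigma>"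
proof -
  define x where "x = glauber_op f \<sigma>"
  have "(\<lambda>\<tau>. (f \<tau> - x)\<^sup>2) = (\<lambda>\<tau>. (f \<tau>)\<^sup>2 - (2 * x) * f \<tau> + x\<^sup>2)"
    by (auto simp: power2_eq_square algebra_simps)
  then have "glauber_op (\<lambda>\<tau>. (f \<tau> - x)\<^sup>2) \<sigma> = glauber_op (\<lambda>\<tau>. (f \<tau>)\<^sup>2) \<sigma> - 2 * x * x + x\<^sup>2"
    by (simp only: glauber_op_add glauber_op_diff glauber_op_cmult glauber_op_const x_def)
  then show ?thesis by (simp add: step_var_def x_def power2_eq_square)
qed

lemma step_var_lower:
  assumes s: "\<sigma> \<in> cf"
  shows "c0 * (f \<sigma> - glauber_op f \<sigma>)\<^sup>2 + c0 / n * (\<Sum>v<n. (f (flip v \<sigma>) - glauber_op f \<sigma>)\<^sup>2) \<le> step_var f \<sigma>"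
  unfolding step_var_alt using s by (intro glauber_op_lower) auto

lemma step_var_ge_self:
  assumes s: "\<sigma> \<in> cf" shows "c0 * (f \<sigma> - glauber_op f \<sigma>)\<^sup>2 \<le> step_var f \<sigma>"
proof -
  have "0 \<le> c0 / n * (\<Sum>v<n. (f (flip v \<sigma>) - glauber_op f \<sigma>)\<^sup>2)"
    using c0_pos by (intro mult_nonneg_nonneg sum_nonneg) auto
  then show ?thesis using step_var_lower[OF s, of f] by linarith
qed

lemma step_var_ge_flip:
  assumes s: "\<sigma> \<in> cf" shows "c0 / n * (\<Sum>v<n. (f (flip v \<sigma>) - glauber_op f \<sigma>)\<^sup>2) \<le> step_var f \<sigma>"
proof -
  have "0 \<le> c0 * (f \<sigma> - glauber_op f \<sigma>)\<^sup>2" using c0_pos by simp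
  then show ?thesis using step_var_lower[OF s, of f] by linarith
qed

lemma spin_diff_sq_eq: assumes "\<sigma> \<in> cf" "v < n" shows "(spin_diff v f \<sigma>)\<^sup>2 = (f (flip v \<sigma>) - f \<sigma>)\<^sup>2"
  using cf_cases[OF assms]
proof
  assume "\<sigma> v = 1"
  then have "\<sigma>(v := 1) = \<sigma>" "flip v \<sigma> = \<sigma>(v := -1)" by (auto simp: flip_def)
  then show ?thesis by (simp add: spin_diff_def power2_commute)
next
  assume "\<sigma> v = -1"
  then have "\<sigma>(v := -1) = \<sigma>" "flip v \<sigma> = \<sigma>(v := 1)" by (auto simp: flip_def)
  then show ?thesis by (simp add: spin_diff_def)
qed

text \<open>A derivative is a difference of two deviations from the mean, at \<open>\<sigma>\<close>
  and at a flip. The first occurs in all \<open>n\<close> terms, which is affordable because staying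
  put has probability at least \<open>c0\<close> rather than \<open>c0 / n\<close>.\<close>

lemma step_var_ge_grad_sq:
  assumes s: "\<sigma> \<in> cf" shows "c0 / (2 * n) * grad_sq f \<sigma> \<le> step_var f \<sigma>"
proof -
  define x where "x = glauber_op f \<sigma>"
  have "(spin_diff v f \<sigma>)\<^sup>2 \<le> 2 * ((f \<sigma> - x)\<^sup>2 + (f (flip v \<sigma>) - x)\<^sup>2)" if "v < n" for v
  proof -
    have "0 \<le> ((f (flip v \<sigma>) - x) + (f \<sigma> - x))\<^sup>2" by simp
    then show ?thesis unfolding spin_diff_sq_eq[OF s that] by (simp add: power2_eq_square algebra_simps)
  qed
  then have "grad_sq f \<sigma> \<le> (\<Sum>v<n. 2 * ((f \<sigma> - x)\<^sup>2 + (f (flip v \<sigma>) - x)\<^sup>2))"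
    unfolding grad_sq_def by (intro sum_mono) auto
  also have "\<dots> = 2 * n * (f \<sigma> - x)\<^sup>2 + 2 * (\<Sum>v<n. (f (flip v \<sigma>) - x)\<^sup>2)"
    by (simp add: sum.distrib flip: sum_distrib_left)
  finally have "c0 / (2 * n) * grad_sq f \<sigma> \<le> c0 / (2 * n) * (2 * n * (f \<sigma> - x)\<^sup>2 + 2 * (\<Sum>v<n. (f (flip v \<sigma>) - x)\<^sup>2))"
    using c0_pos by (intro mult_left_mono) auto
  also have "\<dots> = c0 * (f \<sigma> - x)\<^sup>2 + c0 / n * (\<Sum>v<n. (f (flip v \<sigma>) - x)\<^sup>2)"
    using n_pos by (simp add: field_simps)
  also have "\<dots> \<le> step_var f \<sigma>" unfolding x_def by (rule step_var_lower[OF s])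
  finally show ?thesis .
qed

lemma grad_sq_nonneg: "0 \<le> grad_sq f \<sigma>"
  by (auto simp: grad_sq_def intro: sum_nonneg)

text \<open>The main part \<open>x\<close> averages \<open>h\<close> with an image of
  \<open>h\<close> dominated by \<open>J\<close>, hence has norm at most that of \<open>h\<close>.
  The rest \<open>y\<close> compares derivatives at \<open>\<sigma>\<close> and its flips with their
  one-step means \<open>h\<close>; it carries a factor \<open>1 / n\<close> and is controlled by
  variances. These are available because the one-step mean of \<open>grad_sq f\<close> is the
  squared norm of \<open>h\<close> plus \<open>Va\<close>.\<close>

lemma grad_sq_glauber_op_le:
  assumes s: "\<sigma> \<in> cf"
  shows "grad_sq (glauber_op f) \<sigma> \<le> (1 + cA / (real n)\<^sup>2) * glauber_op (grad_sq f) \<sigma>"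
proof -
  define h where "h v = glauber_op (spin_diff v f) \<sigma>" for v
  define D where "D v = (\<Sum>w<n. rate_diff v w \<sigma> * h w)" for v
  define x where "x v = (1 - 1 / n) * h v + D v / n" for v
  define e2 where "e2 v = (\<Sum>w<n. rate_diff v w \<sigma> * (spin_diff w f (flip v \<sigma>) - h w))" for v
  define y where "y v = ((h v - spin_diff v f \<sigma>) + e2 v) / n" for v
  define Va where "Va = (\<Sum>v<n. step_var (spin_diff v f) \<sigma>)"
  \<comment> \<open>With this \<open>\<eta>\<close> the cost of \<open>y\<close> is
    \<open>(1 + 1 / \<eta>) * \<eta> = 1 + \<eta>\<close> times \<open>Va\<close>, the same factor
    as for the main part.\<close>
  define \<eta> where "\<eta> = cA / (real n)\<^sup>2"
  have n1: "1 \<le> real n" using n_pos by simp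
  have eta: "\<eta> > 0" using cA_pos n_pos by (simp add: \<eta>_def)
  have Vv: "0 \<le> step_var (spin_diff v f) \<sigma>" for v
    unfolding step_var_alt using s by (intro glauber_op_nonneg) auto
  have split: "spin_diff v (glauber_op f) \<sigma> = x v + y v" if "v < n" for v
    unfolding spin_diff_glauber_op[OF s that] x_def y_def D_def e2_def h_def using n_pos
    by (simp add: field_simps sum_subtractf)
  have D2: "(\<Sum>v<n. (D v)\<^sup>2) \<le> (\<Sum>v<n. (h v)\<^sup>2)"
  proof -
    have "(\<Sum>v<n. (D v)\<^sup>2) \<le> (\<Sum>v<n. (\<Sum>w<n. J v w * \<bar>h w\<bar>)\<^sup>2)"
    proof (intro sum_mono)
      fix v assume "v \<in> {..<n}"
      then have v: "v < n" by simp
      have "\<bar>D v\<bar> \<le> (\<Sum>w<n. \<bar>rate_diff v w \<sigma> * h w\<bar>)" unfolding D_def by (rule sum_abs)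
      also have "\<dots> \<le> (\<Sum>w<n. J v w * \<bar>h w\<bar>)"
        using abs_rate_diff_le[OF v] by (intro sum_mono) (auto simp: abs_mult intro!: mult_right_mono)
      finally show "(D v)\<^sup>2 \<le> (\<Sum>w<n. J v w * \<bar>h w\<bar>)\<^sup>2" by (rule abs_le_square_iff[THEN iffD1, OF order_trans]) auto
    qed
    also have "\<dots> \<le> (\<Sum>v<n. \<bar>h v\<bar>\<^sup>2)"
      by (rule schur_test[where b = "\<lambda>v. a (g v)"])
        (use J_nonneg J_sym J_eigen a_ge alpha_pos g_less in \<open>force+\<close>)
    finally show ?thesis by simp
  qed
  have x2: "(\<Sum>v<n. (x v)\<^sup>2) \<le> (\<Sum>v<n. (h v)\<^sup>2)"
  proof -
    have "(x v)\<^sup>2 \<le> (1 - 1 / n) * (h v)\<^sup>2 + 1 / n * (D v)\<^sup>2" for v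
    proof -
      have "(1 - 1 / n) * (h v)\<^sup>2 + 1 / n * (D v)\<^sup>2 - (x v)\<^sup>2 = (1 - 1 / n) * (1 / n) * (h v - D v)\<^sup>2"
        unfolding x_def by (simp add: power2_eq_square algebra_simps)
      also have "\<dots> \<ge> 0" using n1 by (intro mult_nonneg_nonneg) auto
      finally show ?thesis by linarith
    qed
    then have "(\<Sum>v<n. (x v)\<^sup>2) \<le> (1 - 1 / n) * (\<Sum>v<n. (h v)\<^sup>2) + 1 / n * (\<Sum>v<n. (D v)\<^sup>2)"
      unfolding sum_distrib_left sum.distrib[symmetric] by (intro sum_mono)
    also have "\<dots> \<le> (1 - 1 / n) * (\<Sum>v<n. (h v)\<^sup>2) + 1 / n * (\<Sum>v<n. (h v)\<^sup>2)"
      using D2 n1 by (intro add_mono mult_left_mono) auto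
    finally show ?thesis by (simp add: algebra_simps)
  qed
  have e22: "(\<Sum>v<n. (e2 v)\<^sup>2) \<le> Q\<^sup>2 / c0 * Va"
  proof -
    have "(e2 v)\<^sup>2 \<le> Q\<^sup>2 / n * (\<Sum>w<n. (spin_diff w f (flip v \<sigma>) - h w)\<^sup>2)" if v: "v < n" for v
    proof -
      have "(e2 v)\<^sup>2 \<le> (\<Sum>w<n. (rate_diff v w \<sigma>)\<^sup>2) * (\<Sum>w<n. (spin_diff w f (flip v \<sigma>) - h w)\<^sup>2)"
        unfolding e2_def by (rule Cauchy_Schwarz_ineq_sum)
      also have "(\<Sum>w<n. (rate_diff v w \<sigma>)\<^sup>2) \<le> (\<Sum>w<n. (Q / n)\<^sup>2)"
      proof (intro sum_mono)
        fix w assume "w \<in> {..<n}"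
        then have "\<bar>rate_diff v w \<sigma>\<bar> \<le> Q / n" using order_trans[OF abs_rate_diff_le[OF v] J_le[OF v]] by simp
        then show "(rate_diff v w \<sigma>)\<^sup>2 \<le> (Q / n)\<^sup>2" using Q_pos by (intro abs_le_square_iff[THEN iffD1]) auto
      qed
      also have "\<dots> = Q\<^sup>2 / n" using n_pos by (simp add: power2_eq_square)
      finally show ?thesis by (simp add: mult_right_mono sum_nonneg)
    qed
    then have "(\<Sum>v<n. (e2 v)\<^sup>2) \<le> (\<Sum>v<n. Q\<^sup>2 / n * (\<Sum>w<n. (spin_diff w f (flip v \<sigma>) - h w)\<^sup>2))"
      by (intro sum_mono) auto
    \<comment> \<open>Exchanging the sums groups, for a fixed direction \<open>w\<close>, the
      derivative at all flips, which is what \<open>step_var_ge_flip\<close> controls.\<close>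
    also have "\<dots> = Q\<^sup>2 / c0 * (\<Sum>w<n. c0 / n * (\<Sum>v<n. (spin_diff w f (flip v \<sigma>) - h w)\<^sup>2))"
    proof -
      have sw: "(\<Sum>v<n. \<Sum>w<n. (spin_diff w f (flip v \<sigma>) - h w)\<^sup>2) = (\<Sum>w<n. \<Sum>v<n. (spin_diff w f (flip v \<sigma>) - h w)\<^sup>2)"
        by (rule sum.swap)
      show ?thesis unfolding sum_distrib_left[symmetric] sw using c0_pos by simp
    qed
    also have "\<dots> \<le> Q\<^sup>2 / c0 * Va"
      unfolding Va_def h_def using c0_pos s by (intro mult_left_mono sum_mono step_var_ge_flip) auto
    finally show ?thesis .
  qed
  have e12: "(\<Sum>v<n. (h v - spin_diff v f \<sigma>)\<^sup>2) \<le> 1 / c0 * Va"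
  proof -
    have "c0 * (\<Sum>v<n. (h v - spin_diff v f \<sigma>)\<^sup>2) \<le> Va"
      unfolding Va_def h_def sum_distrib_left
      by (subst power2_commute) (intro sum_mono step_var_ge_self s)
    then show ?thesis using c0_pos by (simp add: field_simps)
  qed
  have y2: "(\<Sum>v<n. (y v)\<^sup>2) \<le> \<eta> * Va"
  proof -
    have "(\<Sum>v<n. (y v)\<^sup>2) = (\<Sum>v<n. ((h v - spin_diff v f \<sigma>) + e2 v)\<^sup>2) / (real n)\<^sup>2"
      by (simp add: y_def power_divide sum_divide_distrib)
    also have "\<dots> \<le> (2 * (\<Sum>v<n. (h v - spin_diff v f \<sigma>)\<^sup>2) + 2 * (\<Sum>v<n. (e2 v)\<^sup>2)) / (real n)\<^sup>2"
      using sum_sq_add_le[of 1 "\<lambda>v. h v - spin_diff v f \<sigma>" e2 "{..<n}"] by (intro divide_right_mono) auto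
    also have "\<dots> \<le> (2 * (1 / c0 * Va) + 2 * (Q\<^sup>2 / c0 * Va)) / (real n)\<^sup>2"
      using e12 e22 by (intro divide_right_mono add_mono) auto
    also have "\<dots> = \<eta> * Va" unfolding \<eta>_def cA_def using c0_pos n_pos by (simp add: field_simps)
    finally show ?thesis .
  qed
  have "grad_sq (glauber_op f) \<sigma> = (\<Sum>v<n. (x v + y v)\<^sup>2)" unfolding grad_sq_def by (simp add: split)
  also have "\<dots> \<le> (1 + \<eta>) * (\<Sum>v<n. (x v)\<^sup>2) + (1 + 1 / \<eta>) * (\<Sum>v<n. (y v)\<^sup>2)"
    by (rule sum_sq_add_le[OF eta])
  also have "\<dots> \<le> (1 + \<eta>) * (\<Sum>v<n. (h v)\<^sup>2) + (1 + 1 / \<eta>) * (\<eta> * Va)"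
    using x2 y2 eta by (intro add_mono mult_left_mono) auto
  also have "\<dots> = (1 + \<eta>) * ((\<Sum>v<n. (h v)\<^sup>2) + Va)" using eta by (simp add: field_simps)
  also have "(\<Sum>v<n. (h v)\<^sup>2) + Va = glauber_op (grad_sq f) \<sigma>"
    by (simp add: Va_def step_var_def h_def sum_subtractf grad_sq_def[abs_def] glauber_op_sum)
  finally show ?thesis by (simp add: \<eta>_def)
qed

text \<open>Each step releases variance of at least a multiple of the current
  \<open>grad_sq\<close>. Contraction, read backwards, compares earlier contributions with that of
  the final function at the price of one factor \<open>1 + cA / n^2\<close> per step; all
  \<open>Suc t\<close> of them are counted with the worst factor.\<close>

lemma grad_sq_iter_op_reverse_Poincare:
  assumes s: "\<sigma> \<in> cf"
  shows "(iter_op (Suc t) f \<sigma>)\<^sup>2 + real (Suc t) * (c0 / (2 * n)) / (1 + cA / (real n)\<^sup>2) ^ t * grad_sq (iter_op t f) \<sigma>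
    \<le> iter_op (Suc t) (\<lambda>\<tau>. (f \<tau>)\<^sup>2) \<sigma>"
  using s
proof (induction t arbitrary: \<sigma>)
  case 0
  then show ?case using step_var_ge_grad_sq[OF 0, of f] by (simp add: step_var_def)
next
  case (Suc t)
  define b where "b = 1 + cA / (real n)\<^sup>2"
  define \<gamma> where "\<gamma> = c0 / (2 * n)"
  define K where "K = real (Suc t) * \<gamma> / b ^ t"
  define h where "h = iter_op (Suc t) f"
  have b: "b \<ge> 1" using cA_pos by (simp add: b_def)
  have gam: "\<gamma> \<ge> 0" using c0_pos by (simp add: \<gamma>_def)
  have K: "K \<ge> 0" using gam b by (simp add: K_def)
  have "glauber_op (\<lambda>\<tau>. (h \<tau>)\<^sup>2 + K * grad_sq (iter_op t f) \<tau>) \<sigma> \<le> glauber_op (iter_op (Suc t) (\<lambda>\<tau>. (f \<tau>)\<^sup>2)) \<sigma>"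
    using Suc.IH Suc.prems unfolding h_def K_def b_def \<gamma>_def by (intro glauber_op_mono) auto
  then have 1: "glauber_op (\<lambda>\<tau>. (h \<tau>)\<^sup>2) \<sigma> + K * glauber_op (grad_sq (iter_op t f)) \<sigma> \<le> iter_op (Suc (Suc t)) (\<lambda>\<tau>. (f \<tau>)\<^sup>2) \<sigma>"
    by (simp add: glauber_op_add glauber_op_cmult)
  have 2: "(glauber_op h \<sigma>)\<^sup>2 + \<gamma> * grad_sq h \<sigma> \<le> glauber_op (\<lambda>\<tau>. (h \<tau>)\<^sup>2) \<sigma>"
    using step_var_ge_grad_sq[OF Suc.prems, of h] by (simp add: step_var_def \<gamma>_def)
  have "grad_sq h \<sigma> \<le> b * glauber_op (grad_sq (iter_op t f)) \<sigma>"
    using grad_sq_glauber_op_le[OF Suc.prems, of "iter_op t f"] by (simp add: h_def b_def)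
  then have "K / b * grad_sq h \<sigma> \<le> K / b * (b * glauber_op (grad_sq (iter_op t f)) \<sigma>)"
    using K b by (intro mult_left_mono) auto
  then have 3: "K / b * grad_sq h \<sigma> \<le> K * glauber_op (grad_sq (iter_op t f)) \<sigma>" using b by simp
  have "1 \<le> b ^ Suc t" using b by (rule one_le_power)
  then have "\<gamma> / b ^ Suc t \<le> \<gamma> / 1" using gam by (intro divide_left_mono) auto
  then have "(\<gamma> / b ^ Suc t) * grad_sq h \<sigma> \<le> \<gamma> * grad_sq h \<sigma>" using grad_sq_nonneg by (intro mult_right_mono) auto
  moreover have "real (Suc (Suc t)) * \<gamma> / b ^ Suc t = K / b + \<gamma> / b ^ Suc t"
    using b by (simp add: K_def field_simps)
  ultimately have "real (Suc (Suc t)) * \<gamma> / b ^ Suc t * grad_sq h \<sigma> \<le> K / b * grad_sq h \<sigma> + \<gamma> * grad_sq h \<sigma>"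
    by (simp add: ring_distribs)
  with 1 2 3 show ?case by (simp add: h_def b_def \<gamma>_def)
qed

lemma grad_sq_iter_op_le:
  assumes s: "\<sigma> \<in> cf" and f: "\<And>\<tau>. \<tau> \<in> cf \<Longrightarrow> \<bar>f \<tau>\<bar> \<le> 1"
  shows "grad_sq (iter_op t f) \<sigma> \<le> 2 * n * (1 + cA / (real n)\<^sup>2) ^ t / (c0 * real (Suc t))"
proof -
  define b where "b = 1 + cA / (real n)\<^sup>2"
  have b: "b \<ge> 1" using cA_pos by (simp add: b_def)
  have "iter_op (Suc t) (\<lambda>\<tau>. (f \<tau>)\<^sup>2) \<sigma> \<le> iter_op (Suc t) (\<lambda>\<tau>. 1) \<sigma>"
    using s f by (intro iter_op_mono) (auto simp: abs_square_le_1)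
  then have "real (Suc t) * (c0 / (2 * n)) / b ^ t * grad_sq (iter_op t f) \<sigma> \<le> 1"
    using grad_sq_iter_op_reverse_Poincare[OF s, of t f] zero_le_power2[of "iter_op (Suc t) f \<sigma>"]
    unfolding b_def iter_op_const by linarith
  moreover have "b ^ t > 0" using b by simp
  ultimately have "grad_sq (iter_op t f) \<sigma> * (c0 * real (Suc t)) \<le> 2 * n * b ^ t"
    using n_pos by (simp add: field_simps)
  then have "grad_sq (iter_op t f) \<sigma> \<le> 2 * n * b ^ t / (c0 * real (Suc t))"
    using c0_pos by (subst pos_le_divide_eq) auto
  then show ?thesis by (simp add: b_def)
qed

section \<open>Permutations inside blocks and the Lipschitz estimate\<close>

abbreviation swap :: "nat \<Rightarrow> nat \<Rightarrow> nat \<Rightarrow> nat" where "swap \<equiv> Transposition.transpose"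

lemma swap_less: "u < n \<Longrightarrow> v < n \<Longrightarrow> swap u v w < n \<longleftrightarrow> w < n"
  by (auto simp: Transposition.transpose_def)

lemma swap_block: "g u = g v \<Longrightarrow> g (swap u v w) = g w"
  by (auto simp: Transposition.transpose_def)

lemma cf_swap [simp]: "\<sigma> \<in> cf \<Longrightarrow> u < n \<Longrightarrow> v < n \<Longrightarrow> \<sigma> \<circ> swap u v \<in> cf"
  by (auto simp: configs_def swap_less linorder_not_less[symmetric] simp del: linorder_not_less)

lemma spin_field_swap:
  assumes "u < n" "v < n" "g u = g v"
  shows "spin_field (\<sigma> \<circ> swap u v) w = spin_field \<sigma> (swap u v w)"
proof -
  have "swap u v x = swap u v w \<longleftrightarrow> x = w" for x by (metis transpose_involutory)
  then show ?thesis
    unfolding spin_field_def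
    by (intro sum.reindex_bij_witness[where i = "swap u v" and j = "swap u v"])
      (auto simp: swap_less assms J_def swap_block)
qed

lemma resample_fun_swap: "(\<sigma> \<circ> swap u v)(w := s) = \<sigma>(swap u v w := s) \<circ> swap u v"
  by (auto simp: fun_eq_iff) (metis transpose_involutory)+

lemma resample_swap:
  assumes "u < n" "v < n" "g u = g v"
  shows "resample w f (\<sigma> \<circ> swap u v) = resample (swap u v w) (\<lambda>\<tau>. f (\<tau> \<circ> swap u v)) \<sigma>"
  unfolding resample_def rate_plus_def spin_field_swap[OF assms] resample_fun_swap ..

lemma glauber_op_swap:
  assumes "u < n" "v < n" "g u = g v"
  shows "glauber_op f (\<sigma> \<circ> swap u v) = glauber_op (\<lambda>\<tau>. f (\<tau> \<circ> swap u v)) \<sigma>"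
proof -
  have "(\<Sum>w<n. resample w f (\<sigma> \<circ> swap u v)) = (\<Sum>w<n. resample w (\<lambda>\<tau>. f (\<tau> \<circ> swap u v)) \<sigma>)"
    by (rule sum.reindex_bij_witness[where i = "swap u v" and j = "swap u v"])
      (auto simp: swap_less assms resample_swap)
  then show ?thesis by (simp add: glauber_op_def)
qed

lemma swap_same: "\<sigma> u = \<sigma> v \<Longrightarrow> \<sigma> \<circ> swap u v = \<sigma>"
  by (auto simp: fun_eq_iff Transposition.transpose_def)

lemma abs_resample_le:
  assumes "\<And>\<tau>. \<tau> \<in> cf \<Longrightarrow> \<bar>h \<tau>\<bar> \<le> B" "\<sigma> \<in> cf" "v < n"
  shows "\<bar>resample v h \<sigma>\<bar> \<le> B"
  using resample_mono[of h "\<lambda>_. B" \<sigma> v] resample_mono[of "\<lambda>_. -B" h \<sigma> v] assms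
  by (simp add: resample_const abs_le_iff minus_le_iff)

text \<open>Two configurations that differ by a transposition inside a block coalesce, under the
  permuted coupling, as soon as one of the two sites is resampled to the right value.\<close>

lemma iter_op_swap_le:
  assumes f: "\<And>\<tau>. \<tau> \<in> cf \<Longrightarrow> \<bar>f \<tau>\<bar> \<le> 1" and uv: "u < n" "v < n" "g u = g v"
    and s: "\<sigma> \<in> cf"
  shows "\<bar>iter_op t f \<sigma> - iter_op t f (\<sigma> \<circ> swap u v)\<bar> \<le> 2 * (1 - c0 / n) ^ t"
proof (cases "u = v")
  case True
  have "c0 / n \<le> 1" using c0_le n_pos by (simp add: field_simps)
  then show ?thesis using True by simp
next
  case ne: False
  show ?thesis using s
  proof (induction t arbitrary: \<sigma>)
    case 0
    have "\<bar>f \<sigma>\<bar> \<le> 1" "\<bar>f (\<sigma> \<circ> swap u v)\<bar> \<le> 1" using 0 uv by (auto intro!: f)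
    then have "\<bar>f \<sigma> - f (\<sigma> \<circ> swap u v)\<bar> \<le> 2" by linarith
    then show ?case by (simp only: funpow_0 power_0 mult_1_right)
  next
    case (Suc t)
    define h where "h \<tau> = iter_op t f \<tau> - iter_op t f (\<tau> \<circ> swap u v)" for \<tau>
    define B where "B = 2 * (1 - c0 / n) ^ t"
    have "\<bar>iter_op t f \<sigma> - iter_op t f (\<sigma> \<circ> swap u v)\<bar> \<le> B" unfolding B_def by (rule Suc.IH[OF Suc.prems])
    then have B0: "B \<ge> 0" by linarith
    have hB: "\<bar>h \<tau>\<bar> \<le> B" if "\<tau> \<in> cf" for \<tau> unfolding h_def B_def by (rule Suc.IH[OF that])
    have h0: "h \<tau> = 0" if "\<tau> u = \<tau> v" for \<tau> using swap_same[of \<tau> u v] that by (simp add: h_def)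
    have "iter_op (Suc t) f \<sigma> - iter_op (Suc t) f (\<sigma> \<circ> swap u v) = glauber_op h \<sigma>"
      by (simp add: glauber_op_swap uv h_def[abs_def] glauber_op_diff)
    also have "\<bar>\<dots>\<bar> \<le> (\<Sum>w<n. \<bar>resample w h \<sigma>\<bar>) / n"
      unfolding glauber_op_def by (simp add: abs_divide divide_right_mono sum_abs)
    \<comment> \<open>Only the resampling of \<open>u\<close> is credited with coalescence; every
      other site, \<open>v\<close> included, is bounded by \<open>B\<close>. This already gives the
      rate \<open>c0 / n\<close>.\<close>
    also have "\<dots> \<le> (\<Sum>w<n. (if w = u then B - c0 * B else B)) / n"
    proof (intro divide_right_mono sum_mono)
      fix w assume "w \<in> {..<n}"
      then have w: "w < n" by simp
      have "\<bar>resample u h \<sigma>\<bar> \<le> (1 - c0) * B"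
        using cf_cases[OF Suc.prems uv(2)]
      proof
        assume "\<sigma> v = 1"
        then have "h (\<sigma>(u := 1)) = 0" using ne by (intro h0) auto
        then have "\<bar>resample u h \<sigma>\<bar> = (1 - rate_plus \<sigma> u) * \<bar>h (\<sigma>(u := -1))\<bar>"
          using rate_plus_bounds[of \<sigma> u] by (simp add: resample_def abs_mult)
        also have "\<dots> \<le> (1 - c0) * B"
          using rate_plus_ge[OF Suc.prems uv(1)] rate_plus_bounds[of \<sigma> u] hB Suc.prems uv c0_le by (intro mult_mono) auto
        finally show ?thesis .
      next
        assume "\<sigma> v = -1"
        then have "h (\<sigma>(u := -1)) = 0" using ne by (intro h0) auto
        then have "\<bar>resample u h \<sigma>\<bar> = rate_plus \<sigma> u * \<bar>h (\<sigma>(u := 1))\<bar>"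
          using rate_plus_bounds[of \<sigma> u] by (simp add: resample_def abs_mult)
        also have "\<dots> \<le> (1 - c0) * B"
          using rate_plus_ge[OF Suc.prems uv(1)] rate_plus_bounds[of \<sigma> u] hB Suc.prems uv c0_le by (intro mult_mono) auto
        finally show ?thesis .
      qed
      then show "\<bar>resample w h \<sigma>\<bar> \<le> (if w = u then B - c0 * B else B)"
        using abs_resample_le[OF hB Suc.prems w] by (simp add: algebra_simps)
    qed simp
    also have "(\<Sum>w<n. (if w = u then B - c0 * B else B)) = (\<Sum>w<n. B - (if w = u then c0 * B else 0))"
      by (intro sum.cong) auto
    also have "\<dots> = n * B - c0 * B" using uv by (simp add: sum_subtractf)
    also have "(n * B - c0 * B) / n = B * (1 - c0 / n)" using n_pos by (simp add: field_simps)
    finally show ?case by (simp add: B_def mult_ac)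
  qed
qed

lemma grad_sq_lower_bound_imp:
  assumes K: "grad_sq F \<tau> \<le> K" and S: "S \<subseteq> {..<n}" "real n * \<rho> / 2 \<le> real (card S)"
    and D: "\<And>w. w \<in> S \<Longrightarrow> D \<le> \<bar>spin_diff w F \<tau>\<bar>"
  shows "D \<le> sqrt (2 * K / (\<rho> * n))"
\<comment> \<open>In the application \<open>D\<close> is a derivative minus
  \<open>\<epsilon>\<close> and may be negative.\<close>
proof (cases "D \<le> 0")
  case True
  have "0 \<le> K" using K grad_sq_nonneg[of F \<tau>] by linarith
  then have "0 \<le> sqrt (2 * K / (\<rho> * n))" using rho_pos by simp
  then show ?thesis using True by linarith
next
  case False
  have "real n * \<rho> / 2 * D\<^sup>2 \<le> real (card S) * D\<^sup>2" using S by (intro mult_right_mono) auto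
  also have "\<dots> = (\<Sum>w\<in>S. D\<^sup>2)" by simp
  also have "\<dots> \<le> (\<Sum>w\<in>S. (spin_diff w F \<tau>)\<^sup>2)"
    using D False by (intro sum_mono abs_le_square_iff[THEN iffD1]) auto
  also have "\<dots> \<le> grad_sq F \<tau>" unfolding grad_sq_def using S by (intro sum_mono2) auto
  finally have "real n * \<rho> / 2 * D\<^sup>2 \<le> K" using K by linarith
  then have "D\<^sup>2 \<le> 2 * K / (\<rho> * n)" using rho_pos n_pos by (simp add: field_simps)
  then show ?thesis by (rule real_le_rsqrt)
qed

text \<open>The sites of a block that carry the same spin have, up to \<open>\<epsilon>\<close>, the same discrete
  derivative; as there are of order \<open>n\<close> of them, a bound on the sum of squares bounds each
  derivative.\<close>

lemma abs_spin_diff_le: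
  assumes K: "\<And>\<tau>. \<tau> \<in> cf \<Longrightarrow> grad_sq F \<tau> \<le> K"
    and eps: "\<And>u w \<tau>. u < n \<Longrightarrow> w < n \<Longrightarrow> g u = g w \<Longrightarrow> \<tau> \<in> cf \<Longrightarrow> \<bar>F \<tau> - F (\<tau> \<circ> swap u w)\<bar> \<le> \<epsilon>"
    and s: "\<sigma> \<in> cf" and v: "v < n"
  shows "\<bar>spin_diff v F \<sigma>\<bar> \<le> sqrt (2 * K / (\<rho> * n)) + \<epsilon>"
proof -
  define sp where "sp = \<sigma>(v := 1)"
  define sm where "sm = \<sigma>(v := -1)"
  have cf: "sp \<in> cf" "sm \<in> cf" using s v by (auto simp: sp_def sm_def)
  \<comment> \<open>The two sets cover the block of \<open>v\<close>, so one of them has at least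
    half of its sites.\<close>
  define A where "A = {w. w < n \<and> g w = g v \<and> sp w = 1}"
  define B where "B = {w. w < n \<and> g w = g v \<and> sm w = -1}"
  have fin: "finite A" "finite B" by (auto simp: A_def B_def)
  have "{w. w < n \<and> g w = g v} \<subseteq> A \<union> B"
    using cf_cases[OF s] by (auto simp: A_def B_def sp_def sm_def)
  then have "card {w. w < n \<and> g w = g v} \<le> card (A \<union> B)" using fin by (intro card_mono) auto
  also have "\<dots> \<le> card A + card B" by (rule card_Un_le)
  finally have "real n * p (g v) \<le> real (card A) + real (card B)"
    using card_block[OF g_less[OF v]] by linarith
  moreover have "real n * \<rho> \<le> real n * p (g v)" using p_ge[OF g_less[OF v]] by (intro mult_left_mono) auto
  ultimately have "real n * \<rho> / 2 \<le> real (card A) \<or> real n * \<rho> / 2 \<le> real (card B)" by linarith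
  then have "\<bar>spin_diff v F \<sigma>\<bar> - \<epsilon> \<le> sqrt (2 * K / (\<rho> * n))"
  proof
    assume A: "real n * \<rho> / 2 \<le> real (card A)"
    show ?thesis
    proof (rule grad_sq_lower_bound_imp[OF K[OF cf(1)] _ A])
      fix w assume "w \<in> A"
      then have w: "w < n" "g w = g v" "sp w = 1" by (auto simp: A_def)
      have 1: "sp(w := 1) = sp" using w by auto
      \<comment> \<open>Lowering \<open>w\<close> in \<open>sp\<close> in place of \<open>v\<close>
        gives \<open>sm\<close> with the two sites exchanged.\<close>
      have 2: "sp(w := -1) = sm \<circ> swap v w"
        using w by (auto simp: sp_def sm_def fun_eq_iff Transposition.transpose_def split: if_splits)
      have "\<bar>F sm - F (sm \<circ> swap v w)\<bar> \<le> \<epsilon>" using w v cf by (intro eps) auto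
      moreover have "spin_diff w F sp = F sp - F (sm \<circ> swap v w)" unfolding spin_diff_def 1 2 ..
      moreover have "spin_diff v F \<sigma> = F sp - F sm" by (simp add: spin_diff_def sp_def sm_def)
      ultimately show "\<bar>spin_diff v F \<sigma>\<bar> - \<epsilon> \<le> \<bar>spin_diff w F sp\<bar>" by linarith
    qed (auto simp: A_def)
  next
    assume B: "real n * \<rho> / 2 \<le> real (card B)"
    show ?thesis
    proof (rule grad_sq_lower_bound_imp[OF K[OF cf(2)] _ B])
      fix w assume "w \<in> B"
      then have w: "w < n" "g w = g v" "sm w = -1" by (auto simp: B_def)
      have 1: "sm(w := -1) = sm" using w by auto
      have 2: "sm(w := 1) = sp \<circ> swap v w"
        using w by (auto simp: sp_def sm_def fun_eq_iff Transposition.transpose_def split: if_splits)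
      have "\<bar>F sp - F (sp \<circ> swap v w)\<bar> \<le> \<epsilon>" using w v cf by (intro eps) auto
      moreover have "spin_diff w F sm = F (sp \<circ> swap v w) - F sm" unfolding spin_diff_def 1 2 ..
      moreover have "spin_diff v F \<sigma> = F sp - F sm" by (simp add: spin_diff_def sp_def sm_def)
      ultimately show "\<bar>spin_diff v F \<sigma>\<bar> - \<epsilon> \<le> \<bar>spin_diff w F sm\<bar>" by linarith
    qed (auto simp: B_def)
  qed
  then show ?thesis by linarith
qed

section \<open>Dependence on the block magnetizations\<close>

definition block_mag :: "nat \<Rightarrow> (nat \<Rightarrow> real) \<Rightarrow> real" where
  "block_mag i \<sigma> = (\<Sum>v | v < n \<and> g v = i. \<sigma> v)"

lemma block_mag_swap:
  assumes "u < n" "v < n" "g u = g v"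
  shows "block_mag i (\<sigma> \<circ> swap u v) = block_mag i \<sigma>"
  unfolding block_mag_def
  by (rule sum.reindex_bij_witness[where i = "swap u v" and j = "swap u v"])
    (auto simp: swap_less assms swap_block)

lemma block_mag_flip: "v < n \<Longrightarrow> block_mag i (flip v \<sigma>) = block_mag i \<sigma> - (if g v = i then 2 * \<sigma> v else 0)"
proof -
  assume v: "v < n"
  have "block_mag i (flip v \<sigma>) = (\<Sum>w | w < n \<and> g w = i. \<sigma> w - (if w = v then 2 * \<sigma> v else 0))"
    unfolding block_mag_def by (intro sum.cong) (auto simp: flip_def)
  also have "\<dots> = block_mag i \<sigma> - (if g v = i then 2 * \<sigma> v else 0)"
    using v by (auto simp: sum_subtractf block_mag_def)
  finally show ?thesis .
qed

text \<open>Opposite disagreements inside one block are removed by a transposition, at cost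
  \<open>\<epsilon>2\<close> and without changing any magnetization. Once a block has disagreements
  of one sign only, each flip brings its magnetization closer to the target by 2, at cost
  \<open>\<epsilon>1\<close>. At most \<open>n\<close> moves are made.\<close>

lemma Lipschitz_block_mag:
  assumes spin_diff: "\<And>v \<tau>. v < n \<Longrightarrow> \<tau> \<in> cf \<Longrightarrow> \<bar>spin_diff v F \<tau>\<bar> \<le> \<epsilon>1"
    and eps: "\<And>u w \<tau>. u < n \<Longrightarrow> w < n \<Longrightarrow> g u = g w \<Longrightarrow> \<tau> \<in> cf \<Longrightarrow> \<bar>F \<tau> - F (\<tau> \<circ> swap u w)\<bar> \<le> \<epsilon>2"
    and e2: "\<epsilon>2 \<ge> 0" and s: "\<sigma> \<in> cf" and t: "\<eta> \<in> cf"
  shows "\<bar>F \<sigma> - F \<eta>\<bar> \<le> \<epsilon>1 / 2 * (\<Sum>i<m. \<bar>block_mag i \<sigma> - block_mag i \<eta>\<bar>) + real n * \<epsilon>2"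
proof -
  \<comment> \<open>The induction carries the number of disagreements in place of \<open>n\<close>,
    since every move lowers it.\<close>
  have "\<bar>F \<sigma> - F \<eta>\<bar> \<le> \<epsilon>1 / 2 * (\<Sum>i<m. \<bar>block_mag i \<sigma> - block_mag i \<eta>\<bar>) + real (card {v. v < n \<and> \<sigma> v \<noteq> \<eta> v}) * \<epsilon>2"
    using s
  proof (induction "card {v. v < n \<and> \<sigma> v \<noteq> \<eta> v}" arbitrary: \<sigma> rule: less_induct)
    case less
    note s = less.prems
    let ?D = "\<lambda>\<sigma>. {v. v < n \<and> \<sigma> v \<noteq> \<eta> v}"
    have fin: "finite (?D \<sigma>)" for \<sigma> by simp
    have dec: "real (card (?D \<sigma>')) * \<epsilon>2 + \<epsilon>2 \<le> real (card (?D \<sigma>)) * \<epsilon>2"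
      if "card (?D \<sigma>') < card (?D \<sigma>)" for \<sigma>'
    proof -
      have "real (card (?D \<sigma>')) + 1 \<le> real (card (?D \<sigma>))" using that by linarith
      then have "(real (card (?D \<sigma>')) + 1) * \<epsilon>2 \<le> real (card (?D \<sigma>)) * \<epsilon>2" using e2 by (rule mult_right_mono)
      then show ?thesis by (simp add: algebra_simps)
    qed
    consider (eq) "?D \<sigma> = {}"
      | (swap) u w where "u < n" "w < n" "g u = g w" "\<sigma> u = 1" "\<eta> u = -1" "\<sigma> w = -1" "\<eta> w = 1"
      | (flip) v where "v \<in> ?D \<sigma>" "\<forall>w. w < n \<and> g w = g v \<and> \<sigma> w \<noteq> \<eta> w \<longrightarrow> \<sigma> w = \<sigma> v"
    proof (cases "?D \<sigma> = {}")
      case False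
      then obtain v where v: "v \<in> ?D \<sigma>" by blast
      show ?thesis
      proof (cases "\<forall>w. w < n \<and> g w = g v \<and> \<sigma> w \<noteq> \<eta> w \<longrightarrow> \<sigma> w = \<sigma> v")
        case True
        then show ?thesis using that(3) v by blast
      next
        case False
        then obtain w where w: "w < n" "g w = g v" "\<sigma> w \<noteq> \<eta> w" "\<sigma> w \<noteq> \<sigma> v" by blast
        have vn: "v < n" "\<sigma> v \<noteq> \<eta> v" using v by auto
        have c: "\<sigma> v = 1 \<or> \<sigma> v = -1" "\<eta> v = 1 \<or> \<eta> v = -1" "\<sigma> w = 1 \<or> \<sigma> w = -1" "\<eta> w = 1 \<or> \<eta> w = -1"
          using cf_cases[OF s] cf_cases[OF t] vn w by blast+
        show ?thesis
        proof (cases "\<sigma> v = 1")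
          case True
          then show ?thesis using that(2)[of v w] c w vn by force
        next
          case False
          then show ?thesis using that(2)[of w v] c w vn by force
        qed
      qed
    qed
    then show ?case
    proof cases
      case eq
      then have "\<sigma> w = \<eta> w" for w using s t by (cases "w < n") (auto simp: configs_def)
      then have "\<sigma> = \<eta>" by blast
      then show ?thesis by simp
    next
      case swap
      define \<sigma>' where "\<sigma>' = \<sigma> \<circ> swap u w"
      have s': "\<sigma>' \<in> cf" using s swap by (simp add: \<sigma>'_def)
      have eq: "\<sigma>' u = \<eta> u" "\<sigma>' w = \<eta> w" using swap by (simp_all add: \<sigma>'_def)
      have same: "\<sigma>' x = \<sigma> x" if "x \<noteq> u" "x \<noteq> w" for x using that by (simp add: \<sigma>'_def)
      have "?D \<sigma>' \<subseteq> ?D \<sigma> - {u, w}"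
      proof
        fix x assume x: "x \<in> ?D \<sigma>'"
        then have "x \<noteq> u" "x \<noteq> w" using eq by auto
        then show "x \<in> ?D \<sigma> - {u, w}" using x same[of x] by simp
      qed
      moreover have "u \<in> ?D \<sigma>" using swap by simp
      ultimately have "?D \<sigma>' \<subset> ?D \<sigma>" by blast
      then have lt: "card (?D \<sigma>') < card (?D \<sigma>)" by (rule psubset_card_mono[OF fin])
      have "\<bar>F \<sigma>' - F \<eta>\<bar> \<le> \<epsilon>1 / 2 * (\<Sum>i<m. \<bar>block_mag i \<sigma>' - block_mag i \<eta>\<bar>) + real (card (?D \<sigma>')) * \<epsilon>2"
        by (rule less.hyps[OF lt s'])
      moreover have "block_mag i \<sigma>' = block_mag i \<sigma>" for i unfolding \<sigma>'_def by (rule block_mag_swap) (use swap in auto)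
      moreover have "\<bar>F \<sigma> - F \<sigma>'\<bar> \<le> \<epsilon>2" unfolding \<sigma>'_def by (rule eps) (use swap s in auto)
      ultimately show ?thesis using dec[OF lt] by simp
    next
      case flip
      then have v: "v < n" "\<sigma> v \<noteq> \<eta> v" by auto
      define \<sigma>' where "\<sigma>' = flip v \<sigma>"
      have s': "\<sigma>' \<in> cf" using s v by (simp add: \<sigma>'_def)
      have eq: "\<sigma>' v = \<eta> v" using v cf_cases[OF s v(1)] cf_cases[OF t v(1)]
        by (auto simp: \<sigma>'_def flip_def)
      have same: "\<sigma>' x = \<sigma> x" if "x \<noteq> v" for x using that by (simp add: \<sigma>'_def flip_def)
      have "?D \<sigma>' \<subseteq> ?D \<sigma> - {v}"
      proof
        fix x assume x: "x \<in> ?D \<sigma>'"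
        then have "x \<noteq> v" using eq by auto
        then show "x \<in> ?D \<sigma> - {v}" using x same[of x] by simp
      qed
      then have "?D \<sigma>' \<subset> ?D \<sigma>" using v by auto
      then have lt: "card (?D \<sigma>') < card (?D \<sigma>)" by (rule psubset_card_mono[OF fin])
      have IH: "\<bar>F \<sigma>' - F \<eta>\<bar> \<le> \<epsilon>1 / 2 * (\<Sum>i<m. \<bar>block_mag i \<sigma>' - block_mag i \<eta>\<bar>) + real (card (?D \<sigma>')) * \<epsilon>2"
        by (rule less.hyps[OF lt s'])
      have "(spin_diff v F \<sigma>)\<^sup>2 = (F \<sigma>' - F \<sigma>)\<^sup>2" unfolding \<sigma>'_def by (rule spin_diff_sq_eq[OF s v(1)])
      then have "\<bar>F \<sigma> - F \<sigma>'\<bar> = \<bar>spin_diff v F \<sigma>\<bar>" by (metis abs_minus_commute power2_eq_iff abs_minus_cancel)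
      then have F: "\<bar>F \<sigma> - F \<sigma>'\<bar> \<le> \<epsilon>1" using spin_diff[OF v(1) s] by simp
      define i where "i = g v"
      have im: "i < m" using g_less v by (simp add: i_def)
      \<comment> \<open>All disagreements in the block have the sign found at \<open>v\<close>, so
        no term is negative and the flip cannot overshoot.\<close>
      have "2 \<le> \<sigma> v * (block_mag i \<sigma> - block_mag i \<eta>)"
      proof -
        have "2 \<le> \<sigma> v * (\<sigma> v - \<eta> v)" using cf_cases[OF s v(1)] cf_cases[OF t v(1)] v by auto
        also have "\<dots> \<le> (\<Sum>w | w < n \<and> g w = i. \<sigma> v * (\<sigma> w - \<eta> w))"
        proof (rule member_le_sum)
          fix w assume "w \<in> {w. w < n \<and> g w = i} - {v}"
          then have w: "w < n" "g w = g v" by (auto simp: i_def)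
          show "0 \<le> \<sigma> v * (\<sigma> w - \<eta> w)"
          proof (cases "\<sigma> w = \<eta> w")
            case False
            then have "\<sigma> w = \<sigma> v" using flip w by blast
            then show ?thesis using cf_cases[OF s v(1)] cf_cases[OF t w(1)] by auto
          qed simp
        qed (use v in \<open>auto simp: i_def\<close>)
        finally show ?thesis by (simp add: block_mag_def sum_subtractf sum_distrib_left right_diff_distrib)
      qed
      then have Mi: "\<bar>block_mag i \<sigma>' - block_mag i \<eta>\<bar> = \<bar>block_mag i \<sigma> - block_mag i \<eta>\<bar> - 2"
        using cf_cases[OF s v(1)] block_mag_flip[OF v(1), of i \<sigma>] by (auto simp: \<sigma>'_def i_def)
      have Mj: "block_mag j \<sigma>' = block_mag j \<sigma>" if "j \<noteq> i" for j
        using block_mag_flip[OF v(1), of j \<sigma>] that by (simp add: \<sigma>'_def i_def)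
      have "(\<Sum>j<m. \<bar>block_mag j \<sigma>' - block_mag j \<eta>\<bar>) = (\<Sum>j<m. \<bar>block_mag j \<sigma> - block_mag j \<eta>\<bar> - (if j = i then 2 else 0))"
        using Mi Mj by (intro sum.cong) auto
      also have "\<dots> = (\<Sum>j<m. \<bar>block_mag j \<sigma> - block_mag j \<eta>\<bar>) - 2" using im by (simp add: sum_subtractf)
      finally have S0: "(\<Sum>j<m. \<bar>block_mag j \<sigma>' - block_mag j \<eta>\<bar>) = (\<Sum>j<m. \<bar>block_mag j \<sigma> - block_mag j \<eta>\<bar>) - 2" .
      have S: "\<epsilon>1 / 2 * (\<Sum>j<m. \<bar>block_mag j \<sigma>' - block_mag j \<eta>\<bar>) = \<epsilon>1 / 2 * (\<Sum>j<m. \<bar>block_mag j \<sigma> - block_mag j \<eta>\<bar>) - \<epsilon>1"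
        unfolding S0 by (simp add: right_diff_distrib)
      show ?thesis using IH F S dec[OF lt] e2 by linarith
    qed
  qed
  moreover have "real (card {v. v < n \<and> \<sigma> v \<noteq> \<eta> v}) * \<epsilon>2 \<le> real n * \<epsilon>2"
    using e2 card_mono[of "{..<n}" "{v. v < n \<and> \<sigma> v \<noteq> \<eta> v}"] by (intro mult_right_mono) auto
  ultimately show ?thesis by linarith
qed

section \<open>The quadratic form and its drift\<close>

definition mean_field :: "(nat \<Rightarrow> real) \<Rightarrow> nat \<Rightarrow> real" where "mean_field z v = (\<Sum>w<n. J v w * z w)"

definition energy :: "(nat \<Rightarrow> real) \<Rightarrow> real" where "energy z = (\<Sum>v<n. z v * mean_field z v)"

definition block_field :: "(nat \<Rightarrow> real) \<Rightarrow> nat \<Rightarrow> real" where "block_field z i = (\<Sum>j<m. q i j * block_mag j z) / n"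

lemma mean_field_eq_block_field: "mean_field z v = block_field z (g v)"
proof -
  have "mean_field z v = (\<Sum>j<m. \<Sum>w | w < n \<and> g w = j. J v w * z w)"
    unfolding mean_field_def by (rule sum_blocks)
  also have "\<dots> = (\<Sum>j<m. q (g v) j / n * block_mag j z)"
    unfolding block_mag_def sum_distrib_left by (intro sum.cong refl) (auto simp: J_def)
  finally show ?thesis by (simp add: block_field_def sum_divide_distrib)
qed

lemma energy_eq_block_field: "energy z = (\<Sum>i<m. block_mag i z * block_field z i)"
  unfolding energy_def by (subst sum_blocks) (auto simp: block_mag_def mean_field_eq_block_field sum_distrib_right intro!: sum.cong)

lemma sum_block_mag_sq_le: "(\<Sum>i<m. (block_mag i z)\<^sup>2) \<le> n / \<kappa> * energy z"
proof -
  have "(\<Sum>i<m. \<Sum>j<m. block_mag i z * q i j * block_mag j z) = n * energy z"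
    using n_pos by (simp add: energy_eq_block_field block_field_def sum_distrib_left sum_divide_distrib mult_ac)
  then have "\<kappa> * (\<Sum>i<m. (block_mag i z)\<^sup>2) \<le> n * energy z" using q_pos_def[of "\<lambda>i. block_mag i z"] by simp
  then show ?thesis using kappa_pos by (simp add: field_simps)
qed

lemma energy_nonneg: "0 \<le> energy z"
proof -
  have "0 \<le> (\<Sum>i<m. (block_mag i z)\<^sup>2)" by (intro sum_nonneg) auto
  then have "0 \<le> n / \<kappa> * energy z" using sum_block_mag_sq_le[of z] by linarith
  then show ?thesis using kappa_pos n_pos by (simp add: zero_le_mult_iff zero_le_divide_iff)
qed

lemma mean_field_symm: "(\<Sum>v<n. y v * mean_field z v) = (\<Sum>v<n. z v * mean_field y v)"
proof -
  have "(\<Sum>v<n. y v * mean_field z v) = (\<Sum>v<n. \<Sum>w<n. y v * J v w * z w)"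
    by (simp add: mean_field_def sum_distrib_left mult_ac)
  also have "\<dots> = (\<Sum>w<n. \<Sum>v<n. y v * J v w * z w)" by (rule sum.swap)
  also have "\<dots> = (\<Sum>v<n. z v * mean_field y v)"
    unfolding mean_field_def sum_distrib_left by (intro sum.cong refl) (auto simp: J_sym)
  finally show ?thesis .
qed

text \<open>The Schur test with the Perron weights bounds the norm of \<open>J z\<close>; the
  arithmetic-geometric inequality turns this into the form inequality
  \<open>J \<le> 1\<close>.\<close>

lemma energy_le_sum_sq: "energy z \<le> (\<Sum>v<n. (z v)\<^sup>2)"
proof -
  have "(\<Sum>v<n. (mean_field z v)\<^sup>2) \<le> (\<Sum>v<n. (z v)\<^sup>2)"
    unfolding mean_field_def by (rule schur_test[where b = "\<lambda>v. a (g v)"])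
      (use J_nonneg J_sym J_eigen a_ge alpha_pos g_less in \<open>force+\<close>)
  moreover have "2 * energy z \<le> (\<Sum>v<n. (z v)\<^sup>2) + (\<Sum>v<n. (mean_field z v)\<^sup>2)"
    unfolding energy_def sum_distrib_left sum.distrib[symmetric]
  proof (intro sum_mono)
    fix v
    show "2 * (z v * mean_field z v) \<le> (z v)\<^sup>2 + (mean_field z v)\<^sup>2"
      using sum_squares_bound[of "z v" "mean_field z v"] by simp
  qed
  ultimately show ?thesis by linarith
qed

lemma mean_field_diff: "mean_field (\<lambda>v. y v - z v) w = mean_field y w - mean_field z w"
  by (simp add: mean_field_def sum_subtractf right_diff_distrib)

text \<open>This is \<open>J^2 \<le> J\<close>, obtained from \<open>0 \<le> J \<le> 1\<close>
  without diagonalizing: expand the nonnegative \<open>energy\<close> of \<open>z - J z\<close> and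
  bound the \<open>energy\<close> of \<open>J z\<close> by its squared norm.\<close>

lemma sum_mean_field_sq_le: "(\<Sum>v<n. (mean_field z v)\<^sup>2) \<le> energy z"
proof -
  have "0 \<le> energy (\<lambda>v. z v - mean_field z v)" by (rule energy_nonneg)
  also have "energy (\<lambda>v. z v - mean_field z v) =
      energy z - (\<Sum>v<n. z v * mean_field (mean_field z) v) - (\<Sum>v<n. mean_field z v * mean_field z v) + energy (mean_field z)"
    by (simp add: energy_def mean_field_diff algebra_simps sum_subtractf sum.distrib)
  also have "(\<Sum>v<n. z v * mean_field (mean_field z) v) = (\<Sum>v<n. mean_field z v * mean_field z v)" by (rule mean_field_symm)
  also have "(\<Sum>v<n. mean_field z v * mean_field z v) = (\<Sum>v<n. (mean_field z v)\<^sup>2)" by (simp add: power2_eq_square)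
  finally show ?thesis using energy_le_sum_sq[of "mean_field z"] by linarith
qed

lemma sum_block_field_sq_le: "n * \<rho> * (\<Sum>i<m. (block_field z i)\<^sup>2) \<le> (\<Sum>v<n. (mean_field z v)\<^sup>2)"
proof -
  have "(\<Sum>v<n. (mean_field z v)\<^sup>2) = (\<Sum>i<m. n * p i * (block_field z i)\<^sup>2)"
    unfolding mean_field_eq_block_field by (rule sum_blocks_const)
  also have "\<dots> \<ge> (\<Sum>i<m. n * \<rho> * (block_field z i)\<^sup>2)"
    using p_ge by (intro sum_mono mult_right_mono mult_left_mono) auto
  finally show ?thesis by (simp add: sum_distrib_left)
qed

text \<open>Converse of \<open>sum_mean_field_sq_le\<close> up to a constant: \<open>energy\<close>
  pairs block magnetizations with block fields, and the former are bounded by \<open>energy\<close>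
  itself, so one factor cancels.\<close>

lemma sum_mean_field_sq_ge: "\<kappa> * \<rho> * energy z \<le> (\<Sum>v<n. (mean_field z v)\<^sup>2)"
proof (cases "energy z = 0")
  case False
  then have energy: "energy z > 0" using energy_nonneg[of z] by simp
  have "(energy z)\<^sup>2 \<le> (\<Sum>i<m. (block_mag i z)\<^sup>2) * (\<Sum>i<m. (block_field z i)\<^sup>2)"
    unfolding energy_eq_block_field by (rule Cauchy_Schwarz_ineq_sum)
  also have "\<dots> \<le> (n / \<kappa> * energy z) * (\<Sum>i<m. (block_field z i)\<^sup>2)"
    by (intro mult_right_mono sum_block_mag_sq_le sum_nonneg) auto
  finally have "energy z * energy z \<le> energy z * (n / \<kappa> * (\<Sum>i<m. (block_field z i)\<^sup>2))"
    by (simp add: power2_eq_square mult_ac)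
  then have "energy z \<le> n / \<kappa> * (\<Sum>i<m. (block_field z i)\<^sup>2)" using energy by (rule mult_left_le_imp_le)
  then have "\<kappa> * \<rho> * energy z \<le> \<kappa> * \<rho> * (n / \<kappa> * (\<Sum>i<m. (block_field z i)\<^sup>2))"
    using kappa_pos rho_pos by (intro mult_left_mono) auto
  also have "\<dots> = n * \<rho> * (\<Sum>i<m. (block_field z i)\<^sup>2)" using kappa_pos by simp
  finally show ?thesis using sum_block_field_sq_le[of z] by linarith
qed (simp add: sum_nonneg)

lemma mean_field_sq_le: assumes "v < n" shows "(mean_field z v)\<^sup>2 \<le> energy z / (n * \<rho>)"
proof -
  have "(mean_field z v)\<^sup>2 \<le> (\<Sum>i<m. (block_field z i)\<^sup>2)"
    unfolding mean_field_eq_block_field by (rule member_le_sum) (use g_less assms in auto)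
  moreover have "n * \<rho> * (\<Sum>i<m. (block_field z i)\<^sup>2) \<le> energy z"
    using sum_block_field_sq_le sum_mean_field_sq_le order_trans by blast
  then have "(\<Sum>i<m. (block_field z i)\<^sup>2) \<le> energy z / (n * \<rho>)"
    using n_pos rho_pos by (subst pos_le_divide_eq) (auto simp: mult_ac)
  ultimately show ?thesis by linarith
qed

lemma abs_mean_field_le: assumes "\<sigma> \<in> cf" "v < n" shows "\<bar>mean_field \<sigma> v\<bar> \<le> Q"
proof -
  have "\<bar>mean_field \<sigma> v\<bar> \<le> (\<Sum>w<n. \<bar>J v w * \<sigma> w\<bar>)"
    unfolding mean_field_def by (rule sum_abs)
  also have "\<dots> \<le> (\<Sum>w<n. Q / n)"
    using assms J_nonneg J_le by (intro sum_mono) (auto simp: abs_mult abs_spin)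
  also have "\<dots> = Q" using n_pos by simp
  finally show ?thesis .
qed

lemma spin_field_eq_mean_field: "v < n \<Longrightarrow> spin_field \<sigma> v = mean_field \<sigma> v - J v v * \<sigma> v"
  unfolding spin_field_def mean_field_def by (subst sum.remove[of "{..<n}" v]) auto

lemma abs_tanh_spin_field_mean_field: assumes "\<sigma> \<in> cf" "v < n" shows "\<bar>tanh (spin_field \<sigma> v) - tanh (mean_field \<sigma> v)\<bar> \<le> Q / n"
proof -
  have "\<bar>spin_field \<sigma> v - mean_field \<sigma> v\<bar> = J v v" using assms J_nonneg[of v v] by (simp add: spin_field_eq_mean_field abs_mult abs_spin)
  then show ?thesis using abs_tanh_real_diff_le[of "spin_field \<sigma> v" "mean_field \<sigma> v"] J_le[of v v] assms by linarith
qed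

lemma energy_resample:
  assumes v: "v < n"
  shows "energy (\<sigma>(v := s)) = energy \<sigma> + 2 * (s - \<sigma> v) * mean_field \<sigma> v + J v v * (s - \<sigma> v)\<^sup>2"
proof -
  define d where "d = s - \<sigma> v"
  have mean_field: "mean_field (\<sigma>(v := s)) w = mean_field \<sigma> w + J w v * d" for w
  proof -
    have "mean_field (\<sigma>(v := s)) w = (\<Sum>u<n. J w u * \<sigma> u + (if u = v then J w v * d else 0))"
      unfolding mean_field_def by (intro sum.cong) (auto simp: d_def algebra_simps)
    then show ?thesis using v by (simp add: sum.distrib mean_field_def)
  qed
  have "energy (\<sigma>(v := s)) = (\<Sum>w<n. \<sigma> w * mean_field \<sigma> w + d * (J v w * \<sigma> w) + (if w = v then d * (mean_field \<sigma> v + J v v * d) else 0))"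
    unfolding energy_def mean_field
  proof (intro sum.cong refl)
    fix w assume "w \<in> {..<n}"
    then have "J w v = J v w" using v J_sym by simp
    then show "(\<sigma>(v := s)) w * (mean_field \<sigma> w + J w v * d)
      = \<sigma> w * mean_field \<sigma> w + d * (J v w * \<sigma> w) + (if w = v then d * (mean_field \<sigma> v + J v v * d) else 0)"
      by (auto simp: d_def algebra_simps)
  qed
  also have "\<dots> = energy \<sigma> + d * mean_field \<sigma> v + d * (mean_field \<sigma> v + J v v * d)"
    using v by (simp add: sum.distrib energy_def mean_field_def flip: sum_distrib_left)
  finally show ?thesis by (simp add: d_def power2_eq_square algebra_simps)
qed

text \<open>The new spin has mean \<open>tanh\<close> of the local field, and
  \<open>x * tanh x\<close> falls short of \<open>x^2\<close> by a quartic term. In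
  \<open>cD\<close>, the part \<open>4 * Q\<close> pays for the diagonal of \<open>J\<close> and
  \<open>2 * Q^2\<close> for replacing the local field by \<open>mean_field\<close>.\<close>

lemma resample_energy_le:
  assumes s: "\<sigma> \<in> cf" and v: "v < n"
  shows "resample v energy \<sigma> \<le> energy \<sigma> + 2 * (mean_field \<sigma> v)\<^sup>2 - 2 / (3 * (1 + Q)\<^sup>2) * (mean_field \<sigma> v) ^ 4 - 2 * \<sigma> v * mean_field \<sigma> v + cD / n"
proof -
  define x where "x = mean_field \<sigma> v"
  define t where "t = tanh (spin_field \<sigma> v)"
  define r where "r = rate_plus \<sigma> v"
  have t: "t = 2 * r - 1" by (simp add: t_def r_def rate_plus_def field_simps)
  have r: "0 \<le> r" "r \<le> 1" using rate_plus_bounds[of \<sigma> v] by (auto simp: r_def)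
  have x: "\<bar>x\<bar> \<le> Q" unfolding x_def by (rule abs_mean_field_le[OF s v])
  have Jv: "0 \<le> J v v" "J v v \<le> Q / n" using J_nonneg J_le v by auto
  define Z where "Z = J v v * (r * (1 - \<sigma> v)\<^sup>2 + (1 - r) * (-1 - \<sigma> v)\<^sup>2)"
  have "resample v energy \<sigma> = r * energy (\<sigma>(v := 1)) + (1 - r) * energy (\<sigma>(v := -1))" by (simp add: resample_def r_def)
  also have "\<dots> = energy \<sigma> + 2 * (x * t) - 2 * \<sigma> v * x + J v v * (r * (1 - \<sigma> v)\<^sup>2 + (1 - r) * (-1 - \<sigma> v)\<^sup>2)"
    unfolding energy_resample[OF v] x_def[symmetric] t by (simp add: algebra_simps)
  finally have 1: "resample v energy \<sigma> = energy \<sigma> + 2 * (x * t) - 2 * \<sigma> v * x + Z" by (simp add: Z_def)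
  have 2: "Z \<le> Q / n * 4"
    unfolding Z_def using Jv r cf_cases[OF s v] Q_pos by (intro mult_mono) auto
  have "x * (t - tanh x) \<le> \<bar>x\<bar> * \<bar>t - tanh x\<bar>" by (metis abs_ge_self abs_mult)
  also have "\<dots> \<le> Q * (Q / n)"
    using x abs_tanh_spin_field_mean_field[OF s v] Q_pos by (intro mult_mono) (auto simp: t_def x_def)
  finally have 3: "x * t \<le> x * tanh x + Q * (Q / n)" by (simp add: algebra_simps)
  have 4: "x * tanh x \<le> x\<^sup>2 - x ^ 4 / (3 * (1 + Q)\<^sup>2)" using tanh_quartic_lower[OF x] by linarith
  have "x * t \<le> x\<^sup>2 - x ^ 4 / (3 * (1 + Q)\<^sup>2) + Q * (Q / n)" by (rule order_trans[OF 3 add_right_mono[OF 4]])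
  then have "2 * (x * t) \<le> 2 * (x\<^sup>2 - x ^ 4 / (3 * (1 + Q)\<^sup>2) + Q * (Q / n))" by (rule mult_left_mono) simp
  then have "resample v energy \<sigma> \<le> energy \<sigma> + 2 * (x\<^sup>2 - x ^ 4 / (3 * (1 + Q)\<^sup>2) + Q * (Q / n)) - 2 * \<sigma> v * x + Q / n * 4"
    unfolding 1 by (intro add_mono diff_mono order_refl 2)
  then show ?thesis
    by (simp add: x_def cD_def power2_eq_square add_divide_distrib algebra_simps)
qed

text \<open>Positive definiteness enters here through \<^term>\<open>(\<Sum>v<n. (mean_field \<sigma> v)\<^sup>2) \<le> energy \<sigma>\<close>: at the critical
  temperature the quadratic part of the drift has a sign, leaving the quartic one.\<close>

lemma glauber_op_energy_le:
  assumes s: "\<sigma> \<in> cf"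
  shows "glauber_op energy \<sigma> \<le> energy \<sigma> - c3 / (real n)\<^sup>2 * (energy \<sigma>)\<^sup>2 + cD / n"
proof -
  define k where "k = 2 / (3 * (1 + Q)\<^sup>2)"
  have k: "k \<ge> 0" by (simp add: k_def)
  have c3k: "c3 = k * (\<kappa> * \<rho>)\<^sup>2" by (simp add: k_def c3_def)
  have "(\<Sum>v<n. resample v energy \<sigma>) \<le> (\<Sum>v<n. energy \<sigma> + 2 * (mean_field \<sigma> v)\<^sup>2 - k * (mean_field \<sigma> v) ^ 4 - 2 * (\<sigma> v * mean_field \<sigma> v) + cD / n)"
    using resample_energy_le[OF s] by (intro sum_mono) (auto simp: k_def mult_ac)
  also have "\<dots> = n * energy \<sigma> + 2 * (\<Sum>v<n. (mean_field \<sigma> v)\<^sup>2) - k * (\<Sum>v<n. (mean_field \<sigma> v) ^ 4) - 2 * energy \<sigma> + cD"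
    using n_pos by (simp add: sum.distrib sum_subtractf energy_def flip: sum_distrib_left)
  finally have 1: "(\<Sum>v<n. resample v energy \<sigma>) \<le> n * energy \<sigma> - k * (\<Sum>v<n. (mean_field \<sigma> v) ^ 4) + cD"
    using sum_mean_field_sq_le[of \<sigma>] by linarith
  \<comment> \<open>The power mean inequality makes the quartic loss quadratic in
    \<open>energy\<close>, the form that the Riccati recursion requires.\<close>
  have "(\<kappa> * \<rho> * energy \<sigma>)\<^sup>2 \<le> (\<Sum>v<n. (mean_field \<sigma> v)\<^sup>2)\<^sup>2"
    using sum_mean_field_sq_ge kappa_pos rho_pos energy_nonneg by (intro power_mono) auto
  also have "\<dots> \<le> (\<Sum>v<n. (1::real)\<^sup>2) * (\<Sum>v<n. ((mean_field \<sigma> v)\<^sup>2)\<^sup>2)"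
    using Cauchy_Schwarz_ineq_sum[of "\<lambda>_. 1" "\<lambda>v. (mean_field \<sigma> v)\<^sup>2" "{..<n}"] by simp
  finally have "(\<kappa> * \<rho> * energy \<sigma>)\<^sup>2 / n \<le> (\<Sum>v<n. (mean_field \<sigma> v) ^ 4)"
    using n_pos by (simp add: field_simps)
  then have "k * ((\<kappa> * \<rho> * energy \<sigma>)\<^sup>2 / n) \<le> k * (\<Sum>v<n. (mean_field \<sigma> v) ^ 4)" by (intro mult_left_mono k)
  then have "(\<Sum>v<n. resample v energy \<sigma>) \<le> n * energy \<sigma> - k * ((\<kappa> * \<rho> * energy \<sigma>)\<^sup>2 / n) + cD" using 1 by linarith
  also have "\<dots> = n * (energy \<sigma> - c3 / (real n)\<^sup>2 * (energy \<sigma>)\<^sup>2 + cD / n)"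
    using n_pos by (simp add: c3k power_mult_distrib power2_eq_square field_simps)
  finally show ?thesis unfolding glauber_op_def using n_pos by (simp add: divide_le_eq mult_ac)
qed

text \<open>The centre \<open>c\<close> is free: 0 serves for the second moment of
  \<open>energy\<close>, the initial value for the displacement of
  \<open>perron_mag\<close>.\<close>

lemma glauber_op_sq_shift:
  "glauber_op (\<lambda>\<tau>. (f \<tau> - c)\<^sup>2) \<sigma> = (f \<sigma> - c)\<^sup>2 + 2 * (f \<sigma> - c) * (glauber_op f \<sigma> - f \<sigma>) + glauber_op (\<lambda>\<tau>. (f \<tau> - f \<sigma>)\<^sup>2) \<sigma>"
proof -
  define y where "y = f \<sigma>"
  have "(\<lambda>\<tau>. (f \<tau> - c)\<^sup>2) = (\<lambda>\<tau>. 2 * (y - c) * f \<tau> + ((y - c)\<^sup>2 - 2 * (y - c) * y) + (f \<tau> - y)\<^sup>2)"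
    by (auto simp: power2_eq_square algebra_simps)
  then have "glauber_op (\<lambda>\<tau>. (f \<tau> - c)\<^sup>2) \<sigma> = 2 * (y - c) * glauber_op f \<sigma> + ((y - c)\<^sup>2 - 2 * (y - c) * y) + glauber_op (\<lambda>\<tau>. (f \<tau> - y)\<^sup>2) \<sigma>"
    by (simp only: glauber_op_add glauber_op_cmult glauber_op_const)
  then show ?thesis by (simp add: y_def algebra_simps)
qed

lemma resample_local_le:
  assumes s: "\<sigma> \<in> cf" and v: "v < n" and "h (\<sigma>(v := 1)) \<le> B" "h (\<sigma>(v := -1)) \<le> B"
  shows "resample v h \<sigma> \<le> B"
proof -
  have "resample v h \<sigma> \<le> rate_plus \<sigma> v * B + (1 - rate_plus \<sigma> v) * B"
    unfolding resample_def using rate_plus_bounds[of \<sigma> v] assms by (intro add_mono mult_left_mono) auto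
  then show ?thesis by (simp add: algebra_simps)
qed

text \<open>Resampling \<open>v\<close> changes \<open>energy\<close> by at most
  \<open>4 * \<bar>mean_field \<sigma> v\<bar>\<close> plus a term of order \<open>1 / n\<close>, so
  the mean squared increment is of order at most \<open>(energy \<sigma> + 1) / n\<close>.\<close>

lemma glauber_op_energy_sq_le:
  assumes s: "\<sigma> \<in> cf"
  shows "glauber_op (\<lambda>\<tau>. (energy \<tau>)\<^sup>2) \<sigma> \<le> (energy \<sigma>)\<^sup>2 + cE * (energy \<sigma> + 1) / n"
proof -
  have loc: "(energy (\<sigma>(v := e)) - energy \<sigma>)\<^sup>2 \<le> 32 * (mean_field \<sigma> v)\<^sup>2 + 32 * Q\<^sup>2 / n"
    if v: "v < n" and e: "e = 1 \<or> e = -1" for v e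
  proof -
    have d: "\<bar>e - \<sigma> v\<bar> \<le> 2" using e cf_cases[OF s v] by auto
    have "\<bar>energy (\<sigma>(v := e)) - energy \<sigma>\<bar> \<le> \<bar>2 * (e - \<sigma> v) * mean_field \<sigma> v\<bar> + \<bar>J v v * (e - \<sigma> v)\<^sup>2\<bar>"
      unfolding energy_resample[OF v] using abs_triangle_ineq by simp
    also have "\<dots> \<le> 4 * \<bar>mean_field \<sigma> v\<bar> + Q / n * 4"
    proof (intro add_mono)
      show "\<bar>2 * (e - \<sigma> v) * mean_field \<sigma> v\<bar> \<le> 4 * \<bar>mean_field \<sigma> v\<bar>"
        unfolding abs_mult by (intro mult_right_mono) (use d in auto)
      have "(e - \<sigma> v)\<^sup>2 \<le> 4" using d abs_le_square_iff[of "e - \<sigma> v" 2] by simp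
      then show "\<bar>J v v * (e - \<sigma> v)\<^sup>2\<bar> \<le> Q / n * 4"
        unfolding abs_mult using J_nonneg[OF v v] J_le[OF v v] Q_pos by (intro mult_mono) auto
    qed
    finally have "(energy (\<sigma>(v := e)) - energy \<sigma>)\<^sup>2 \<le> (4 * \<bar>mean_field \<sigma> v\<bar> + Q / n * 4)\<^sup>2"
      by (intro abs_le_square_iff[THEN iffD1]) auto
    also have "\<dots> \<le> 32 * (mean_field \<sigma> v)\<^sup>2 + 32 * (Q / n)\<^sup>2"
    proof -
      have "(4 * A + B * 4)\<^sup>2 \<le> 32 * A\<^sup>2 + 32 * B\<^sup>2" for A B :: real
        using zero_le_power2[of "A - B"] by (simp add: power2_eq_square algebra_simps)
      from this[of "\<bar>mean_field \<sigma> v\<bar>" "Q / n"] show ?thesis by simp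
    qed
    also have "(Q / n)\<^sup>2 \<le> Q\<^sup>2 / n"
      using n_pos by (simp add: power_divide power2_eq_square divide_left_mono frac_le)
    finally show ?thesis by simp
  qed
  have "glauber_op (\<lambda>\<tau>. (energy \<tau> - energy \<sigma>)\<^sup>2) \<sigma> \<le> (\<Sum>v<n. 32 * (mean_field \<sigma> v)\<^sup>2 + 32 * Q\<^sup>2 / n) / n"
    unfolding glauber_op_def by (intro divide_right_mono sum_mono resample_local_le s loc) auto
  also have "\<dots> = (32 * (\<Sum>v<n. (mean_field \<sigma> v)\<^sup>2) + 32 * Q\<^sup>2) / n"
    using n_pos by (simp add: sum.distrib sum_distrib_left)
  also have "\<dots> \<le> (32 * energy \<sigma> + 32 * Q\<^sup>2) / n"
    using sum_mean_field_sq_le[of \<sigma>] by (intro divide_right_mono) auto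
  finally have 1: "glauber_op (\<lambda>\<tau>. (energy \<tau> - energy \<sigma>)\<^sup>2) \<sigma> \<le> (32 * energy \<sigma> + 32 * Q\<^sup>2) / n" .
  have "0 \<le> c3 / (real n)\<^sup>2 * (energy \<sigma>)\<^sup>2" using c3_pos by simp
  then have "glauber_op energy \<sigma> - energy \<sigma> \<le> cD / n" using glauber_op_energy_le[OF s] by linarith
  then have "2 * energy \<sigma> * (glauber_op energy \<sigma> - energy \<sigma>) \<le> 2 * energy \<sigma> * (cD / n)"
    using energy_nonneg by (intro mult_left_mono) auto
  then have "glauber_op (\<lambda>\<tau>. (energy \<tau>)\<^sup>2) \<sigma> \<le> (energy \<sigma>)\<^sup>2 + 2 * energy \<sigma> * (cD / n) + (32 * energy \<sigma> + 32 * Q\<^sup>2) / n"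
    using glauber_op_sq_shift[of energy 0 \<sigma>] 1 by simp
  moreover have "2 * energy \<sigma> * (cD / n) + (32 * energy \<sigma> + 32 * Q\<^sup>2) / n \<le> cE * (energy \<sigma> + 1) / n"
  proof -
    have "2 * energy \<sigma> * cD + (32 * energy \<sigma> + 32 * Q\<^sup>2) \<le> cE * (energy \<sigma> + 1)"
      using energy_nonneg[of \<sigma>] cD_pos by (simp add: cE_def algebra_simps)
    then have "(2 * energy \<sigma> * cD + (32 * energy \<sigma> + 32 * Q\<^sup>2)) / n \<le> cE * (energy \<sigma> + 1) / n"
      by (intro divide_right_mono) auto
    then show ?thesis by (simp add: add_divide_distrib)
  qed
  ultimately show ?thesis by linarith
qed

section \<open>Magnetization in the Perron direction\<close>

definition perron_mag :: "(nat \<Rightarrow> real) \<Rightarrow> real" where "perron_mag \<sigma> = (\<Sum>v<n. a (g v) * \<sigma> v)"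

lemma a_nonneg: "v < n \<Longrightarrow> 0 \<le> a (g v)"
  using a_ge[OF g_less] alpha_pos by (meson less_le_trans less_imp_le)

text \<open>\<open>J\<close> is symmetric and fixes the weights \<open>a (g v)\<close>; this is what
  cancels the linear drift.\<close>

lemma perron_mag_eq_mean_field: "perron_mag \<sigma> = (\<Sum>v<n. a (g v) * mean_field \<sigma> v)"
proof -
  have "(\<Sum>v<n. a (g v) * mean_field \<sigma> v) = (\<Sum>v<n. \<sigma> v * mean_field (\<lambda>v. a (g v)) v)" by (rule mean_field_symm)
  also have "\<dots> = perron_mag \<sigma>" unfolding perron_mag_def by (intro sum.cong) (auto simp: mean_field_def J_eigen)
  finally show ?thesis ..
qed

lemma perron_mag_resample: "v < n \<Longrightarrow> perron_mag (\<sigma>(v := e)) = perron_mag \<sigma> + a (g v) * (e - \<sigma> v)"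
proof -
  assume v: "v < n"
  have "perron_mag (\<sigma>(v := e)) = (\<Sum>w<n. a (g w) * \<sigma> w + (if w = v then a (g v) * (e - \<sigma> v) else 0))"
    unfolding perron_mag_def by (intro sum.cong) (auto simp: algebra_simps)
  then show ?thesis using v by (simp add: sum.distrib perron_mag_def)
qed

lemma glauber_op_perron_mag: "glauber_op perron_mag \<sigma> - perron_mag \<sigma> = (\<Sum>v<n. a (g v) * (tanh (spin_field \<sigma> v) - mean_field \<sigma> v)) / n"
proof -
  have "resample v perron_mag \<sigma> = perron_mag \<sigma> + a (g v) * (tanh (spin_field \<sigma> v) - \<sigma> v)" if "v < n" for v
    unfolding resample_def perron_mag_resample[OF that] rate_plus_def by (simp add: field_simps)
  then have "glauber_op perron_mag \<sigma> = (\<Sum>v<n. perron_mag \<sigma> + a (g v) * (tanh (spin_field \<sigma> v) - \<sigma> v)) / n"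
    by (simp add: glauber_op_def)
  also have "\<dots> = perron_mag \<sigma> + ((\<Sum>v<n. a (g v) * tanh (spin_field \<sigma> v)) - perron_mag \<sigma>) / n"
    using n_pos by (simp add: sum.distrib right_diff_distrib sum_subtractf perron_mag_def add_divide_distrib)
  also have "\<dots> = perron_mag \<sigma> + (\<Sum>v<n. a (g v) * (tanh (spin_field \<sigma> v) - mean_field \<sigma> v)) / n"
    by (subst (2) perron_mag_eq_mean_field) (simp add: right_diff_distrib sum_subtractf)
  finally show ?thesis by simp
qed

text \<open>Only \<open>tanh x - x\<close> survives, which is cubic: one factor is bounded by the
  largest mean field, the other two sum to at most \<open>energy \<sigma>\<close>. The summand
  \<open>Q\<close> comes from the diagonal of \<open>J\<close>.\<close>

lemma abs_glauber_op_perron_mag_le: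
  assumes s: "\<sigma> \<in> cf"
  shows "\<bar>glauber_op perron_mag \<sigma> - perron_mag \<sigma>\<bar> \<le> (Q + energy \<sigma> * sqrt (energy \<sigma> / (n * \<rho>))) / n"
proof -
  have "\<bar>a (g v) * (tanh (spin_field \<sigma> v) - mean_field \<sigma> v)\<bar> \<le> Q / n + (mean_field \<sigma> v)\<^sup>2 * sqrt (energy \<sigma> / (n * \<rho>))" if v: "v < n" for v
  proof -
    have "\<bar>a (g v) * (tanh (spin_field \<sigma> v) - mean_field \<sigma> v)\<bar> \<le> 1 * \<bar>tanh (spin_field \<sigma> v) - mean_field \<sigma> v\<bar>"
      unfolding abs_mult using a_nonneg[OF v] a_le_1[OF g_less[OF v]] by (intro mult_right_mono) auto
    also have "\<dots> \<le> Q / n + \<bar>mean_field \<sigma> v\<bar> ^ 3"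
    proof -
      have tri: "\<bar>y - x\<bar> \<le> \<bar>y - z\<bar> + \<bar>x - z\<bar>" for x y z :: real by linarith
      show ?thesis
        using abs_tanh_spin_field_mean_field[OF s v] abs_tanh_cubic_upper[of "mean_field \<sigma> v"]
          tri[of "tanh (spin_field \<sigma> v)" "mean_field \<sigma> v" "tanh (mean_field \<sigma> v)"] by simp
    qed
    also have "\<bar>mean_field \<sigma> v\<bar> ^ 3 = (mean_field \<sigma> v)\<^sup>2 * \<bar>mean_field \<sigma> v\<bar>"
      by (simp add: power2_eq_square power3_eq_cube abs_mult_self_eq)
    also have "\<bar>mean_field \<sigma> v\<bar> \<le> sqrt (energy \<sigma> / (n * \<rho>))"
      using mean_field_sq_le[OF v, of \<sigma>] by (intro real_le_rsqrt) simp
    finally show ?thesis by (simp add: mult_left_mono)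
  qed
  then have "\<bar>\<Sum>v<n. a (g v) * (tanh (spin_field \<sigma> v) - mean_field \<sigma> v)\<bar> \<le> (\<Sum>v<n. Q / n + (mean_field \<sigma> v)\<^sup>2 * sqrt (energy \<sigma> / (n * \<rho>)))"
    by (intro order_trans[OF sum_abs] sum_mono) auto
  also have "\<dots> = Q + (\<Sum>v<n. (mean_field \<sigma> v)\<^sup>2) * sqrt (energy \<sigma> / (n * \<rho>))"
    using n_pos by (simp add: sum.distrib sum_distrib_right)
  also have "\<dots> \<le> Q + energy \<sigma> * sqrt (energy \<sigma> / (n * \<rho>))"
    using sum_mean_field_sq_le energy_nonneg rho_pos by (intro add_left_mono mult_right_mono) auto
  finally show ?thesis unfolding glauber_op_perron_mag by (simp add: abs_divide divide_right_mono)
qed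

lemma perron_mag_eq_block_mag: "perron_mag \<sigma> = (\<Sum>i<m. a i * block_mag i \<sigma>)"
  unfolding perron_mag_def by (subst sum_blocks) (auto simp: block_mag_def sum_distrib_left intro!: sum.cong)

lemma perron_mag_sq_le: "(perron_mag \<sigma>)\<^sup>2 \<le> m * n / \<kappa> * energy \<sigma>"
proof -
  have "(perron_mag \<sigma>)\<^sup>2 \<le> (\<Sum>i<m. (a i)\<^sup>2) * (\<Sum>i<m. (block_mag i \<sigma>)\<^sup>2)"
    unfolding perron_mag_eq_block_mag by (rule Cauchy_Schwarz_ineq_sum)
  also have "\<dots> \<le> (\<Sum>i<m. 1) * (n / \<kappa> * energy \<sigma>)"
  proof (intro mult_mono sum_mono sum_block_mag_sq_le)
    fix i assume "i \<in> {..<m}"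
    then have "\<bar>a i\<bar> \<le> 1" using a_ge[of i] a_le_1[of i] alpha_pos by auto
    then show "(a i)\<^sup>2 \<le> 1" by (simp add: abs_square_le_1)
  qed (auto intro: sum_nonneg)
  finally show ?thesis by simp
qed

section \<open>Moments along the dynamics\<close>

text \<open>\<open>f\<close> and \<open>y0\<close> stand for the value of \<open>perron_mag\<close>
  and the energy at the start. While energies are of order \<open>sqrt n\<close> the increment is of
  order 1, so the displacement is diffusive.\<close>

lemma glauber_op_perron_mag_sq_le:
  assumes s: "\<sigma> \<in> cf" and y0: "0 \<le> y0" and f: "f\<^sup>2 \<le> m * n / \<kappa> * y0"
  shows "glauber_op (\<lambda>\<tau>. (perron_mag \<tau> - f)\<^sup>2) \<sigma> \<le> (perron_mag \<sigma> - f)\<^sup>2 + cG * (1 + ((energy \<sigma>)\<^sup>2 + y0\<^sup>2) / n)"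
proof -
  define W where "W = 1 + ((energy \<sigma>)\<^sup>2 + y0\<^sup>2) / n"
  define U where "U = energy \<sigma> + y0"
  define r where "r = sqrt n"
  define u where "u = sqrt U"
  define c where "c = sqrt (m / \<kappa>)"
  have U: "0 \<le> U" "energy \<sigma> \<le> U" "y0 \<le> U" using y0 energy_nonneg[of \<sigma>] by (auto simp: U_def)
  have r: "r > 0" "n = r * r" using n_pos by (auto simp: r_def)
  have u: "u \<ge> 0" "U = u * u" using U by (auto simp: u_def)
  have c: "c \<ge> 0" "m / \<kappa> = c * c" using kappa_pos by (auto simp: c_def)
  have sr: "sqrt \<rho> > 0" using rho_pos by simp
  have bd: "\<bar>z\<bar> \<le> c * r * u" if "z\<^sup>2 \<le> m * n / \<kappa> * w" "0 \<le> w" "w \<le> U" for z w :: real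
  proof -
    have "z\<^sup>2 \<le> m * n / \<kappa> * U"
      using that kappa_pos mult_left_mono[OF that(3), of "m * n / \<kappa>"] by simp
    also have "\<dots> = (m / \<kappa>) * n * U" by simp
    also have "\<dots> = (c * r * u)\<^sup>2" unfolding c(2) r(2) u(2) by (simp add: power2_eq_square mult_ac)
    finally have "\<bar>z\<bar> \<le> \<bar>c * r * u\<bar>" by (rule abs_le_square_iff[THEN iffD2])
    then show ?thesis using c r u by simp
  qed
  have "\<bar>perron_mag \<sigma>\<bar> \<le> c * r * u" by (rule bd[OF perron_mag_sq_le energy_nonneg U(2)])
  moreover have "\<bar>f\<bar> \<le> c * r * u" by (rule bd[OF f y0 U(3)])
  ultimately have A: "\<bar>perron_mag \<sigma> - f\<bar> \<le> 2 * c * r * u" by linarith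
  have B: "\<bar>glauber_op perron_mag \<sigma> - perron_mag \<sigma>\<bar> \<le> (Q + U * (u / (r * sqrt \<rho>))) / n"
  proof -
    have "sqrt (energy \<sigma> / (n * \<rho>)) \<le> u / (r * sqrt \<rho>)"
      using U rho_pos n_pos by (simp add: u_def r_def real_sqrt_divide real_sqrt_mult divide_right_mono)
    then have "energy \<sigma> * sqrt (energy \<sigma> / (n * \<rho>)) \<le> U * (u / (r * sqrt \<rho>))"
      using U energy_nonneg rho_pos by (intro mult_mono) auto
    then have "(Q + energy \<sigma> * sqrt (energy \<sigma> / (n * \<rho>))) / n \<le> (Q + U * (u / (r * sqrt \<rho>))) / n"
      by (intro divide_right_mono) auto
    then show ?thesis using abs_glauber_op_perron_mag_le[OF s] by linarith
  qed
  have "\<bar>perron_mag \<sigma> - f\<bar> * \<bar>glauber_op perron_mag \<sigma> - perron_mag \<sigma>\<bar> \<le> (2 * c * r * u) * ((Q + U * (u / (r * sqrt \<rho>))) / n)"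
    using A B c r u by (intro mult_mono) auto
  also have "\<dots> = 2 * c * (Q * (u / r) + 1 / sqrt \<rho> * (U\<^sup>2 / n))"
    unfolding r(2) u(2) using r sr by (simp add: field_simps power2_eq_square)
  also have "\<dots> \<le> 2 * c * (Q * (1 + U\<^sup>2 / n) + 1 / sqrt \<rho> * (1 + U\<^sup>2 / n))"
  proof (intro mult_left_mono add_mono)
    have "u / r \<le> 1 + (U / n)\<^sup>2"
      using sqrt_le_one_plus_sq[of "U / n"] U by (simp add: u_def r_def real_sqrt_divide)
    also have "(U / n)\<^sup>2 \<le> U\<^sup>2 / n"
      using n_pos by (simp add: power_divide power2_eq_square frac_le)
    finally show "u / r \<le> 1 + U\<^sup>2 / n" by simp
  qed (use Q_pos c sr in auto)
  also have "\<dots> = 2 * c * (Q + 1 / sqrt \<rho>) * (1 + U\<^sup>2 / n)" by (simp add: algebra_simps)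
  also have "\<dots> \<le> 2 * c * (Q + 1 / sqrt \<rho>) * (2 * W)"
  proof (intro mult_left_mono)
    have "U\<^sup>2 \<le> 2 * ((energy \<sigma>)\<^sup>2 + y0\<^sup>2)"
      using sum_squares_bound[of "energy \<sigma>" y0] by (simp add: U_def power2_sum)
    then have "U\<^sup>2 / n \<le> 2 * ((energy \<sigma>)\<^sup>2 + y0\<^sup>2) / n" by (intro divide_right_mono) auto
    then show "1 + U\<^sup>2 / n \<le> 2 * W" by (simp add: W_def)
  qed (use Q_pos c sr in auto)
  finally have AB0: "\<bar>perron_mag \<sigma> - f\<bar> * \<bar>glauber_op perron_mag \<sigma> - perron_mag \<sigma>\<bar> \<le> 2 * c * (Q + 1 / sqrt \<rho>) * (2 * W)" .
  have "2 * (2 * c * (Q + 1 / sqrt \<rho>) * (2 * W)) = 8 * c * (Q + 1 / sqrt \<rho>) * W"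
    by (simp add: algebra_simps)
  then have AB: "2 * (\<bar>perron_mag \<sigma> - f\<bar> * \<bar>glauber_op perron_mag \<sigma> - perron_mag \<sigma>\<bar>) \<le> 8 * c * (Q + 1 / sqrt \<rho>) * W"
    using mult_left_mono[OF AB0, of 2] by simp
  have loc: "(perron_mag (\<sigma>(v := e)) - perron_mag \<sigma>)\<^sup>2 \<le> 4" if v: "v < n" and e: "e = 1 \<or> e = -1" for v e
  proof -
    have "\<bar>a (g v) * (e - \<sigma> v)\<bar> \<le> 1 * 2"
      unfolding abs_mult using e cf_cases[OF s v] a_nonneg[OF v] a_le_1[OF g_less[OF v]]
      by (intro mult_mono) auto
    then show ?thesis using abs_le_square_iff[of "a (g v) * (e - \<sigma> v)" 2] by (simp add: perron_mag_resample[OF v])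
  qed
  have C: "glauber_op (\<lambda>\<tau>. (perron_mag \<tau> - perron_mag \<sigma>)\<^sup>2) \<sigma> \<le> 4"
  proof -
    have "glauber_op (\<lambda>\<tau>. (perron_mag \<tau> - perron_mag \<sigma>)\<^sup>2) \<sigma> \<le> (\<Sum>v<n. 4) / n"
      unfolding glauber_op_def by (intro divide_right_mono sum_mono resample_local_le s loc) auto
    then show ?thesis using n_pos by simp
  qed
  have "(perron_mag \<sigma> - f) * (glauber_op perron_mag \<sigma> - perron_mag \<sigma>) \<le> \<bar>perron_mag \<sigma> - f\<bar> * \<bar>glauber_op perron_mag \<sigma> - perron_mag \<sigma>\<bar>"
    by (metis abs_ge_self abs_mult)
  then have D: "2 * (perron_mag \<sigma> - f) * (glauber_op perron_mag \<sigma> - perron_mag \<sigma>) \<le> 2 * (\<bar>perron_mag \<sigma> - f\<bar> * \<bar>glauber_op perron_mag \<sigma> - perron_mag \<sigma>\<bar>)"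
    unfolding mult.assoc by (rule mult_left_mono) simp
  have "cG * W = 8 * c * (Q + 1 / sqrt \<rho>) * W + 4 * W"
    by (simp add: cG_def c_def ring_distribs)
  moreover have "4 \<le> 4 * W" by (simp add: W_def)
  ultimately show ?thesis unfolding W_def[symmetric] glauber_op_sq_shift[of perron_mag f \<sigma>] using AB C D by linarith
qed

lemma iter_op_energy_le: assumes s: "\<sigma> \<in> cf" shows "iter_op t energy \<sigma> \<le> energy \<sigma> + t * (cD / n)"
proof (induction t)
  case (Suc t)
  have "glauber_op energy \<tau> \<le> energy \<tau> + cD / n" if "\<tau> \<in> cf" for \<tau>
  proof -
    have "0 \<le> c3 / (real n)\<^sup>2 * (energy \<tau>)\<^sup>2" using c3_pos by simp
    then show ?thesis using glauber_op_energy_le[OF that] by linarith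
  qed
  then have "iter_op (Suc t) energy \<sigma> \<le> iter_op t (\<lambda>\<tau>. energy \<tau> + cD / n) \<sigma>"
    unfolding Pit_Suc' using s by (intro iter_op_mono) auto
  also have "\<dots> = iter_op t energy \<sigma> + cD / n" by (simp only: iter_op_add iter_op_const)
  finally show ?case using Suc by (simp add: algebra_simps add_divide_distrib)
qed simp

text \<open>\<open>iter_op_square_le\<close> turns the drift bound into a scalar Riccati recursion
  for the mean, which forgets its start. From time \<open>n * sqrt n\<close> on, the transient is of
  order at most \<open>sqrt n\<close>.\<close>

lemma iter_op_energy_bound:
  assumes s: "\<sigma> \<in> cf" and t: "n * sqrt n \<le> real t"
  shows "iter_op t energy \<sigma> \<le> cR * sqrt n"
proof -
  have r: "1 \<le> sqrt n" using n_pos by simp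
  have "0 < n * sqrt n" using n_pos by simp
  then have "t \<noteq> 0" using t by (intro notI) simp
  then obtain t' where t': "t = Suc t'" by (cases t) auto
  define \<epsilon> where "\<epsilon> = c3 / (real n)\<^sup>2"
  define \<delta> where "\<delta> = cD / n"
  have eps: "\<epsilon> > 0" using c3_pos n_pos by (simp add: \<epsilon>_def)
  have "iter_op (Suc i) energy \<sigma> \<le> iter_op i energy \<sigma> - \<epsilon> * (iter_op i energy \<sigma>)\<^sup>2 + \<delta>" for i
  proof -
    have "iter_op (Suc i) energy \<sigma> \<le> iter_op i (\<lambda>\<tau>. energy \<tau> - \<epsilon> * (energy \<tau>)\<^sup>2 + \<delta>) \<sigma>"
      unfolding Pit_Suc' \<epsilon>_def \<delta>_def using s by (intro iter_op_mono glauber_op_energy_le) auto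
    also have "\<dots> = iter_op i energy \<sigma> - \<epsilon> * iter_op i (\<lambda>\<tau>. (energy \<tau>)\<^sup>2) \<sigma> + \<delta>"
      by (simp only: iter_op_add iter_op_diff iter_op_cmult iter_op_const)
    finally show ?thesis
      using mult_left_mono[OF iter_op_square_le[OF s, of i energy], of \<epsilon>] eps by linarith
  qed
  then have "iter_op (Suc t') energy \<sigma> \<le> sqrt (\<delta> / \<epsilon>) + \<delta> + 1 / (\<epsilon> * real (Suc t'))"
    by (intro riccati_decay eps) (use cD_pos in \<open>auto simp: \<delta>_def\<close>)
  also have "sqrt (\<delta> / \<epsilon>) = sqrt (cD / c3) * sqrt n"
    using n_pos by (simp add: \<delta>_def \<epsilon>_def power2_eq_square flip: real_sqrt_mult)
  also have "\<delta> \<le> cD * sqrt n"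
  proof -
    have "cD / n \<le> cD / 1" using cD_pos n_pos by (intro divide_left_mono) auto
    also have "\<dots> \<le> cD * sqrt n" using cD_pos r by simp
    finally show ?thesis by (simp add: \<delta>_def)
  qed
  also have "1 / (\<epsilon> * real (Suc t')) \<le> 1 / c3 * sqrt n"
  proof -
    have "1 / (\<epsilon> * real (Suc t')) \<le> 1 / (\<epsilon> * (n * sqrt n))"
      using eps t t' n_pos by (intro divide_left_mono mult_left_mono) auto
    also have "\<epsilon> * (n * sqrt n) = c3 / sqrt n"
    proof -
      have "real n = sqrt n * sqrt n" by simp
      then show ?thesis using n_pos by (simp add: \<epsilon>_def field_simps power2_eq_square)
    qed
    finally show ?thesis by simp
  qed
  finally show ?thesis by (simp add: t' cR_def algebra_simps)
qed

lemma iter_op_energy_sq_le: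
  assumes s: "\<sigma> \<in> cf"
  shows "iter_op t (\<lambda>\<tau>. (energy \<tau>)\<^sup>2) \<sigma> \<le> (energy \<sigma>)\<^sup>2 + t / n * (cE * (energy \<sigma> + 1 + t / n * cD))"
proof (induction t)
  case (Suc t)
  have "iter_op (Suc t) (\<lambda>\<tau>. (energy \<tau>)\<^sup>2) \<sigma> \<le> iter_op t (\<lambda>\<tau>. (energy \<tau>)\<^sup>2 + (cE / n * energy \<tau> + cE / n)) \<sigma>"
    unfolding Pit_Suc' using s glauber_op_energy_sq_le
    by (intro iter_op_mono) (auto simp: distrib_left add_divide_distrib add.assoc)
  also have "\<dots> = iter_op t (\<lambda>\<tau>. (energy \<tau>)\<^sup>2) \<sigma> + (cE / n * iter_op t energy \<sigma> + cE / n)"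
    by (simp only: iter_op_add iter_op_cmult iter_op_const)
  also have "cE / n * iter_op t energy \<sigma> \<le> cE / n * (energy \<sigma> + t * (cD / n))"
    using iter_op_energy_le[OF s] cE_pos by (intro mult_left_mono) auto
  finally have "iter_op (Suc t) (\<lambda>\<tau>. (energy \<tau>)\<^sup>2) \<sigma> \<le> (energy \<sigma>)\<^sup>2 + t / n * (cE * (energy \<sigma> + 1 + t / n * cD)) + 1 / n * (cE * (energy \<sigma> + 1 + t / n * cD))"
    using Suc by (simp add: algebra_simps)
  also have "\<dots> = (energy \<sigma>)\<^sup>2 + Suc t / n * (cE * (energy \<sigma> + 1 + t / n * cD))"
    by (simp add: ring_distribs add_divide_distrib)
  also have "\<dots> \<le> (energy \<sigma>)\<^sup>2 + Suc t / n * (cE * (energy \<sigma> + 1 + Suc t / n * cD))"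
    using cE_pos cD_pos by (intro add_left_mono mult_left_mono mult_right_mono divide_right_mono) auto
  finally show ?case .
qed simp

text \<open>Up to time \<open>n * sqrt n\<close> the second moment of \<open>energy\<close> stays of
  order \<open>n\<close>, so each step adds at most a constant to the mean squared
  displacement.\<close>

lemma iter_op_perron_mag_sq_le:
  assumes s: "\<sigma> \<in> cf" and t: "real t \<le> n * sqrt n" and l: "1 \<le> L" "energy \<sigma> \<le> L * sqrt n"
  shows "iter_op t (\<lambda>\<tau>. (perron_mag \<tau> - perron_mag \<sigma>)\<^sup>2) \<sigma> \<le> t * (cG * (1 + 2 * L\<^sup>2 + cE * (L + 1 + cD)))"
  using t
proof (induction t)
  case (Suc t)
  define r where "r = sqrt n"
  have r: "1 \<le> r" "r * r = n" using n_pos by (auto simp: r_def)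
  have tn: "t / n \<le> r" using Suc.prems n_pos by (simp add: r_def field_simps)
  have Y2: "(energy \<sigma>)\<^sup>2 \<le> L\<^sup>2 * n"
  proof -
    have "(energy \<sigma>)\<^sup>2 \<le> (L * sqrt n)\<^sup>2" using l energy_nonneg by (intro power_mono) auto
    then show ?thesis by (simp add: power_mult_distrib)
  qed
  have "iter_op t (\<lambda>\<tau>. (energy \<tau>)\<^sup>2) \<sigma> \<le> (energy \<sigma>)\<^sup>2 + t / n * (cE * (energy \<sigma> + 1 + t / n * cD))"
    by (rule iter_op_energy_sq_le[OF s])
  also have "\<dots> \<le> L\<^sup>2 * n + r * (cE * (L * r + r + r * cD))"
    using Y2 tn l r cE_pos cD_pos energy_nonneg[of \<sigma>]
    by (intro add_mono mult_mono) (auto simp: r_def)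
  also have "r * (cE * (L * r + r + r * cD)) = (r * r) * (cE * (L + 1 + cD))" by (simp add: algebra_simps)
  finally have 1: "iter_op t (\<lambda>\<tau>. (energy \<tau>)\<^sup>2) \<sigma> + (energy \<sigma>)\<^sup>2 \<le> n * (2 * L\<^sup>2 + cE * (L + 1 + cD))"
    using Y2 unfolding r by (simp add: algebra_simps)
  have "iter_op (Suc t) (\<lambda>\<tau>. (perron_mag \<tau> - perron_mag \<sigma>)\<^sup>2) \<sigma>
    \<le> iter_op t (\<lambda>\<tau>. (perron_mag \<tau> - perron_mag \<sigma>)\<^sup>2 + (cG + (cG / n * (energy \<tau>)\<^sup>2 + cG / n * (energy \<sigma>)\<^sup>2))) \<sigma>"
    unfolding Pit_Suc'
  proof (intro iter_op_mono s)
    fix \<tau> assume "\<tau> \<in> cf"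
    from glauber_op_perron_mag_sq_le[OF this energy_nonneg perron_mag_sq_le, of \<sigma>]
    show "glauber_op (\<lambda>\<tau>. (perron_mag \<tau> - perron_mag \<sigma>)\<^sup>2) \<tau> \<le> (perron_mag \<tau> - perron_mag \<sigma>)\<^sup>2 + (cG + (cG / n * (energy \<tau>)\<^sup>2 + cG / n * (energy \<sigma>)\<^sup>2))"
      by (simp add: algebra_simps add_divide_distrib)
  qed
  also have "\<dots> = iter_op t (\<lambda>\<tau>. (perron_mag \<tau> - perron_mag \<sigma>)\<^sup>2) \<sigma> + cG * (1 + (iter_op t (\<lambda>\<tau>. (energy \<tau>)\<^sup>2) \<sigma> + (energy \<sigma>)\<^sup>2) / n)"
    by (simp only: iter_op_add iter_op_cmult iter_op_const) (simp add: algebra_simps add_divide_distrib)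
  also have "\<dots> \<le> t * (cG * (1 + 2 * L\<^sup>2 + cE * (L + 1 + cD))) + cG * (1 + (2 * L\<^sup>2 + cE * (L + 1 + cD)))"
    using Suc cG_pos 1 n_pos by (intro add_mono mult_left_mono) (auto simp: divide_le_eq mult_ac)
  finally show ?case by (simp add: algebra_simps)
qed simp

section \<open>Merging and the initial state of the lower bound\<close>

text \<open>Makes the scales \<open>n^(3/4)\<close> and \<open>n^(3/2)\<close> the integer powers 3
  and 6.\<close>

definition root4 :: real where "root4 = sqrt (sqrt n)"

lemma root4: "root4 \<ge> 1" "root4 ^ 4 = n" "root4\<^sup>2 = sqrt n" "root4 ^ 6 = n * sqrt n"
proof -
  show 1: "root4 \<ge> 1" using n_pos by (simp add: root4_def)
  show 2: "root4\<^sup>2 = sqrt n" by (simp add: root4_def)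
  have "root4 ^ 4 = (root4\<^sup>2)\<^sup>2" by (simp flip: power_mult)
  then show 3: "root4 ^ 4 = n" unfolding 2 by simp
  have "root4 ^ 6 = root4 ^ 4 * root4\<^sup>2" by (simp flip: power_add)
  then show "root4 ^ 6 = n * sqrt n" unfolding 2 3 .
qed

lemma iter_op_sum_block_mag_le:
  assumes s: "\<sigma> \<in> cf" and T: "n * sqrt n \<le> real T"
  shows "iter_op T (\<lambda>\<tau>. \<Sum>i<m. \<bar>block_mag i \<tau>\<bar>) \<sigma> \<le> cM * root4 ^ 3"
proof -
  \<comment> \<open>The bound \<open>\<bar>M\<bar> \<le> M^2 / (2 * x) + x / 2\<close> passes
    through \<open>iter_op\<close> linearly, and with \<open>x\<close> at the order
    \<open>n^(3/4)\<close> allowed by the energy bound it loses only a constant.\<close>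
  define x where "x = root4 ^ 3"
  have x: "x > 0" using root4(1) by (simp add: x_def)
  have "(\<Sum>i<m. \<bar>block_mag i \<tau>\<bar>) \<le> n / (2 * \<kappa> * x) * energy \<tau> + m * x / 2" for \<tau>
  proof -
    have "\<bar>block_mag i \<tau>\<bar> \<le> (block_mag i \<tau>)\<^sup>2 / (2 * x) + x / 2" for i
    proof -
      have "2 * \<bar>block_mag i \<tau>\<bar> * x \<le> (block_mag i \<tau>)\<^sup>2 + x\<^sup>2" using sum_squares_bound[of "\<bar>block_mag i \<tau>\<bar>" x] by simp
      then show ?thesis using x by (simp add: field_simps power2_eq_square)
    qed
    then have "(\<Sum>i<m. \<bar>block_mag i \<tau>\<bar>) \<le> (\<Sum>i<m. (block_mag i \<tau>)\<^sup>2 / (2 * x) + x / 2)" by (intro sum_mono)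
    also have "\<dots> = (\<Sum>i<m. (block_mag i \<tau>)\<^sup>2) / (2 * x) + m * x / 2"
      by (simp add: sum.distrib sum_divide_distrib)
    also have "\<dots> \<le> (n / \<kappa> * energy \<tau>) / (2 * x) + m * x / 2"
      using sum_block_mag_sq_le x by (intro add_right_mono divide_right_mono) auto
    finally show ?thesis by (simp add: mult_ac)
  qed
  then have "iter_op T (\<lambda>\<tau>. \<Sum>i<m. \<bar>block_mag i \<tau>\<bar>) \<sigma> \<le> iter_op T (\<lambda>\<tau>. n / (2 * \<kappa> * x) * energy \<tau> + m * x / 2) \<sigma>"
    using s by (intro iter_op_mono) auto
  also have "\<dots> = n / (2 * \<kappa> * x) * iter_op T energy \<sigma> + m * x / 2"
    by (simp only: iter_op_add iter_op_cmult iter_op_const)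
  also have "\<dots> \<le> n / (2 * \<kappa> * x) * (cR * sqrt n) + m * x / 2"
    using iter_op_energy_bound[OF s T] kappa_pos x by (intro add_right_mono mult_left_mono) auto
  also have "n / (2 * \<kappa> * x) * (cR * sqrt n) = cR / (2 * \<kappa>) * (root4 ^ 6 / x)" by (simp add: root4(4))
  also have "root4 ^ 6 / x = x"
  proof -
    have "root4 ^ 6 = x * x" by (simp add: x_def flip: power_add)
    then show ?thesis using x by simp
  qed
  finally show ?thesis by (simp add: cM_def x_def field_simps)
qed

text \<open>The first \<open>T\<close> steps bring both starts to magnetizations of order
  \<open>n^(3/4)\<close>; the last \<open>t\<close> steps smooth the observable into
  \<open>F\<close>. The two chains need no joint law, since the Lipschitz bound is averaged over one
  endpoint and then over the other.\<close>

lemma iter_op_gap_le: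
  assumes phi: "\<And>\<tau>. \<tau> \<in> cf \<Longrightarrow> \<bar>\<phi> \<tau>\<bar> \<le> 1" and s: "\<sigma> \<in> cf" and t: "\<eta> \<in> cf"
    and T: "n * sqrt n \<le> real T" and t1: "cK * (n * sqrt n) \<le> real t" and t2: "real t \<le> (real n)\<^sup>2"
  shows "iter_op (T + t) \<phi> \<sigma> - iter_op (T + t) \<phi> \<eta> \<le> 1 / 2"
proof -
  define F where "F = iter_op t \<phi>"
  define x where "x = root4 ^ 3"
  define e2 where "e2 = 2 * (1 - c0 / n) ^ t"
  define Kt where "Kt = 2 * exp cA / (c0 * cK * sqrt n)"
  define e1 where "e1 = sqrt (2 * Kt / (\<rho> * n)) + e2"
  have n1: "1 \<le> real n" using n_pos by simp
  have r: "sqrt n \<ge> 1" using n1 by simp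
  have cK0: "cK > 0" using cK_ge(1) by simp
  have x: "x \<ge> 1" "x * x = n * sqrt n" "x \<le> n"
  proof -
    show "x \<ge> 1" using root4(1) by (simp add: x_def)
    show "x * x = n * sqrt n" unfolding root4(4)[symmetric] x_def by (simp flip: power_add)
    have "root4 ^ 3 \<le> root4 ^ 4" using root4(1) by (intro power_increasing) auto
    then show "x \<le> n" unfolding root4(2) x_def .
  qed
  have c0n: "0 \<le> 1 - c0 / n" using c0_le n1 c0_pos by (simp add: field_simps)
  have e20: "e2 \<ge> 0" unfolding e2_def using c0n by simp
  have e2n: "n * e2 \<le> 4 / (c0\<^sup>2 * cK)"
  proof -
    have "(1 - c0 / n) ^ t \<le> exp (- (c0 / n)) ^ t"
      using c0n exp_ge_add_one_self[of "- (c0 / n)"] by (intro power_mono) auto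
    also have "\<dots> = exp (- (c0 * t / n))" by (simp add: mult_ac flip: exp_of_nat_mult)
    also have "\<dots> \<le> exp (- (c0 * cK * sqrt n))"
    proof -
      have "c0 * (cK * (n * sqrt n)) / n \<le> c0 * t / n"
        using t1 c0_pos by (intro divide_right_mono mult_left_mono) auto
      then show ?thesis using n_pos by simp
    qed
    \<comment> \<open>The exponent is of order \<open>sqrt n\<close>, so an inverse square already
      offsets the factor \<open>n\<close>.\<close>
    also have "\<dots> \<le> 2 / (c0 * cK * sqrt n)\<^sup>2"
      using c0_pos cK0 n_pos by (intro exp_minus_le) auto
    finally have "n * e2 \<le> n * (2 * (2 / (c0 * cK * sqrt n)\<^sup>2))"
      unfolding e2_def by (intro mult_left_mono) auto
    also have "(c0 * cK * sqrt n)\<^sup>2 = c0\<^sup>2 * cK\<^sup>2 * n" by (simp add: power_mult_distrib)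
    also have "n * (2 * (2 / (c0\<^sup>2 * cK\<^sup>2 * n))) = 4 / (c0\<^sup>2 * cK * cK)"
      using n_pos by (simp add: power2_eq_square)
    also have "\<dots> \<le> 4 / (c0\<^sup>2 * cK)"
      using c0_pos cK_ge(1) by (intro divide_left_mono) auto
    finally show ?thesis .
  qed
  have grad_sq: "grad_sq F \<tau> \<le> Kt" if "\<tau> \<in> cf" for \<tau>
  proof -
    have "grad_sq F \<tau> \<le> 2 * n * (1 + cA / (real n)\<^sup>2) ^ t / (c0 * real (Suc t))"
      unfolding F_def by (rule grad_sq_iter_op_le[OF that phi])
    also have "\<dots> \<le> 2 * n * exp cA / (c0 * (cK * (n * sqrt n)))"
    proof (intro frac_le mult_left_mono)
      have "(1 + cA / (real n)\<^sup>2) ^ t \<le> exp (cA / (real n)\<^sup>2) ^ t"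
        using cA_pos by (intro power_mono exp_ge_add_one_self) auto
      also have "\<dots> = exp (cA * (t / (real n)\<^sup>2))" by (simp add: mult_ac flip: exp_of_nat_mult)
      \<comment> \<open>Here \<open>t \<le> n^2\<close> caps the accumulated contraction
        losses.\<close>
      also have "\<dots> \<le> exp (cA * 1)"
        using t2 n_pos cA_pos by (subst exp_le_cancel_iff, intro mult_left_mono) auto
      finally show "(1 + cA / (real n)\<^sup>2) ^ t \<le> exp cA" by simp
    qed (use t1 c0_pos cK0 n_pos in auto)
    also have "\<dots> = Kt" using n_pos by (simp add: Kt_def)
    finally show ?thesis .
  qed
  have eps: "\<bar>F \<tau> - F (\<tau> \<circ> swap u v)\<bar> \<le> e2" if "u < n" "v < n" "g u = g v" "\<tau> \<in> cf" for u v \<tau>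
    unfolding F_def e2_def by (rule iter_op_swap_le[OF phi that])
  have spin_diff: "\<bar>spin_diff v F \<tau>\<bar> \<le> e1" if "v < n" "\<tau> \<in> cf" for v \<tau>
    unfolding e1_def by (rule abs_spin_diff_le[OF grad_sq eps that(2,1)])
  have e10: "e1 \<ge> 0" using spin_diff[OF n_pos s] by linarith
  define N where "N \<tau> = (\<Sum>i<m. \<bar>block_mag i \<tau>\<bar>)" for \<tau>
  \<comment> \<open>Each term depends on one endpoint only, so \<open>iter_op\<close> can be applied
    in \<open>\<tau>\<close> and then in \<open>\<tau>'\<close>.\<close>
  have Lip: "F \<tau> \<le> e1 / 2 * N \<tau> + (F \<tau>' + e1 / 2 * N \<tau>' + n * e2)" if "\<tau> \<in> cf" "\<tau>' \<in> cf" for \<tau> \<tau>'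
  proof -
    have "F \<tau> - F \<tau>' \<le> e1 / 2 * (\<Sum>i<m. \<bar>block_mag i \<tau> - block_mag i \<tau>'\<bar>) + n * e2"
      using Lipschitz_block_mag[OF spin_diff eps e20 that] by linarith
    also have "(\<Sum>i<m. \<bar>block_mag i \<tau> - block_mag i \<tau>'\<bar>) \<le> N \<tau> + N \<tau>'"
      unfolding N_def sum.distrib[symmetric] by (intro sum_mono abs_triangle_ineq4)
    finally show ?thesis using e10 by (simp add: distrib_left mult_left_mono)
  qed
  have 1: "iter_op T F \<sigma> \<le> e1 / 2 * iter_op T N \<sigma> + (F \<tau>' + e1 / 2 * N \<tau>' + n * e2)" if "\<tau>' \<in> cf" for \<tau>'
    using iter_op_mono[OF Lip[OF _ that] s, where t = T] by (simp only: iter_op_add iter_op_cmult iter_op_const)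
  have "iter_op T F \<sigma> \<le> e1 / 2 * iter_op T N \<sigma> + (iter_op T F \<eta> + e1 / 2 * iter_op T N \<eta> + n * e2)"
    using iter_op_mono[OF 1 t, where t = T] by (simp only: iter_op_add iter_op_cmult iter_op_const)
  moreover have "e1 / 2 * iter_op T N \<sigma> \<le> e1 / 2 * (cM * x)" "e1 / 2 * iter_op T N \<eta> \<le> e1 / 2 * (cM * x)"
    unfolding N_def x_def using e10 by (intro mult_left_mono iter_op_sum_block_mag_le s t T; simp)+
  ultimately have A: "iter_op T F \<sigma> - iter_op T F \<eta> \<le> e1 * (cM * x) + n * e2" by simp
  have "sqrt (2 * Kt / (\<rho> * n)) * (cM * x) \<le> 1 / 4"
  proof -
    have "2 * Kt / (\<rho> * n) = cT / cK / (x * x)"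
      unfolding x(2) cT_def Kt_def by (simp add: mult_ac)
    then have "sqrt (2 * Kt / (\<rho> * n)) = sqrt (cT / cK) / x"
      using x(1) by (simp add: real_sqrt_divide real_sqrt_mult)
    then have "sqrt (2 * Kt / (\<rho> * n)) * (cM * x) = sqrt (cT / cK * cM\<^sup>2)"
      using x(1) by (simp only: real_sqrt_mult[of "cT / cK"] real_sqrt_abs abs_of_nonneg[OF cM_nonneg]) simp
    also have "\<dots> \<le> sqrt ((1 / 4)\<^sup>2)"
      using cK_ge(2) cK0 by (intro real_sqrt_le_mono) (simp add: field_simps power2_eq_square)
    finally show ?thesis by simp
  qed
  moreover have "e2 * (cM * x) + n * e2 \<le> 1 / 4"
  proof -
    have "e2 * (cM * x) \<le> e2 * (cM * n)" using e20 cM_nonneg x(3) by (intro mult_left_mono) auto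
    then have "e2 * (cM * x) + n * e2 \<le> (cM + 1) * (n * e2)" by (simp add: algebra_simps)
    also have "\<dots> \<le> (cM + 1) * (4 / (c0\<^sup>2 * cK))" using e2n cM_nonneg by (intro mult_left_mono) auto
    also have "\<dots> = (16 * (cM + 1) / c0\<^sup>2) / cK / 4" by (simp add: divide_simps)
    also have "\<dots> \<le> cK / cK / 4" using cK_ge(3) cK0 by (intro divide_right_mono) auto
    finally show ?thesis using cK0 by simp
  qed
  ultimately have "e1 * (cM * x) + n * e2 \<le> 1 / 2" unfolding e1_def by (simp add: distrib_right)
  then show ?thesis using A by (simp add: F_def funpow_add)
qed

text \<open>Take a minimizer of \<open>perron_mag\<close> among the admissible configurations, which
  include all plus. Lowering one spin in a block of positive magnetization must leave this set, so
  the minimum is within 2 of \<open>z\<close>. The bounds \<open>-1\<close> allow for odd block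
  sizes and rule out large cancelling magnetizations.\<close>

lemma initial_config:
  assumes z: "0 < z" "z \<le> \<alpha> * n"
  obtains \<sigma> where "\<sigma> \<in> cf" "z \<le> perron_mag \<sigma>" "perron_mag \<sigma> \<le> z + 2" "\<And>i. i < m \<Longrightarrow> -1 \<le> block_mag i \<sigma>"
proof -
  define A where "A = {\<sigma> \<in> cf. z \<le> perron_mag \<sigma> \<and> (\<forall>i<m. -1 \<le> block_mag i \<sigma>)}"
  define \<sigma>0 :: "nat \<Rightarrow> real" where "\<sigma>0 = (\<lambda>v. if v < n then 1 else 0)"
  have "\<sigma>0 \<in> A"
  proof -
    have "\<alpha> * n = (\<Sum>v<n. \<alpha>)" by simp
    also have "\<dots> \<le> perron_mag \<sigma>0" unfolding perron_mag_def using a_ge g_less by (intro sum_mono) (auto simp: \<sigma>0_def)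
    finally have "z \<le> perron_mag \<sigma>0" using z by linarith
    moreover have "0 \<le> block_mag i \<sigma>0" for i unfolding block_mag_def by (intro sum_nonneg) (auto simp: \<sigma>0_def)
    then have "-1 \<le> block_mag i \<sigma>0" for i by (rule order_trans[rotated]) simp
    moreover have "\<sigma>0 \<in> cf" by (auto simp: configs_def \<sigma>0_def)
    ultimately show ?thesis by (simp add: A_def)
  qed
  moreover have fin: "finite A" by (simp add: A_def)
  ultimately have "Min (perron_mag ` A) \<in> perron_mag ` A" by (intro Min_in) auto
  then obtain \<sigma> where "Min (perron_mag ` A) = perron_mag \<sigma>" and sA: "\<sigma> \<in> A" by (rule imageE)
  then have min: "perron_mag \<sigma> \<le> perron_mag \<tau>" if "\<tau> \<in> A" for \<tau> using Min_le[of "perron_mag ` A" "perron_mag \<tau>"] fin that by simp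
  have s: "\<sigma> \<in> cf" "z \<le> perron_mag \<sigma>" "\<And>i. i < m \<Longrightarrow> -1 \<le> block_mag i \<sigma>" using sA by (auto simp: A_def)
  have "\<exists>i<m. 0 < block_mag i \<sigma>"
  proof (rule ccontr)
    assume "\<not> (\<exists>i<m. 0 < block_mag i \<sigma>)"
    then have "block_mag i \<sigma> \<le> 0" if "i < m" for i using that by (meson not_less)
    moreover have "0 \<le> a i" if "i < m" for i using a_ge[OF that] alpha_pos by linarith
    ultimately have "perron_mag \<sigma> \<le> (\<Sum>i<m. 0)" unfolding perron_mag_eq_block_mag
      by (intro sum_mono mult_nonneg_nonpos) auto
    then show False using s(2) z(1) by simp
  qed
  then obtain i where i: "i < m" "0 < block_mag i \<sigma>" by blast
  have "\<exists>v. v < n \<and> g v = i \<and> \<sigma> v = 1"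
  proof (rule ccontr)
    assume no: "\<not> (\<exists>v. v < n \<and> g v = i \<and> \<sigma> v = 1)"
    have "block_mag i \<sigma> \<le> 0" unfolding block_mag_def
    proof (rule sum_nonpos)
      fix v assume "v \<in> {v. v < n \<and> g v = i}"
      then show "\<sigma> v \<le> 0" using no cf_cases[OF s(1), of v] by auto
    qed
    then show False using i by simp
  qed
  then obtain v where v: "v < n" "g v = i" "\<sigma> v = 1" by blast
  \<comment> \<open>Magnetizations are integers, so a positive one is at least 1 and stays at least
    -1 after a flip.\<close>
  have odd: "1 \<le> block_mag i \<sigma>"
  proof -
    have "\<exists>k::int. block_mag i \<sigma> = of_int k" unfolding block_mag_def
    proof -
      have "\<sigma> w \<in> \<int>" if "w < n" for w using cf_cases[OF s(1) that] by auto
      then have "(\<Sum>v | v < n \<and> g v = i. \<sigma> v) \<in> \<int>" by (intro Ints_sum) auto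
      then show "\<exists>k::int. (\<Sum>v | v < n \<and> g v = i. \<sigma> v) = of_int k" by (auto elim: Ints_cases)
    qed
    then obtain k :: int where "block_mag i \<sigma> = of_int k" by blast
    then show ?thesis using i(2) by simp
  qed
  have F: "perron_mag (flip v \<sigma>) = perron_mag \<sigma> - 2 * a i" using perron_mag_resample[OF v(1), of \<sigma> "-1"] v by (simp add: flip_def)
  have "flip v \<sigma> \<notin> A"
  proof
    assume "flip v \<sigma> \<in> A"
    then have "0 \<ge> a i" using min F by fastforce
    then show False using a_ge[OF i(1)] alpha_pos by linarith
  qed
  moreover have "flip v \<sigma> \<in> cf" using s v by simp
  moreover have "-1 \<le> block_mag j (flip v \<sigma>)" if "j < m" for j
    using block_mag_flip[OF v(1), of j \<sigma>] v odd s(3)[OF that] by auto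
  ultimately have "perron_mag (flip v \<sigma>) < z" by (auto simp: A_def)
  then have "perron_mag \<sigma> \<le> z + 2" using F a_le_1[OF i(1)] by linarith
  then show thesis using that s by blast
qed

text \<open>With magnetizations at least -1 there is no substantial cancellation in
  \<open>perron_mag\<close>, whose weights are at least \<open>\<alpha>\<close>; it therefore
  controls every block.\<close>

lemma energy_le_of_block_mag_ge:
  assumes Mge: "\<And>i. i < m \<Longrightarrow> -1 \<le> block_mag i \<sigma>" and F: "perron_mag \<sigma> \<le> L * root4 ^ 3 + 2" and L: "1 \<le> L"
  shows "energy \<sigma> \<le> Q * (cS * L)\<^sup>2 * sqrt n"
proof -
  define S where "S = (\<Sum>i<m. \<bar>block_mag i \<sigma>\<bar>)"
  define x where "x = root4 ^ 3"
  have x: "x \<ge> 1" using root4(1) by (simp add: x_def)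
  have S0: "S \<ge> 0" by (simp add: S_def sum_nonneg)
  have "\<alpha> * (\<Sum>i<m. block_mag i \<sigma> + 1) \<le> (\<Sum>i<m. a i * (block_mag i \<sigma> + 1))"
    unfolding sum_distrib_left using a_ge Mge by (intro sum_mono mult_right_mono) force+
  also have "\<dots> = perron_mag \<sigma> + (\<Sum>i<m. a i)" by (simp add: perron_mag_eq_block_mag distrib_left sum.distrib)
  also have "(\<Sum>i<m. a i) \<le> (\<Sum>i<m. 1)" using a_le_1 by (intro sum_mono) auto
  finally have "(\<Sum>i<m. block_mag i \<sigma> + 1) \<le> (perron_mag \<sigma> + m) / \<alpha>" using alpha_pos by (simp add: field_simps)
  moreover have "S \<le> (\<Sum>i<m. block_mag i \<sigma> + 1) + m"
  proof -
    have "S \<le> (\<Sum>i<m. (block_mag i \<sigma> + 1) + 1)" unfolding S_def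
    proof (intro sum_mono)
      fix i assume "i \<in> {..<m}"
      then show "\<bar>block_mag i \<sigma>\<bar> \<le> block_mag i \<sigma> + 1 + 1" using Mge[of i] by auto
    qed
    then show ?thesis by (simp add: sum.distrib)
  qed
  moreover have "(perron_mag \<sigma> + m) / \<alpha> + m \<le> cS * (L * x)"
  proof -
    have Lx: "1 \<le> L * x" using L x by (metis mult_mono mult_1 zero_le_one order_trans)
    have "perron_mag \<sigma> + m \<le> L * x + 2 + m" using F by (simp add: x_def)
    also have "\<dots> \<le> (3 + m) * (L * x)"
      using Lx mult_left_mono[OF Lx, of "2 + real m"] by (simp add: algebra_simps)
    finally have "(perron_mag \<sigma> + m) / \<alpha> \<le> (3 + m) * (L * x) / \<alpha>" using alpha_pos by (intro divide_right_mono) auto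
    moreover have "real m \<le> m * (L * x)" using mult_left_mono[OF Lx, of "real m"] by simp
    ultimately show ?thesis by (simp add: cS_def distrib_right)
  qed
  ultimately have S: "S \<le> cS * (L * x)" by linarith
  have block_field: "\<bar>block_field \<sigma> i\<bar> \<le> Q * S / n" if "i < m" for i
  proof -
    have "\<bar>\<Sum>j<m. q i j * block_mag j \<sigma>\<bar> \<le> (\<Sum>j<m. \<bar>q i j * block_mag j \<sigma>\<bar>)" by (rule sum_abs)
    also have "\<dots> \<le> (\<Sum>j<m. Q * \<bar>block_mag j \<sigma>\<bar>)"
      using q_nonneg q_le that by (intro sum_mono) (auto simp: abs_mult intro!: mult_right_mono)
    finally show ?thesis unfolding block_field_def S_def by (simp add: abs_divide divide_right_mono sum_distrib_left)
  qed
  have "energy \<sigma> \<le> (\<Sum>i<m. \<bar>block_mag i \<sigma>\<bar> * (Q * S / n))"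
    unfolding energy_eq_block_field
  proof (intro sum_mono)
    fix i assume "i \<in> {..<m}"
    then have "\<bar>block_mag i \<sigma>\<bar> * \<bar>block_field \<sigma> i\<bar> \<le> \<bar>block_mag i \<sigma>\<bar> * (Q * S / n)" using block_field by (intro mult_left_mono) auto
    moreover have "block_mag i \<sigma> * block_field \<sigma> i \<le> \<bar>block_mag i \<sigma>\<bar> * \<bar>block_field \<sigma> i\<bar>" by (metis abs_ge_self abs_mult)
    ultimately show "block_mag i \<sigma> * block_field \<sigma> i \<le> \<bar>block_mag i \<sigma>\<bar> * (Q * S / n)" by linarith
  qed
  also have "\<dots> = S * (Q * S / n)" unfolding S_def by (rule sum_distrib_right[symmetric])
  also have "\<dots> = Q / n * S\<^sup>2" by (simp add: power2_eq_square)
  also have "\<dots> \<le> Q / n * (cS * (L * x))\<^sup>2"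
    using S S0 Q_pos by (intro mult_left_mono power_mono) auto
  also have "\<dots> = Q * (cS * L)\<^sup>2 * (root4 ^ 6 / n)"
    by (simp add: x_def power_mult_distrib flip: power_mult)
  also have "root4 ^ 6 / n = sqrt n" unfolding root4(4) using n_pos by simp
  finally show ?thesis .
qed

end

locale curie_weiss_glauber = curie_weiss +
  fixes k :: "nat \<Rightarrow> nat \<Rightarrow> real" and \<beta> :: real
  assumes q_eq: "\<And>i j. q i j = \<beta> * k i j"
begin

section \<open>Reversibility and total variation\<close>

definition gibbs_mean :: "((nat \<Rightarrow> real) \<Rightarrow> real) \<Rightarrow> real" where
  "gibbs_mean f = (\<Sum>\<sigma>\<in>cf. gibbs k g n \<beta> \<sigma> * f \<sigma>)"

lemma beta_coupling: "\<beta> * coupling k g n v w = J v w"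
  by (simp add: coupling_def J_def q_eq)

lemma beta_local_field: "\<beta> * local_field k g n \<sigma> v = spin_field \<sigma> v"
  by (simp add: local_field_def spin_field_def sum_distrib_left beta_coupling atLeast0LessThan flip: mult.assoc)

lemma glauber_step_sum:
  assumes s: "\<sigma> \<in> cf"
  shows "(\<Sum>\<tau>\<in>cf. glauber_step k g n \<beta> \<sigma> \<tau> * f \<tau>) = glauber_op f \<sigma>"
proof -
  define c where "c v \<tau> = (if \<forall>w. w \<noteq> v \<longrightarrow> \<tau> w = \<sigma> w then (1 + \<tau> v * tanh (spin_field \<sigma> v)) / 2 else 0)" for v and \<tau> :: "nat \<Rightarrow> real"
  have c: "(\<Sum>\<tau>\<in>cf. c v \<tau> * f \<tau>) = resample v f \<sigma>" if v: "v < n" for v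
  proof -
    have sub: "{\<sigma>(v := 1), \<sigma>(v := -1)} \<subseteq> cf" using s v by simp
    have "c v \<tau> = 0" if "\<tau> \<in> cf - {\<sigma>(v := 1), \<sigma>(v := -1)}" for \<tau>
    proof -
      have "\<not> (\<forall>w. w \<noteq> v \<longrightarrow> \<tau> w = \<sigma> w)"
      proof
        assume eq: "\<forall>w. w \<noteq> v \<longrightarrow> \<tau> w = \<sigma> w"
        then have "\<tau> = \<sigma>(v := \<tau> v)" by auto
        moreover have "\<tau> v = 1 \<or> \<tau> v = -1" using that cf_cases[OF _ v] by blast
        ultimately show False using that by auto
      qed
      then show ?thesis unfolding c_def by (rule if_not_P)
    qed
    then have "(\<Sum>\<tau>\<in>cf. c v \<tau> * f \<tau>) = (\<Sum>\<tau>\<in>{\<sigma>(v := 1), \<sigma>(v := -1)}. c v \<tau> * f \<tau>)"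
      using sub by (intro sum.mono_neutral_right) auto
    also have "\<sigma>(v := 1) \<noteq> \<sigma>(v := -1)" by (auto dest: fun_upd_eqD)
    then have "(\<Sum>\<tau>\<in>{\<sigma>(v := 1), \<sigma>(v := -1)}. c v \<tau> * f \<tau>) = resample v f \<sigma>"
      by (simp add: c_def resample_def rate_plus_def field_simps)
    finally show ?thesis .
  qed
  have "(\<Sum>\<tau>\<in>cf. glauber_step k g n \<beta> \<sigma> \<tau> * f \<tau>) = (\<Sum>\<tau>\<in>cf. (\<Sum>v<n. c v \<tau> * f \<tau>) / n)"
    unfolding glauber_step_def beta_local_field c_def[symmetric]
    by (simp add: atLeast0LessThan sum_distrib_right)
  also have "\<dots> = (\<Sum>v<n. \<Sum>\<tau>\<in>cf. c v \<tau> * f \<tau>) / n"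
    by (subst sum.swap) (simp add: sum_divide_distrib)
  also have "\<dots> = glauber_op f \<sigma>" by (simp add: c glauber_op_def)
  finally show ?thesis .
qed

lemma glauber_iter_sum:
  assumes s: "\<sigma> \<in> cf"
  shows "(\<Sum>\<tau>\<in>cf. glauber_iter k g n \<beta> t \<sigma> \<tau> * f \<tau>) = iter_op t f \<sigma>"
proof (induction t arbitrary: f)
  case 0
  have "(\<Sum>\<tau>\<in>cf. glauber_iter k g n \<beta> 0 \<sigma> \<tau> * f \<tau>) = (\<Sum>\<tau>\<in>cf. if \<tau> = \<sigma> then f \<tau> else 0)"
    by (intro sum.cong) auto
  then show ?case using s by simp
next
  case (Suc t)
  have "(\<Sum>\<tau>\<in>cf. glauber_iter k g n \<beta> (Suc t) \<sigma> \<tau> * f \<tau>)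
    = (\<Sum>\<tau>\<in>cf. \<Sum>\<rho>'\<in>cf. glauber_iter k g n \<beta> t \<sigma> \<rho>' * (glauber_step k g n \<beta> \<rho>' \<tau> * f \<tau>))"
    by (simp add: sum_distrib_right mult.assoc)
  also have "\<dots> = (\<Sum>\<rho>'\<in>cf. \<Sum>\<tau>\<in>cf. glauber_iter k g n \<beta> t \<sigma> \<rho>' * (glauber_step k g n \<beta> \<rho>' \<tau> * f \<tau>))"
    by (rule sum.swap)
  also have "\<dots> = (\<Sum>\<rho>'\<in>cf. glauber_iter k g n \<beta> t \<sigma> \<rho>' * glauber_op f \<rho>')"
    by (simp add: glauber_step_sum flip: sum_distrib_left)
  also have "\<dots> = iter_op t (glauber_op f) \<sigma>" by (rule Suc.IH)
  finally show ?case by (simp only: Pit_Suc')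
qed

text \<open>Differs from the Boltzmann factor by the diagonal of \<open>J\<close>, which is constant
  on spins of modulus 1 and cancels on normalizing.\<close>

definition gibbs_weight :: "(nat \<Rightarrow> real) \<Rightarrow> real" where "gibbs_weight \<sigma> = exp (energy \<sigma> / 2)"

lemma beta_hamiltonian:
  "\<beta> * hamiltonian k g n \<sigma> = energy \<sigma> / 2 - (\<Sum>v<n. J v v * (\<sigma> v)\<^sup>2) / 2"
proof -
  define h where "h = (\<lambda>(v, w). J v w * \<sigma> v * \<sigma> w)"
  define A where "A = {(v, w). v < w \<and> w < n}"
  define B where "B = {(v, w). w < v \<and> v < n}"
  define D where "D = {(v, w). v = w \<and> v < n}"
  have sq: "{..<n} \<times> {..<n} = A \<union> (B \<union> D)" by (auto simp: A_def B_def D_def)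
  have fin: "finite (A \<union> (B \<union> D))" unfolding sq[symmetric] by simp
  have H: "\<beta> * hamiltonian k g n \<sigma> = sum h A"
    by (simp add: hamiltonian_def A_def h_def sum_distrib_left case_prod_beta beta_coupling flip: mult.assoc)
  have "sum h B = sum h A"
    by (rule sum.reindex_bij_witness[where i = prod.swap and j = prod.swap])
      (auto simp: A_def B_def h_def J_sym)
  moreover have "sum h D = (\<Sum>v<n. J v v * (\<sigma> v)\<^sup>2)"
    by (rule sum.reindex_bij_witness[where i = "\<lambda>v. (v, v)" and j = fst])
      (auto simp: D_def h_def power2_eq_square)
  moreover have "energy \<sigma> = sum h ({..<n} \<times> {..<n})"
    by (simp add: energy_def mean_field_def h_def sum_distrib_left mult_ac flip: sum.cartesian_product)
  moreover have "sum h ({..<n} \<times> {..<n}) = sum h A + (sum h B + sum h D)"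
    unfolding sq using fin by (subst sum.union_disjoint; (subst sum.union_disjoint)?)
      (auto simp: A_def B_def D_def)
  ultimately show ?thesis using H by linarith
qed

lemma gibbs_eq:
  assumes "\<sigma> \<in> cf" shows "gibbs k g n \<beta> \<sigma> = gibbs_weight \<sigma> / (\<Sum>\<tau>\<in>cf. gibbs_weight \<tau>)"
proof -
  define C where "C = exp ((\<Sum>v<n. J v v) / 2)"
  have C: "C > 0" by (simp add: C_def)
  have e: "exp (\<beta> * hamiltonian k g n \<tau>) = gibbs_weight \<tau> / C" if "\<tau> \<in> cf" for \<tau>
  proof -
    have "(\<Sum>v<n. J v v * (\<tau> v)\<^sup>2) = (\<Sum>v<n. J v v)"
      using cf_cases[OF that] by (intro sum.cong) (auto simp: power2_eq_1_iff)
    then show ?thesis by (simp add: beta_hamiltonian gibbs_weight_def C_def exp_diff)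
  qed
  have "(\<Sum>\<tau>\<in>cf. exp (\<beta> * hamiltonian k g n \<tau>)) = (\<Sum>\<tau>\<in>cf. gibbs_weight \<tau>) / C"
    by (simp add: e sum_divide_distrib cong: sum.cong)
  then show ?thesis using C by (simp add: gibbs_def e assms)
qed

lemma cf_nonempty: "(\<lambda>v. if v < n then 1 else 0) \<in> cf"
  by (auto simp: configs_def)

lemma Z_pos: "(\<Sum>\<tau>\<in>cf. gibbs_weight \<tau>) > 0"
  by (rule sum_pos) (use cf_nonempty in \<open>auto simp: gibbs_weight_def\<close>)

lemma gibbs_nonneg: "\<sigma> \<in> cf \<Longrightarrow> 0 \<le> gibbs k g n \<beta> \<sigma>"
  using Z_pos by (auto simp: gibbs_eq gibbs_weight_def)

lemma gibbs_mean_eq: "gibbs_mean f = (\<Sum>\<sigma>\<in>cf. gibbs_weight \<sigma> * f \<sigma>) / (\<Sum>\<tau>\<in>cf. gibbs_weight \<tau>)"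
  by (simp add: gibbs_mean_def gibbs_eq sum_divide_distrib cong: sum.cong)

lemma gibbs_mean_const: "gibbs_mean (\<lambda>_. c) = c"
  using Z_pos by (simp add: gibbs_mean_eq flip: sum_distrib_right)

lemma gibbs_mean_add: "gibbs_mean (\<lambda>\<sigma>. f \<sigma> + h \<sigma>) = gibbs_mean f + gibbs_mean h"
  by (simp add: gibbs_mean_def distrib_left sum.distrib)

lemma gibbs_mean_cmult: "gibbs_mean (\<lambda>\<sigma>. c * f \<sigma>) = c * gibbs_mean f"
  by (simp add: gibbs_mean_def sum_distrib_left mult_ac)

lemma gibbs_mean_mono: "(\<And>\<sigma>. \<sigma> \<in> cf \<Longrightarrow> f \<sigma> \<le> h \<sigma>) \<Longrightarrow> gibbs_mean f \<le> gibbs_mean h"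
  unfolding gibbs_mean_def by (intro sum_mono mult_left_mono gibbs_nonneg) auto

lemma flip_flip [simp]: "flip v (flip v \<sigma>) = \<sigma>"
  by (auto simp: flip_def)

lemma sum_cf_pair:
  fixes f :: "(nat \<Rightarrow> real) \<Rightarrow> real"
  assumes v: "v < n"
  shows "2 * (\<Sum>\<sigma>\<in>cf. f \<sigma>) = (\<Sum>\<sigma>\<in>cf. f (\<sigma>(v := 1)) + f (\<sigma>(v := -1)))"
proof -
  have "(\<Sum>\<sigma>\<in>cf. f \<sigma>) = (\<Sum>\<sigma>\<in>cf. f (flip v \<sigma>))"
    by (rule sum.reindex_bij_witness[where i = "flip v" and j = "flip v"]) (use v in auto)
  then have "2 * (\<Sum>\<sigma>\<in>cf. f \<sigma>) = (\<Sum>\<sigma>\<in>cf. f \<sigma> + f (flip v \<sigma>))" by (simp add: sum.distrib)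
  also have "\<dots> = (\<Sum>\<sigma>\<in>cf. f (\<sigma>(v := 1)) + f (\<sigma>(v := -1)))"
  proof (intro sum.cong refl)
    fix \<sigma> assume s: "\<sigma> \<in> cf"
    from cf_cases[OF s v] show "f \<sigma> + f (flip v \<sigma>) = f (\<sigma>(v := 1)) + f (\<sigma>(v := -1))"
    proof
      assume "\<sigma> v = 1"
      then have "\<sigma>(v := 1) = \<sigma>" "flip v \<sigma> = \<sigma>(v := -1)" by (auto simp: flip_def)
      then show ?thesis by simp
    next
      assume "\<sigma> v = -1"
      then have "\<sigma>(v := -1) = \<sigma>" "flip v \<sigma> = \<sigma>(v := 1)" by (auto simp: flip_def)
      then show ?thesis by simp
    qed
  qed
  finally show ?thesis .
qed

text \<open>Heat-bath property: the two weights have ratio \<open>exp (2 * x)\<close> with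
  \<open>x\<close> the local field, and \<open>(1 + tanh x) / 2\<close> is the corresponding
  logistic probability.\<close>

lemma rate_plus_eq_gibbs_weight:
  assumes v: "v < n"
  shows "rate_plus \<sigma> v * (gibbs_weight (\<sigma>(v := 1)) + gibbs_weight (\<sigma>(v := -1))) = gibbs_weight (\<sigma>(v := 1))"
proof -
  define x where "x = spin_field \<sigma> v"
  have "mean_field (\<sigma>(v := -1)) v = spin_field (\<sigma>(v := -1)) v - J v v"
    using spin_field_eq_mean_field[OF v, of "\<sigma>(v := -1)"] by simp
  then have mean_field: "mean_field (\<sigma>(v := -1)) v = x - J v v" by (simp add: x_def spin_field_resample_same)
  have "energy (\<sigma>(v := 1)) = energy (\<sigma>(v := -1)) + 4 * x"
    using energy_resample[OF v, of "\<sigma>(v := -1)" 1] by (simp add: mean_field algebra_simps)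
  then have w: "gibbs_weight (\<sigma>(v := 1)) = gibbs_weight (\<sigma>(v := -1)) * exp (2 * x)"
    by (simp add: gibbs_weight_def add_divide_distrib flip: exp_add)
  have "tanh x = (1 - exp (- (2 * x))) / (1 + exp (- (2 * x)))" by (simp add: tanh_real_altdef)
  then have "rate_plus \<sigma> v = 1 / (1 + exp (- (2 * x)))"
  proof -
    have "1 + exp (- (2 * x)) > 0" by (simp add: add_pos_pos)
    moreover assume "tanh x = (1 - exp (- (2 * x))) / (1 + exp (- (2 * x)))"
    ultimately show ?thesis by (simp add: rate_plus_def x_def[symmetric] field_simps)
  qed
  moreover have "(1 + exp (- (2 * x))) * exp (2 * x) = exp (2 * x) + 1" by (simp add: distrib_right flip: exp_add)
  moreover have "1 + exp (- (2 * x)) > 0" by (simp add: add_pos_pos)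
  ultimately have "rate_plus \<sigma> v * (exp (2 * x) + 1) = exp (2 * x)"
    by (metis less_irrefl mult_1 nonzero_mult_div_cancel_left times_divide_eq_left)
  then have "gibbs_weight (\<sigma>(v := -1)) * (rate_plus \<sigma> v * (exp (2 * x) + 1)) = gibbs_weight (\<sigma>(v := -1)) * exp (2 * x)" by simp
  then show ?thesis unfolding w by (simp add: algebra_simps)
qed

text \<open>Each single-site update draws from the Gibbs conditional law; pairing a configuration
  with its flip shows that it preserves the Gibbs mean.\<close>

lemma gibbs_mean_glauber_op: "gibbs_mean (glauber_op f) = gibbs_mean f"
proof -
  have "(\<Sum>\<sigma>\<in>cf. gibbs_weight \<sigma> * resample v f \<sigma>) = (\<Sum>\<sigma>\<in>cf. gibbs_weight \<sigma> * f \<sigma>)" if v: "v < n" for v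
  proof -
    have same: "resample v f (\<sigma>(v := e)) = resample v f \<sigma>" for \<sigma> e by (simp add: resample_def rate_plus_resample_same)
    have "2 * (\<Sum>\<sigma>\<in>cf. gibbs_weight \<sigma> * resample v f \<sigma>) = (\<Sum>\<sigma>\<in>cf. (gibbs_weight (\<sigma>(v := 1)) + gibbs_weight (\<sigma>(v := -1))) * resample v f \<sigma>)"
      unfolding sum_cf_pair[OF v] same by (simp add: distrib_right)
    also have "\<dots> = (\<Sum>\<sigma>\<in>cf. gibbs_weight (\<sigma>(v := 1)) * f (\<sigma>(v := 1)) + gibbs_weight (\<sigma>(v := -1)) * f (\<sigma>(v := -1)))"
    proof (intro sum.cong refl)
      fix \<sigma>
      define r where "r = rate_plus \<sigma> v"
      define w1 where "w1 = gibbs_weight (\<sigma>(v := 1))"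
      define w2 where "w2 = gibbs_weight (\<sigma>(v := -1))"
      have "r * (w1 + w2) = w1" unfolding r_def w1_def w2_def by (rule rate_plus_eq_gibbs_weight[OF v])
      moreover from this have "(1 - r) * (w1 + w2) = w2" by (simp add: left_diff_distrib)
      ultimately have "(w1 + w2) * (r * f (\<sigma>(v := 1)) + (1 - r) * f (\<sigma>(v := -1)))
        = w1 * f (\<sigma>(v := 1)) + w2 * f (\<sigma>(v := -1))"
        by (metis distrib_left mult.assoc mult.commute)
      then show "(gibbs_weight (\<sigma>(v := 1)) + gibbs_weight (\<sigma>(v := -1))) * resample v f \<sigma>
        = gibbs_weight (\<sigma>(v := 1)) * f (\<sigma>(v := 1)) + gibbs_weight (\<sigma>(v := -1)) * f (\<sigma>(v := -1))"
        by (simp add: resample_def r_def w1_def w2_def)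
    qed
    also have "\<dots> = 2 * (\<Sum>\<sigma>\<in>cf. gibbs_weight \<sigma> * f \<sigma>)" unfolding sum_cf_pair[OF v] ..
    finally show ?thesis by simp
  qed
  then have eq: "(\<Sum>v<n. \<Sum>\<sigma>\<in>cf. gibbs_weight \<sigma> * resample v f \<sigma>) = n * (\<Sum>\<sigma>\<in>cf. gibbs_weight \<sigma> * f \<sigma>)" by simp
  have "(\<Sum>\<sigma>\<in>cf. gibbs_weight \<sigma> * glauber_op f \<sigma>) = (\<Sum>\<sigma>\<in>cf. \<Sum>v<n. gibbs_weight \<sigma> * resample v f \<sigma>) / n"
    by (simp add: glauber_op_def sum_distrib_left sum_divide_distrib)
  also have "(\<Sum>\<sigma>\<in>cf. \<Sum>v<n. gibbs_weight \<sigma> * resample v f \<sigma>) = n * (\<Sum>\<sigma>\<in>cf. gibbs_weight \<sigma> * f \<sigma>)"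
    by (subst sum.swap) (rule eq)
  finally show ?thesis using n_pos by (simp add: gibbs_mean_eq)
qed

lemma gibbs_mean_iter_op: "gibbs_mean (iter_op t f) = gibbs_mean f"
  by (induction t) (auto simp: gibbs_mean_glauber_op)

text \<open>The sign of the difference of the two laws is the extremal test function, and
  stationarity replaces the Gibbs mean by an average over starts. Comparing two starts therefore
  suffices; the 2 reflects that total variation is half the absolute sum.\<close>

lemma dist_stat_le:
  assumes "\<And>\<phi> \<sigma> \<eta>. (\<And>\<tau>. \<tau> \<in> cf \<Longrightarrow> \<bar>\<phi> \<tau>\<bar> \<le> 1) \<Longrightarrow> \<sigma> \<in> cf \<Longrightarrow> \<eta> \<in> cf \<Longrightarrow>
    iter_op t \<phi> \<sigma> - iter_op t \<phi> \<eta> \<le> 2 * d"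
  shows "dist_stat k g n \<beta> t \<le> d"
  unfolding dist_stat_def
proof (subst Max_le_iff)
  show "\<forall>x\<in>(\<lambda>\<sigma>. 1 / 2 * (\<Sum>\<tau>\<in>cf. \<bar>glauber_iter k g n \<beta> t \<sigma> \<tau> - gibbs k g n \<beta> \<tau>\<bar>)) ` cf. x \<le> d"
  proof safe
    fix \<sigma> assume s: "\<sigma> \<in> cf"
    define \<phi> where "\<phi> \<tau> = sgn (glauber_iter k g n \<beta> t \<sigma> \<tau> - gibbs k g n \<beta> \<tau>)" for \<tau>
    have phi: "\<bar>\<phi> \<tau>\<bar> \<le> 1" for \<tau> by (simp add: \<phi>_def abs_sgn_eq)
    have "(\<Sum>\<tau>\<in>cf. \<bar>glauber_iter k g n \<beta> t \<sigma> \<tau> - gibbs k g n \<beta> \<tau>\<bar>)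
      = (\<Sum>\<tau>\<in>cf. glauber_iter k g n \<beta> t \<sigma> \<tau> * \<phi> \<tau> - gibbs k g n \<beta> \<tau> * \<phi> \<tau>)"
      by (intro sum.cong refl) (simp add: \<phi>_def abs_sgn left_diff_distrib)
    also have "\<dots> = iter_op t \<phi> \<sigma> - gibbs_mean \<phi>" by (simp add: sum_subtractf glauber_iter_sum[OF s] gibbs_mean_def)
    also have "\<dots> = iter_op t \<phi> \<sigma> - gibbs_mean (iter_op t \<phi>)" by (simp add: gibbs_mean_iter_op)
    finally have eq: "(\<Sum>\<tau>\<in>cf. \<bar>glauber_iter k g n \<beta> t \<sigma> \<tau> - gibbs k g n \<beta> \<tau>\<bar>) = iter_op t \<phi> \<sigma> - gibbs_mean (iter_op t \<phi>)" .
    have "iter_op t \<phi> \<sigma> - 2 * d \<le> gibbs_mean (iter_op t \<phi>)"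
    proof -
      have "gibbs_mean (\<lambda>_. iter_op t \<phi> \<sigma> - 2 * d) \<le> gibbs_mean (iter_op t \<phi>)"
        using assms[OF phi s] by (intro gibbs_mean_mono) (auto simp: algebra_simps)
      then show ?thesis by (simp add: gibbs_mean_const)
    qed
    then show "1 / 2 * (\<Sum>\<tau>\<in>cf. \<bar>glauber_iter k g n \<beta> t \<sigma> \<tau> - gibbs k g n \<beta> \<tau>\<bar>) \<le> d"
      unfolding eq by (simp add: field_simps)
  qed
qed (use cf_nonempty in auto)

lemma dist_stat_ge:
  assumes d: "dist_stat k g n \<beta> t \<le> d" and phi: "\<And>\<tau>. \<tau> \<in> cf \<Longrightarrow> \<bar>\<phi> \<tau>\<bar> \<le> 1" and s: "\<sigma> \<in> cf"
  shows "iter_op t \<phi> \<sigma> - gibbs_mean \<phi> \<le> 2 * d"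
proof -
  have "iter_op t \<phi> \<sigma> - gibbs_mean \<phi> = (\<Sum>\<tau>\<in>cf. (glauber_iter k g n \<beta> t \<sigma> \<tau> - gibbs k g n \<beta> \<tau>) * \<phi> \<tau>)"
    by (simp add: sum_subtractf glauber_iter_sum[OF s] gibbs_mean_def left_diff_distrib)
  also have "\<dots> \<le> (\<Sum>\<tau>\<in>cf. \<bar>glauber_iter k g n \<beta> t \<sigma> \<tau> - gibbs k g n \<beta> \<tau>\<bar>)"
  proof (intro sum_mono)
    fix \<tau> assume "\<tau> \<in> cf"
    then have "\<bar>x * \<phi> \<tau>\<bar> \<le> \<bar>x\<bar> * 1" for x unfolding abs_mult using phi by (intro mult_left_mono) auto
    then show "(glauber_iter k g n \<beta> t \<sigma> \<tau> - gibbs k g n \<beta> \<tau>) * \<phi> \<tau> \<le> \<bar>glauber_iter k g n \<beta> t \<sigma> \<tau> - gibbs k g n \<beta> \<tau>\<bar>"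
      by (metis abs_le_D1 mult_1_right)
  qed
  also have "\<dots> = 2 * (1 / 2 * (\<Sum>\<tau>\<in>cf. \<bar>glauber_iter k g n \<beta> t \<sigma> \<tau> - gibbs k g n \<beta> \<tau>\<bar>))" by simp
  also have "1 / 2 * (\<Sum>\<tau>\<in>cf. \<bar>glauber_iter k g n \<beta> t \<sigma> \<tau> - gibbs k g n \<beta> \<tau>\<bar>) \<le> dist_stat k g n \<beta> t"
    unfolding dist_stat_def using s by (intro Max_ge) auto
  finally show ?thesis using d by simp
qed

section \<open>Doeblin minorization for every fixed size\<close>

lemma glauber_op_ge_single:
  assumes h: "\<And>\<tau>. \<tau> \<in> cf \<Longrightarrow> 0 \<le> h \<tau>" and s: "\<sigma> \<in> cf" and v: "v < n" and e: "e = 1 \<or> e = -1"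
  shows "c0 / n * h (\<sigma>(v := e)) \<le> glauber_op h \<sigma>"
proof -
  have nn: "0 \<le> h (\<sigma>(v := 1))" "0 \<le> h (\<sigma>(v := -1))" using h s v by auto
  have "c0 * h (\<sigma>(v := e)) \<le> resample v h \<sigma>"
  proof -
    have "c0 * h (\<sigma>(v := 1)) + c0 * h (\<sigma>(v := -1)) \<le> resample v h \<sigma>"
      unfolding resample_def using rate_plus_ge[OF s v] nn by (intro add_mono mult_right_mono) auto
    moreover have "0 \<le> c0 * h (\<sigma>(v := 1))" "0 \<le> c0 * h (\<sigma>(v := -1))" using nn c0_pos by auto
    ultimately show ?thesis using e by auto
  qed
  also have "\<dots> \<le> (\<Sum>w<n. resample w h \<sigma>)"
  proof (rule member_le_sum)
    fix w assume "w \<in> {..<n} - {v}"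
    then have "w < n" by simp
    then have "resample w (\<lambda>_. 0) \<sigma> \<le> resample w h \<sigma>" using h s by (intro resample_mono) auto
    then show "0 \<le> resample w h \<sigma>" by (simp add: resample_const)
  qed (use v in auto)
  finally show ?thesis by (simp add: glauber_op_def divide_right_mono)
qed

text \<open>Set the sites below \<open>j\<close> one by one, from the top. A site that is already
  correct is resampled to its own value, so the number of steps is exactly \<open>j\<close>.\<close>

lemma iter_op_ge_reach:
  assumes f: "\<And>\<tau>. \<tau> \<in> cf \<Longrightarrow> 0 \<le> f \<tau>" and t: "\<eta> \<in> cf"
    and "\<sigma> \<in> cf" and "\<And>v. v \<ge> j \<Longrightarrow> \<sigma> v = \<eta> v" and "j \<le> n"
  shows "(c0 / n) ^ j * f \<eta> \<le> iter_op j f \<sigma>"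
  using assms(3-5)
proof (induction j arbitrary: \<sigma>)
  case 0
  then have "\<sigma> = \<eta>" by auto
  then show ?case by simp
next
  case (Suc j)
  have j: "j < n" using Suc.prems by simp
  define \<sigma>' where "\<sigma>' = \<sigma>(j := \<eta> j)"
  have e: "\<eta> j = 1 \<or> \<eta> j = -1" using cf_cases[OF t j] .
  have "\<sigma>' \<in> cf" using e Suc.prems(1) j by (auto simp: \<sigma>'_def)
  moreover have "\<sigma>' v = \<eta> v" if "v \<ge> j" for v
    using Suc.prems(2)[of v] that by (auto simp: \<sigma>'_def)
  ultimately have "(c0 / n) ^ j * f \<eta> \<le> iter_op j f \<sigma>'" using Suc.IH j by simp
  then have "c0 / n * ((c0 / n) ^ j * f \<eta>) \<le> c0 / n * iter_op j f \<sigma>'"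
    using c0_pos by (intro mult_left_mono) auto
  also have "\<dots> \<le> glauber_op (iter_op j f) \<sigma>"
    unfolding \<sigma>'_def using f Suc.prems(1) j e by (intro glauber_op_ge_single iter_op_nonneg) auto
  finally show ?case by (simp add: mult.assoc)
qed

lemma iter_op_oscillation_le:
  assumes f: "\<And>\<tau>. \<tau> \<in> cf \<Longrightarrow> \<bar>f \<tau>\<bar> \<le> 1" and s: "\<sigma> \<in> cf" and t: "\<eta> \<in> cf"
  shows "iter_op (n * j) f \<sigma> - iter_op (n * j) f \<eta> \<le> 2 * (1 - (c0 / n) ^ n) ^ j"
  using s t
proof (induction j arbitrary: \<sigma> \<eta>)
  case 0
  then show ?case using f[of \<sigma>] f[of \<eta>] by simp
next
  case (Suc j)
  define F where "F = iter_op (n * j) f"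
  define \<delta> where "\<delta> = (c0 / n) ^ n"
  have "c0 / n \<le> 1" "0 \<le> c0 / n" using c0_le c0_pos n_pos by (auto simp: field_simps)
  then have dlt: "\<delta> \<le> 1" by (simp add: \<delta>_def power_le_one)
  have fin: "finite (F ` cf)" "F ` cf \<noteq> {}" using cf_nonempty by auto
  obtain lo where "lo \<in> cf" "F lo = Min (F ` cf)" using Min_in[OF fin] by force
  then have lo: "lo \<in> cf" "\<And>\<tau>. \<tau> \<in> cf \<Longrightarrow> F lo \<le> F \<tau>" using Min_le[OF fin(1)] by auto
  obtain hi where "hi \<in> cf" "F hi = Max (F ` cf)" using Max_in[OF fin] by force
  then have hi: "hi \<in> cf" "\<And>\<tau>. \<tau> \<in> cf \<Longrightarrow> F \<tau> \<le> F hi" using Max_ge[OF fin(1)] by auto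
  \<comment> \<open>Every start reaches the maximizer \<open>hi\<close> within \<open>n\<close>
    steps with probability at least \<open>\<delta>\<close>, which lifts even the smallest value of
    the next iterate above \<open>F lo\<close>.\<close>
  have "\<delta> * (F hi - F lo) \<le> iter_op n (\<lambda>\<tau>. F \<tau> - F lo) \<eta>"
    unfolding \<delta>_def by (rule iter_op_ge_reach) (use lo hi Suc.prems in \<open>auto simp: configs_def\<close>)
  also have "\<dots> = iter_op n F \<eta> - F lo" by (simp only: iter_op_diff iter_op_const)
  finally have "\<delta> * (F hi - F lo) \<le> iter_op n F \<eta> - F lo" .
  moreover have "iter_op n F \<sigma> \<le> F hi" using iter_op_mono[of F "\<lambda>_. F hi" \<sigma> n] hi Suc.prems by (simp add: iter_op_const)
  ultimately have "iter_op n F \<sigma> - iter_op n F \<eta> \<le> (1 - \<delta>) * (F hi - F lo)" by (simp add: algebra_simps)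
  also have "\<dots> \<le> (1 - \<delta>) * (2 * (1 - \<delta>) ^ j)"
    using Suc.IH[OF hi(1) lo(1)] dlt by (intro mult_left_mono) (auto simp: F_def \<delta>_def)
  finally show ?case by (simp add: F_def \<delta>_def funpow_add)
qed

section \<open>The mixing time from below\<close>

text \<open>Stationarity transfers the bound from the running chain to equilibrium.\<close>

lemma gibbs_mean_energy_le: "gibbs_mean energy \<le> cR * sqrt n"
proof -
  define T where "T = nat \<lceil>n * sqrt n\<rceil>"
  have "gibbs_mean energy = gibbs_mean (iter_op T energy)" by (simp add: gibbs_mean_iter_op)
  also have "\<dots> \<le> gibbs_mean (\<lambda>_. cR * sqrt n)"
    by (intro gibbs_mean_mono iter_op_energy_bound) (auto simp: T_def of_nat_ceiling)
  finally show ?thesis by (simp add: gibbs_mean_const)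
qed

text \<open>The test function is the sign of \<open>perron_mag \<tau> - z / 2\<close>. Its mean is
  at least 1/2 along the chain and at most -1/2 at equilibrium, a gap of 1 where distance 1/4 allows
  only 1/2. The bound on \<open>n\<close> ensures that level \<open>z\<close> is attainable.\<close>

lemma dist_stat_large:
  assumes n: "(cL / \<alpha>) ^ 4 \<le> n" and t: "real t \<le> c1 * (n * sqrt n)"
  shows "dist_stat k g n \<beta> t > 1 / 4"
proof (rule ccontr)
  assume "\<not> dist_stat k g n \<beta> t > 1 / 4"
  then have d: "dist_stat k g n \<beta> t \<le> 1 / 4" by simp
  define z where "z = cL * root4 ^ 3"
  have z: "z > 0" using cL_ge_1 root4(1) by (simp add: z_def)
  have z2: "z\<^sup>2 = cL\<^sup>2 * (n * sqrt n)"
    unfolding root4(4)[symmetric] z_def by (simp add: power_mult_distrib flip: power_mult)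
  have nn: "n * sqrt n > 0" using n_pos by simp
  have "cL / \<alpha> \<le> root4"
  proof (rule power_le_imp_le_base)
    show "(cL / \<alpha>) ^ Suc 3 \<le> root4 ^ Suc 3" using n by (simp add: root4(2))
  qed (use root4(1) in simp)
  then have "cL \<le> \<alpha> * root4" using alpha_pos by (simp add: field_simps)
  then have "z \<le> \<alpha> * root4 * root4 ^ 3" unfolding z_def using root4(1) by (intro mult_right_mono) auto
  also have "\<alpha> * root4 * root4 ^ 3 = \<alpha> * n" unfolding root4(2)[symmetric] by (simp add: power_numeral_reduce)
  finally have "z \<le> \<alpha> * n" .
  then obtain \<sigma> where s: "\<sigma> \<in> cf" "z \<le> perron_mag \<sigma>" "perron_mag \<sigma> \<le> z + 2" "\<And>i. i < m \<Longrightarrow> -1 \<le> block_mag i \<sigma>"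
    using initial_config[OF z] by blast
  have energy: "energy \<sigma> \<le> cl * sqrt n"
  proof -
    have "energy \<sigma> \<le> Q * (cS * cL)\<^sup>2 * sqrt n"
      using s(3) cL_ge_1 unfolding z_def by (intro energy_le_of_block_mag_ge s(4)) auto
    also have "\<dots> \<le> cl * sqrt n" by (simp add: cl_def distrib_right)
    finally show ?thesis .
  qed
  define C where "C = cG * (1 + 2 * cl\<^sup>2 + cE * (cl + 1 + cD))"
  have C: "C > 0"
    unfolding C_def using cG_pos cl_ge_1 cE_pos cD_pos
    by (intro mult_pos_pos add_pos_nonneg mult_nonneg_nonneg) auto
  have c1: "c1 \<le> 1" "c1 * (16 * C) \<le> cL\<^sup>2"
  proof -
    show "c1 \<le> 1" by (simp add: c1_def)
    have "c1 \<le> cL\<^sup>2 / (16 * C)" by (simp add: c1_def C_def mult.assoc)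
    then show "c1 * (16 * C) \<le> cL\<^sup>2" using C by (simp add: field_simps)
  qed
  have t': "real t \<le> n * sqrt n"
    using t mult_right_mono[OF c1(1), of "n * sqrt n"] by simp
  have G: "iter_op t (\<lambda>\<tau>. (perron_mag \<tau> - perron_mag \<sigma>)\<^sup>2) \<sigma> \<le> t * C"
    unfolding C_def by (rule iter_op_perron_mag_sq_le[OF s(1) t' cl_ge_1 energy])
  have frac: "8 / z\<^sup>2 * E \<le> 1 / 2" if "8 * E \<le> z\<^sup>2 / 2" for E using z that by (simp add: field_simps)
  define \<phi> where "\<phi> \<tau> = (if perron_mag \<tau> > z / 2 then 1 else -1 :: real)" for \<tau>
  \<comment> \<open>Chebyshev's inequality in pointwise form, ready for
    \<open>iter_op_mono\<close>.\<close>
  have phi1: "1 + (- (8 / z\<^sup>2)) * (perron_mag \<tau> - perron_mag \<sigma>)\<^sup>2 \<le> \<phi> \<tau>" for \<tau>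
  proof (cases "perron_mag \<tau> > z / 2")
    case False
    then have "z / 2 \<le> perron_mag \<sigma> - perron_mag \<tau>" using s(2) by linarith
    then have "(z / 2)\<^sup>2 \<le> (perron_mag \<sigma> - perron_mag \<tau>)\<^sup>2" using z by (intro power_mono) auto
    then have "z\<^sup>2 \<le> 4 * (perron_mag \<tau> - perron_mag \<sigma>)\<^sup>2" by (simp add: power2_commute power_divide)
    then have "2 \<le> 8 / z\<^sup>2 * (perron_mag \<tau> - perron_mag \<sigma>)\<^sup>2" using z by (simp add: field_simps)
    then show ?thesis using False by (simp add: \<phi>_def)
  qed (simp add: \<phi>_def)
  have phi2: "\<phi> \<tau> \<le> -1 + 8 / z\<^sup>2 * (perron_mag \<tau>)\<^sup>2" for \<tau>
  proof (cases "perron_mag \<tau> > z / 2")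
    case True
    then have "(z / 2)\<^sup>2 \<le> (perron_mag \<tau>)\<^sup>2" using z by (intro power_mono) auto
    then have "z\<^sup>2 \<le> 4 * (perron_mag \<tau>)\<^sup>2" by (simp add: power_divide)
    then have "2 \<le> 8 / z\<^sup>2 * (perron_mag \<tau>)\<^sup>2" using z by (simp add: field_simps)
    then show ?thesis using True by (simp add: \<phi>_def)
  qed (simp add: \<phi>_def)
  have "iter_op t \<phi> \<sigma> - gibbs_mean \<phi> \<le> 2 * (1 / 4)" by (rule dist_stat_ge[OF d _ s(1)]) (simp add: \<phi>_def)
  moreover have "1 - 8 / z\<^sup>2 * (t * C) \<le> iter_op t \<phi> \<sigma>"
  proof -
    have "iter_op t (\<lambda>\<tau>. 1 + (- (8 / z\<^sup>2)) * (perron_mag \<tau> - perron_mag \<sigma>)\<^sup>2) \<sigma> \<le> iter_op t \<phi> \<sigma>"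
      using s(1) phi1 by (intro iter_op_mono) auto
    then have "1 + (- (8 / z\<^sup>2)) * iter_op t (\<lambda>\<tau>. (perron_mag \<tau> - perron_mag \<sigma>)\<^sup>2) \<sigma> \<le> iter_op t \<phi> \<sigma>"
      by (simp only: iter_op_add iter_op_cmult iter_op_const)
    moreover have "8 / z\<^sup>2 * iter_op t (\<lambda>\<tau>. (perron_mag \<tau> - perron_mag \<sigma>)\<^sup>2) \<sigma> \<le> 8 / z\<^sup>2 * (t * C)"
      using G by (intro mult_left_mono) auto
    ultimately show ?thesis by simp
  qed
  moreover have "8 / z\<^sup>2 * (t * C) \<le> 1 / 2"
  proof -
    have "8 * (t * C) \<le> 8 * (c1 * (n * sqrt n) * C)" using t C by simp
    also have "\<dots> = (c1 * (16 * C)) * (n * sqrt n) / 2" by simp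
    also have "\<dots> \<le> cL\<^sup>2 * (n * sqrt n) / 2" using c1(2) by (intro divide_right_mono mult_right_mono) auto
    finally show ?thesis unfolding z2[symmetric] by (intro frac) simp
  qed
  moreover have "gibbs_mean \<phi> \<le> -1 + 8 / z\<^sup>2 * (m * n / \<kappa> * (cR * sqrt n))"
  proof -
    have "gibbs_mean \<phi> \<le> gibbs_mean (\<lambda>\<tau>. -1 + 8 / z\<^sup>2 * (m * n / \<kappa> * energy \<tau>))"
    proof (rule gibbs_mean_mono)
      fix \<tau>
      have "8 / z\<^sup>2 * (perron_mag \<tau>)\<^sup>2 \<le> 8 / z\<^sup>2 * (m * n / \<kappa> * energy \<tau>)" by (intro mult_left_mono perron_mag_sq_le) auto
      then show "\<phi> \<tau> \<le> -1 + 8 / z\<^sup>2 * (m * n / \<kappa> * energy \<tau>)" using phi2[of \<tau>] by linarith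
    qed
    also have "\<dots> = -1 + 8 / z\<^sup>2 * (m * n / \<kappa> * gibbs_mean energy)" by (simp only: gibbs_mean_add gibbs_mean_cmult gibbs_mean_const)
    also have "8 / z\<^sup>2 * (m * n / \<kappa> * gibbs_mean energy) \<le> 8 / z\<^sup>2 * (m * n / \<kappa> * (cR * sqrt n))"
      using gibbs_mean_energy_le kappa_pos by (intro mult_left_mono) auto
    finally show ?thesis by simp
  qed
  moreover have "8 / z\<^sup>2 * (m * n / \<kappa> * (cR * sqrt n)) \<le> 1 / 2"
  proof -
    have "8 * (m * n / \<kappa> * (cR * sqrt n)) = (16 * m * cR / \<kappa>) * (n * sqrt n) / 2" by simp
    also have "\<dots> \<le> cL\<^sup>2 * (n * sqrt n) / 2"
      unfolding cL_sq by (intro divide_right_mono mult_right_mono) auto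
    finally show ?thesis unfolding z2[symmetric] by (intro frac) simp
  qed
  ultimately show False by linarith
qed

text \<open>The law at time 0 is a point mass, and all plus and all minus cannot both be close to
  one measure. For small \<open>n\<close> this gives the lower bound on the mixing time.\<close>

lemma dist_stat_0: "dist_stat k g n \<beta> 0 > 1 / 4"
proof (rule ccontr)
  assume "\<not> dist_stat k g n \<beta> 0 > 1 / 4"
  then have d: "dist_stat k g n \<beta> 0 \<le> 1 / 4" by simp
  define \<sigma> :: "nat \<Rightarrow> real" where "\<sigma> = (\<lambda>v. if v < n then 1 else 0)"
  define \<eta> :: "nat \<Rightarrow> real" where "\<eta> = (\<lambda>v. if v < n then -1 else 0)"
  have cf: "\<sigma> \<in> cf" "\<eta> \<in> cf" by (auto simp: configs_def \<sigma>_def \<eta>_def)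
  have "iter_op 0 (\<lambda>\<tau>. \<tau> 0) \<sigma> - gibbs_mean (\<lambda>\<tau>. \<tau> 0) \<le> 2 * (1 / 4)"
    by (rule dist_stat_ge[OF d _ cf(1)]) (simp add: abs_spin n_pos)
  moreover have "iter_op 0 (\<lambda>\<tau>. (-1) * \<tau> 0) \<eta> - gibbs_mean (\<lambda>\<tau>. (-1) * \<tau> 0) \<le> 2 * (1 / 4)"
    by (rule dist_stat_ge[OF d _ cf(2)]) (simp add: abs_spin n_pos)
  ultimately show False unfolding gibbs_mean_cmult by (simp add: \<sigma>_def \<eta>_def n_pos)
qed

section \<open>Bounds for fixed parameters\<close>

text \<open>Besides treating small \<open>n\<close>, this shows that the minimum defining
  \<open>mixing_time\<close> is taken over a nonempty set.\<close>

lemma dist_stat_doeblin_steps: "dist_stat k g n \<beta> (n * doeblin_steps n) \<le> 1 / 4"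
proof (rule dist_stat_le)
  fix \<phi> :: "(nat \<Rightarrow> real) \<Rightarrow> real" and \<sigma> \<eta>
  assume "\<And>\<tau>. \<tau> \<in> cf \<Longrightarrow> \<bar>\<phi> \<tau>\<bar> \<le> 1" "\<sigma> \<in> cf" "\<eta> \<in> cf"
  then have "iter_op (n * doeblin_steps n) \<phi> \<sigma> - iter_op (n * doeblin_steps n) \<phi> \<eta> \<le> 2 * (1 - (c0 / n) ^ n) ^ doeblin_steps n"
    by (rule iter_op_oscillation_le)
  then show "iter_op (n * doeblin_steps n) \<phi> \<sigma> - iter_op (n * doeblin_steps n) \<phi> \<eta> \<le> 2 * (1 / 4)" using doeblin_steps[OF n_pos] by linarith
qed

lemma mixing_time_le_large:
  assumes n: "(cK + 1)\<^sup>2 \<le> n"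
  shows "real (mixing_time k g n \<beta>) \<le> (cK + 3) * (n * sqrt n)"
proof -
  define T where "T = nat \<lceil>n * sqrt n\<rceil>"
  define t where "t = nat \<lceil>cK * (n * sqrt n)\<rceil>"
  have n1: "1 \<le> real n" using n_pos by simp
  have r: "1 \<le> n * sqrt n" using mult_mono[OF n1, of 1 "sqrt n"] n1 by simp
  have K: "1 \<le> cK * (n * sqrt n)" using mult_mono[OF cK_ge(1) r] cK_ge(1) by simp
  have T: "n * sqrt n \<le> T" "real T \<le> n * sqrt n + 1" using r unfolding T_def by linarith+
  have t: "cK * (n * sqrt n) \<le> t" "real t \<le> cK * (n * sqrt n) + 1" using K unfolding t_def by linarith+
  \<comment> \<open>From here on \<open>t \<le> n^2\<close> follows, the range in which the gradient
    bound holds with a fixed constant.\<close>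
  have "cK + 1 \<le> sqrt n" using n by (rule real_le_rsqrt)
  then have "(cK + 1) * (n * sqrt n) \<le> sqrt n * (n * sqrt n)" using n1 by (intro mult_right_mono) auto
  also have "\<dots> = (real n)\<^sup>2" by (simp add: power2_eq_square)
  finally have "cK * (n * sqrt n) + n * sqrt n \<le> (real n)\<^sup>2" by (simp add: distrib_right)
  then have t2: "real t \<le> (real n)\<^sup>2" using t(2) r by linarith
  have "dist_stat k g n \<beta> (T + t) \<le> 1 / 4"
  proof (rule dist_stat_le)
    fix \<phi> :: "(nat \<Rightarrow> real) \<Rightarrow> real" and \<sigma> \<eta>
    assume "\<And>\<tau>. \<tau> \<in> cf \<Longrightarrow> \<bar>\<phi> \<tau>\<bar> \<le> 1" "\<sigma> \<in> cf" "\<eta> \<in> cf"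
    from iter_op_gap_le[OF this T(1) t(1) t2]
    show "iter_op (T + t) \<phi> \<sigma> - iter_op (T + t) \<phi> \<eta> \<le> 2 * (1 / 4)" by simp
  qed
  then have "mixing_time k g n \<beta> \<le> T + t" unfolding mixing_time_def by (rule Least_le)
  then have "real (mixing_time k g n \<beta>) \<le> real T + real t" by linarith
  also have "\<dots> \<le> (cK + 3) * (n * sqrt n)" using T t r by (simp add: distrib_right)
  finally show ?thesis .
qed

text \<open>Below the threshold on \<open>n\<close>, \<open>n * sqrt n\<close> is at most
  \<open>(cL / \<alpha>) ^ 6\<close>, so a mixing time of at least 1 suffices.\<close>

lemma mixing_time_ge:
  "min c1 ((\<alpha> / cL) ^ 6) * (n * sqrt n) \<le> real (mixing_time k g n \<beta>)"
proof -
  define t where "t = mixing_time k g n \<beta>"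
  have d: "dist_stat k g n \<beta> t \<le> 1 / 4"
    unfolding t_def mixing_time_def by (rule LeastI) (rule dist_stat_doeblin_steps)
  have nn: "0 \<le> n * sqrt n" by simp
  show ?thesis
  proof (cases "(cL / \<alpha>) ^ 4 \<le> n")
    case True
    then have "c1 * (n * sqrt n) < real t" using dist_stat_large[OF True, of t] d by linarith
    moreover have "min c1 ((\<alpha> / cL) ^ 6) * (n * sqrt n) \<le> c1 * (n * sqrt n)"
      using nn by (intro mult_right_mono) auto
    ultimately show ?thesis by (simp add: t_def)
  next
    case False
    have ca: "cL / \<alpha> > 0" "\<alpha> / cL > 0" using cL_ge_1 alpha_pos by auto
    have "root4 \<le> cL / \<alpha>"
    proof (rule power_le_imp_le_base)
      show "root4 ^ Suc 3 \<le> (cL / \<alpha>) ^ Suc 3" using False by (simp add: root4(2))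
    qed (use ca in simp)
    then have "\<alpha> / cL * root4 \<le> 1" using cL_ge_1 alpha_pos by (simp add: field_simps)
    moreover have "0 \<le> \<alpha> / cL * root4" using ca root4(1) by (intro mult_nonneg_nonneg) auto
    ultimately have "(\<alpha> / cL * root4) ^ 6 \<le> 1" by (intro power_le_one)
    then have "(\<alpha> / cL) ^ 6 * (n * sqrt n) \<le> 1" by (simp only: power_mult_distrib root4(4))
    moreover have "min c1 ((\<alpha> / cL) ^ 6) * (n * sqrt n) \<le> (\<alpha> / cL) ^ 6 * (n * sqrt n)"
      using nn by (intro mult_right_mono) auto
    moreover have "t \<noteq> 0" using d dist_stat_0 by (metis not_less)
    then have "1 \<le> real t" by simp
    ultimately show ?thesis by (simp add: t_def)
  qed
qed

end

text \<open>Stated outside the locale that fixes \<open>n\<close> and \<open>g\<close>, so that the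
  constants are chosen first. The sum \<open>D\<close> over all small sizes dominates each Doeblin
  bound.\<close>

lemma (in curie_weiss_params) mixing_time_order:
  assumes q_eq: "\<And>i j. q i j = \<beta> * k i j"
  obtains C1 C2 where "C1 > 0" "C2 > 0"
    "\<And>n g. curie_weiss m p a q Q \<rho> \<alpha> \<kappa> n g \<Longrightarrow> C1 * (n * sqrt n) \<le> real (mixing_time k g n \<beta>) \<and>
      real (mixing_time k g n \<beta>) \<le> C2 * (n * sqrt n)"
proof -
  define N where "N = nat \<lceil>(cK + 1)\<^sup>2\<rceil>"
  define D where "D = (\<Sum>i<N. real (i * doeblin_steps i))"
  have D: "D \<ge> 0" by (simp add: D_def sum_nonneg)
  have "min c1 ((\<alpha> / cL) ^ 6) > 0" using c1_pos alpha_pos cL_ge_1 by auto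
  moreover have "cK + 3 + D > 0" using D cK_ge(1) by linarith
  moreover have "min c1 ((\<alpha> / cL) ^ 6) * (n * sqrt n) \<le> real (mixing_time k g n \<beta>) \<and>
      real (mixing_time k g n \<beta>) \<le> (cK + 3 + D) * (n * sqrt n)"
    if curie_weiss: "curie_weiss m p a q Q \<rho> \<alpha> \<kappa> n g" for n g
  proof -
    interpret curie_weiss m p a q Q \<rho> \<alpha> \<kappa> n g by (rule curie_weiss)
    interpret curie_weiss_glauber m p a q Q \<rho> \<alpha> \<kappa> n g k \<beta> by unfold_locales (rule q_eq)
    have n1: "1 \<le> real n" using n_pos by simp
    have r: "1 \<le> n * sqrt n" using mult_mono[OF n1, of 1 "sqrt n"] n1 by simp
    have "real (mixing_time k g n \<beta>) \<le> (cK + 3 + D) * (n * sqrt n)"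
    proof (cases "(cK + 1)\<^sup>2 \<le> n")
      case True
      have "(cK + 3) * (n * sqrt n) \<le> (cK + 3 + D) * (n * sqrt n)" using D by (intro mult_right_mono) auto
      then show ?thesis using mixing_time_le_large[OF True] by linarith
    next
      case False
      then have "n < N" unfolding N_def by linarith
      have "mixing_time k g n \<beta> \<le> n * doeblin_steps n"
        unfolding mixing_time_def by (rule Least_le) (rule dist_stat_doeblin_steps)
      then have "real (mixing_time k g n \<beta>) \<le> real (n * doeblin_steps n)" by (simp only: of_nat_le_iff)
      also have "\<dots> \<le> D" unfolding D_def by (rule member_le_sum) (use \<open>n < N\<close> in auto)
      also have "\<dots> \<le> (cK + 3 + D) * 1" using cK_ge(1) by simp
      also have "\<dots> \<le> (cK + 3 + D) * (n * sqrt n)" using r D cK_ge(1) by (intro mult_left_mono) auto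
      finally show ?thesis .
    qed
    then show ?thesis using mixing_time_ge by blast
  qed
  ultimately show ?thesis by (rule that)
qed

theorem theorem3p2:
  fixes m :: nat and p :: "nat \<Rightarrow> real" and k :: "nat \<Rightarrow> nat \<Rightarrow> real" and a :: "nat \<Rightarrow> real"
  assumes "m \<ge> 1"
    and "\<forall>i<m. p i > 0" and "(\<Sum>i<m. p i) = 1"
    and "\<forall>i<m. \<forall>j<m. k i j > 0" and "\<forall>i<m. \<forall>j<m. k i j = k j i"
    and "pos_def_mat m k"
    and "left_perron_vec m p k a"
  shows "\<exists>C1>0. \<exists>C2>0. \<forall>(n::nat) (g::nat \<Rightarrow> nat).
     n \<ge> 1 \<longrightarrow> (\<forall>i<m. real n * p i \<in> \<nat>) \<longrightarrow> (\<forall>v<n. g v < m) \<longrightarrow>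
     (\<forall>i<m. real (card {v\<in>{0..<n}. g v = i}) = real n * p i) \<longrightarrow>
       C1 * real n powr (3/2) \<le> real (mixing_time k g n (beta_cr m p k a)) \<and>
       real (mixing_time k g n (beta_cr m p k a)) \<le> C2 * real n powr (3/2)"
proof -
  define \<beta> where "\<beta> = beta_cr m p k a"
  define q where "q i j = \<beta> * k i j" for i j
  define \<rho> where "\<rho> = Min (p ` {..<m})"
  define \<alpha> where "\<alpha> = Min (a ` {..<m})"
  define Q where "Q = (\<Sum>i<m. \<Sum>j<m. q i j)"
  have m: "{..<m} \<noteq> {}" "0 < m" using assms(1) by (auto simp: lessThan_empty_iff)
  have a: "\<And>i. i < m \<Longrightarrow> a i > 0" "(\<Sum>i<m. a i) = 1" using assms(7) by (auto simp: left_perron_vec_def)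
  obtain r where r: "\<And>j. j < m \<Longrightarrow> (\<Sum>i<m. a i * (p i * k i j)) = r * a j"
    using assms(7) by (auto simp: left_perron_vec_def)
  \<comment> \<open>As \<open>a\<close> sums to 1, the sum in \<open>beta_cr\<close> is the Perron
    eigenvalue \<open>r\<close>, so \<open>\<beta> = 1 / r\<close> normalizes it to 1.\<close>
  have "(\<Sum>i<m. \<Sum>j<m. a i * p i * k i j) = (\<Sum>j<m. \<Sum>i<m. a i * (p i * k i j))"
    by (subst sum.swap) (simp add: mult.assoc)
  also have "\<dots> = r" using a(2) by (simp add: r flip: sum_distrib_left)
  finally have sum_r: "(\<Sum>i<m. \<Sum>j<m. a i * p i * k i j) = r" .
  then have beta: "\<beta> = 1 / r" by (simp add: \<beta>_def beta_cr_def)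
  have r_pos: "r > 0" unfolding sum_r[symmetric]
    using m a assms(2,4) by (intro sum_pos) auto
  then have beta_pos: "\<beta> > 0" by (simp add: beta)
  have q_pos: "q i j > 0" if "i < m" "j < m" for i j using that assms(4) beta_pos by (simp add: q_def)
  obtain \<kappa> where kap: "\<kappa> > 0" "\<And>x. \<kappa> * (\<Sum>i<m. (x i)\<^sup>2) \<le> (\<Sum>i<m. \<Sum>j<m. x i * k i j * x j)"
    using pos_def_mat_coercive[OF assms(6)] by blast
  have "curie_weiss_params m p a q Q \<rho> \<alpha> (\<beta> * \<kappa>)"
  proof
    show "\<rho> > 0" unfolding \<rho>_def using m assms(2) by (subst Min_gr_iff) auto
    show "\<rho> \<le> p i" if "i < m" for i unfolding \<rho>_def using that by simp
    show "\<alpha> > 0" unfolding \<alpha>_def using m a by (subst Min_gr_iff) auto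
    show "\<alpha> \<le> a i" if "i < m" for i unfolding \<alpha>_def using that by simp
    show "a i \<le> 1" if "i < m" for i
      unfolding a(2)[symmetric] using that a(1) by (intro member_le_sum) (auto simp: less_imp_le)
    show "0 \<le> q i j" if "i < m" "j < m" for i j using q_pos[OF that] by simp
    show "q i j \<le> Q" if "i < m" "j < m" for i j
    proof -
      have "q i j \<le> (\<Sum>j<m. q i j)" using that q_pos by (intro member_le_sum) (auto simp: less_imp_le)
      also have "\<dots> \<le> Q" unfolding Q_def using that q_pos
        by (intro member_le_sum[of i "{..<m}" "\<lambda>i. \<Sum>j<m. q i j"] sum_nonneg) (auto simp: less_imp_le)
      finally show ?thesis .
    qed
    show "q i j = q j i" if "i < m" "j < m" for i j using assms(5) that by (simp add: q_def)
    show "(\<Sum>j<m. q i j * p j * a j) = a i" if "i < m" for i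
    proof -
      \<comment> \<open>Symmetry of \<open>k\<close> turns the left eigenvector equation into the
        right one required of \<open>q\<close>.\<close>
      have "(\<Sum>j<m. q i j * p j * a j) = \<beta> * (\<Sum>j<m. a j * (p j * k j i))"
        unfolding sum_distrib_left using assms(5) that by (intro sum.cong) (auto simp: q_def)
      then show ?thesis using r_pos by (simp add: r[OF that] beta)
    qed
    show "\<beta> * \<kappa> > 0" using kap beta_pos by simp
    show "\<beta> * \<kappa> * (\<Sum>i<m. (x i)\<^sup>2) \<le> (\<Sum>i<m. \<Sum>j<m. x i * q i j * x j)" for x
    proof -
      have "\<beta> * (\<kappa> * (\<Sum>i<m. (x i)\<^sup>2)) \<le> \<beta> * (\<Sum>i<m. \<Sum>j<m. x i * k i j * x j)"
        using kap(2) beta_pos by (intro mult_left_mono) auto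
      then show ?thesis by (simp add: q_def sum_distrib_left mult_ac)
    qed
    show "Q > 0" unfolding Q_def using m q_pos by (intro sum_pos) auto
  qed
  then interpret curie_weiss_params m p a q Q \<rho> \<alpha> "\<beta> * \<kappa>" .
  obtain C1 C2 where C: "C1 > 0" "C2 > 0"
    and order: "\<And>n g. curie_weiss m p a q Q \<rho> \<alpha> (\<beta> * \<kappa>) n g \<Longrightarrow>
      C1 * (n * sqrt n) \<le> real (mixing_time k g n \<beta>) \<and> real (mixing_time k g n \<beta>) \<le> C2 * (n * sqrt n)"
    using mixing_time_order[of \<beta> k] q_def by blast
  have "C1 * real n powr (3/2) \<le> real (mixing_time k g n (beta_cr m p k a)) \<and>
      real (mixing_time k g n (beta_cr m p k a)) \<le> C2 * real n powr (3/2)"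
    if n: "n \<ge> 1" and g: "\<forall>v<n. g v < m"
      and card: "\<forall>i<m. real (card {v \<in> {0..<n}. g v = i}) = real n * p i" for n :: nat and g :: "nat \<Rightarrow> nat"
  proof -
    have "curie_weiss m p a q Q \<rho> \<alpha> (\<beta> * \<kappa>) n g"
    proof
      show "n > 0" using n by simp
      show "g v < m" if "v < n" for v using g that by blast
      show "real (card {v. v < n \<and> g v = i}) = real n * p i" if "i < m" for i using card that by simp
    qed
    note o = order[OF this]
    have "real n powr (3 / 2) = real n powr (1 + 1 / 2)" by simp
    also have "\<dots> = n * sqrt n" using n by (simp only: powr_add) (simp add: powr_half_sqrt)
    finally have "real n powr (3 / 2) = n * sqrt n" .
    then show ?thesis using o by (simp only: \<beta>_def)
  qed
  then show ?thesis using C by blast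
qed

end
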